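(* Let $d\ge2$, let $\Gamma<\mathsf{PGL}_d(\mathbb R)$ be a projective Anosov subgroup with limit set $L_\Gamma\subset\mathbb P(\mathbb R^d)$, let $p\in\{1,\dots,d-1\}$, and assume that $\dim_{\mathrm{Hff}}(L_\Gamma)\ge p$. Then $$\dim_{\mathrm{Hff}}(L_\Gamma)\le p\,h_\Gamma(\mathcal J^u_p).$$
   Context: Fix a scalar product on $\mathbb R^d$; for $g\in\mathsf{PGL}_d(\mathbb R)$ (represented by a matrix with $|\det|=1$) let $\sigma_1(g)\ge\dots\ge\sigma_d(g)$ be the singular values and $a(g)=(\log\sigma_1(g),\dots,\log\sigma_d(g))\in E=\{a\in\mathbb R^d:\sum a_i=0\}$. Projective Anosov: $\Gamma$ is finitely generated and, for a word length $|\cdot|$, there are $c,\mu>0$ with $\frac{\sigma_2}{\sigma_1}(\gamma)\le ce^{-\mu|\gamma|}$ for all $\gamma\in\Gamma$. Then $\Gamma$ is word-hyperbolic and there is a continuous equivariant injective map $\xi^1:\partial\Gamma\to\mathbb P(\mathbb R^d)$, $\xi^1(x)=\lim_iU_1(\alpha_i)$ for any geodesic ray $(\alpha_i)$ from the identity to $x$, where $U_1(g)$ is the line spanned by the major axis of the ellipsoid $\{gv:\|v\|=1\}$. The limit set is $L_\Gamma=\xi^1(\partial\Gamma)$. $\dim_{\mathrm{Hff}}$ is Hausdorff dimension for the distance $d([v],[w])=\sin\angle(v,w)$. Put $\omega_k(a)=a_1+\dots+a_k$. The $p$-th unstable Jacobian is $\mathcal J^u_p=(p+1)\omega_1-\omega_{p+1}\in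 E^*$. Critical exponent: $h_\Gamma(\varphi)=\limsup_{T\to\infty}\frac1T\log\#\{\gamma\in\Gamma:\varphi(a(\gamma))<T\}$; thus $h_\Gamma(\mathcal J^u_p)$ is the critical exponent of $s\mapsto\sum_{\gamma\in\Gamma}\big(\frac{\sigma_1\cdots\sigma_{p+1}}{\sigma_1^{p+1}}(\gamma)\big)^s$. *)

theory Defs
  imports "HOL-Analysis.Analysis" "HOL-Algebra.Coset" "HOL-Algebra.Generated_Groups"
begin

section \<open>The projective linear group\<close>

definition GL :: "(real^'n^'n) monoid" where
  "GL = \<lparr>carrier = {A. invertible A}, mult = (**), one = mat 1\<rparr>"

definition scalar_matrices :: "(real^'n^'n) set" where
  "scalar_matrices = {c *\<^sub>R mat 1 |c. c \<noteq> 0}"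

text \<open>An element of \<open>PGL\<close> is a coset, i.e. the set of all matrices representing it.\<close>

definition PGL :: "(real^'n^'n) set monoid" where
  "PGL = GL Mod scalar_matrices"

text \<open>A representing matrix with determinant of absolute value 1; it is unique up to sign.\<close>

definition unimod_rep :: "(real^'n^'n) set \<Rightarrow> real^'n^'n" where
  "unimod_rep \<gamma> = (SOME A. A \<in> \<gamma> \<and> \<bar>det A\<bar> = 1)"

lemma group_GL: "group (GL :: (real^'n^'n) monoid)"
proof (rule groupI)
  fix A :: "real^'n^'n" assume "A \<in> carrier GL"
  then obtain B where "A ** B = mat 1" "B ** A = mat 1"
    by (auto simp: GL_def invertible_def)
  then show "\<exists>B\<in>carrier GL. B \<otimes>\<^bsub>GL\<^esub> A = \<one>\<^bsub>GL\<^esub>"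
    by (auto simp: GL_def invertible_def intro!: bexI[of _ B])
next
  show "\<one>\<^bsub>GL\<^esub> \<in> carrier (GL :: (real^'n^'n) monoid)"
    by (auto simp: GL_def invertible_def intro!: exI[of _ "mat 1"])
qed (auto simp: GL_def matrix_mul_assoc invertible_mult)

lemma scalar_matrices_normal: "scalar_matrices \<lhd> (GL :: (real^'n^'n) monoid)"
proof -
  interpret group "GL :: (real^'n^'n) monoid" by (rule group_GL)
  have inv1: "invertible (c *\<^sub>R (mat 1 :: real^'n^'n))" if "c \<noteq> 0" for c
    unfolding invertible_def using that
    by (intro exI[of _ "inverse c *\<^sub>R mat 1"])
       (simp add: scalar_matrix_assoc matrix_scalar_ac)
  have "subgroup (scalar_matrices :: (real^'n^'n) set) GL"
  proof (rule subgroupI)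
    show "scalar_matrices \<subseteq> carrier (GL :: (real^'n^'n) monoid)"
      by (auto simp: scalar_matrices_def GL_def inv1)
    show "(scalar_matrices :: (real^'n^'n) set) \<noteq> {}"
      by (auto simp: scalar_matrices_def intro!: exI[of _ 1])
  next
    fix A :: "real^'n^'n" assume "A \<in> scalar_matrices"
    then obtain c where c: "c \<noteq> 0" "A = c *\<^sub>R mat 1" by (auto simp: scalar_matrices_def)
    have "inv\<^bsub>GL\<^esub> A = inverse c *\<^sub>R mat 1"
      using c by (intro inv_equality)
        (auto simp: GL_def inv1 scalar_matrix_assoc matrix_scalar_ac)
    with c show "inv\<^bsub>GL\<^esub> A \<in> scalar_matrices" by (auto simp: scalar_matrices_def)
  next
    fix A B :: "real^'n^'n" assume "A \<in> scalar_matrices" "B \<in> scalar_matrices"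
    then obtain c c' where "c \<noteq> 0" "A = c *\<^sub>R mat 1" "c' \<noteq> 0" "B = c' *\<^sub>R mat 1"
      by (auto simp: scalar_matrices_def)
    then show "A \<otimes>\<^bsub>GL\<^esub> B \<in> scalar_matrices"
      by (auto simp: scalar_matrices_def GL_def scalar_matrix_assoc matrix_scalar_ac
               intro!: exI[of _ "c * c'"])
  qed
  moreover have "A \<otimes>\<^bsub>GL\<^esub> B = B \<otimes>\<^bsub>GL\<^esub> A"
    if "A \<in> scalar_matrices" for A B :: "real^'n^'n"
    using that by (auto simp: scalar_matrices_def GL_def matrix_scalar_ac
        simp flip: scalar_matrix_assoc)
  ultimately show ?thesis
    by (intro normalI) (auto simp: r_coset_def l_coset_def)
qed

lemma group_PGL: "group (PGL :: (real^'n^'n) set monoid)"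
  unfolding PGL_def by (rule normal.factorgroup_is_group[OF scalar_matrices_normal])

section \<open>Scalar products, singular values and the Cartan projection\<close>

definition is_scalar_product :: "(real^'n \<Rightarrow> real^'n \<Rightarrow> real) \<Rightarrow> bool" where
  "is_scalar_product B \<longleftrightarrow> bilinear B \<and> (\<forall>v w. B v w = B w v) \<and> (\<forall>v. v \<noteq> 0 \<longrightarrow> B v v > 0)"

definition sp_norm :: "(real^'n \<Rightarrow> real^'n \<Rightarrow> real) \<Rightarrow> real^'n \<Rightarrow> real" where
  "sp_norm B v = sqrt (B v v)"

definition sp_adjoint :: "(real^'n \<Rightarrow> real^'n \<Rightarrow> real) \<Rightarrow> real^'n^'n \<Rightarrow> real^'n^'n" where
  "sp_adjoint B A = (THE A'. \<forall>v w. B (A *v v) w = B v (A' *v w))"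

text \<open>The singular values are the square roots of the eigenvalues of \<open>A\<^sup>* A\<close>, listed in
  decreasing order at the indices \<open>1, \<dots>, d\<close> and repeated according to multiplicity:
  a number \<open>t \<ge> 0\<close> occurs as often as the dimension of the eigenspace for \<open>t\<^sup>2\<close>.
  Outside \<open>1, \<dots>, d\<close> the value is 0, to make the sequence unique.\<close>

definition singular_value ::
    "(real^'n \<Rightarrow> real^'n \<Rightarrow> real) \<Rightarrow> real^'n^'n \<Rightarrow> nat \<Rightarrow> real" where
  "singular_value B A = (THE s.
     (\<forall>i. i \<notin> {1..CARD('n)} \<longrightarrow> s i = 0) \<and>
     (\<forall>i\<in>{1..CARD('n)}. s i \<ge> 0) \<and>
     (\<forall>i\<in>{1..CARD('n)}. \<forall>j\<in>{1..CARD('n)}. i \<le> j \<longrightarrow> s j \<le> s i) \<and>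
     (\<forall>t\<ge>0. card {i\<in>{1..CARD('n)}. s i = t} =
            dim {v. (sp_adjoint B A ** A) *v v = t\<^sup>2 *\<^sub>R v}))"

abbreviation sv ::
    "(real^'n \<Rightarrow> real^'n \<Rightarrow> real) \<Rightarrow> (real^'n^'n) set \<Rightarrow> nat \<Rightarrow> real" where
  "sv B \<gamma> \<equiv> singular_value B (unimod_rep \<gamma>)"

text \<open>Vectors of \<open>E \<subseteq> \<real>\<^sup>d\<close> are sequences, of which only the entries at \<open>1, \<dots>, d\<close> matter.\<close>

definition cartan :: "(real^'n \<Rightarrow> real^'n \<Rightarrow> real) \<Rightarrow> (real^'n^'n) set \<Rightarrow> nat \<Rightarrow> real" where
  "cartan B \<gamma> i = ln (sv B \<gamma> i)"

definition omega :: "nat \<Rightarrow> (nat \<Rightarrow> real) \<Rightarrow> real" where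
  "omega k a = (\<Sum>i=1..k. a i)"

definition unstable_jacobian :: "nat \<Rightarrow> (nat \<Rightarrow> real) \<Rightarrow> real" where
  "unstable_jacobian p a = real (p + 1) * omega 1 a - omega (p + 1) a"

definition ln_card :: "'a set \<Rightarrow> ereal" where
  "ln_card X = (if finite X then ereal (ln (real (card X))) else \<infinity>)"

definition critical_exponent ::
    "(real^'n \<Rightarrow> real^'n \<Rightarrow> real) \<Rightarrow> (real^'n^'n) set set \<Rightarrow> ((nat \<Rightarrow> real) \<Rightarrow> real) \<Rightarrow> ereal"
  where
  "critical_exponent B \<Gamma> \<phi> =
     Limsup at_top (\<lambda>T::real. ereal (1 / T) * ln_card {\<gamma>\<in>\<Gamma>. \<phi> (cartan B \<gamma>) < T})"

section \<open>Word length and boundary at infinity\<close>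

definition finite_gen_set :: "('g, 'm) monoid_scheme \<Rightarrow> 'g set \<Rightarrow> 'g set \<Rightarrow> bool" where
  "finite_gen_set G H S \<longleftrightarrow> finite S \<and> S \<subseteq> H \<and> generate G S = H"

definition word_length :: "('g, 'm) monoid_scheme \<Rightarrow> 'g set \<Rightarrow> 'g \<Rightarrow> nat" where
  "word_length G S x = (LEAST n. \<exists>xs. length xs = n \<and>
     set xs \<subseteq> S \<union> (\<lambda>s. inv\<^bsub>G\<^esub> s) ` S \<and> foldr (\<otimes>\<^bsub>G\<^esub>) xs \<one>\<^bsub>G\<^esub> = x)"

definition word_dist :: "('g, 'm) monoid_scheme \<Rightarrow> 'g set \<Rightarrow> 'g \<Rightarrow> 'g \<Rightarrow> nat" where
  "word_dist G S x y = word_length G S (inv\<^bsub>G\<^esub> x \<otimes>\<^bsub>G\<^esub> y)"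

text \<open>Geodesic rays in the subgroup \<open>H\<close> of \<open>G\<close> generated by \<open>S\<close>, starting at the identity.\<close>

definition geodesic_rays :: "('g, 'm) monoid_scheme \<Rightarrow> 'g set \<Rightarrow> 'g set \<Rightarrow> (nat \<Rightarrow> 'g) set" where
  "geodesic_rays G H S = {\<alpha>. \<alpha> 0 = \<one>\<^bsub>G\<^esub> \<and> range \<alpha> \<subseteq> H \<and>
     (\<forall>i j. i \<le> j \<longrightarrow> word_dist G S (\<alpha> i) (\<alpha> j) = j - i)}"

definition asymptotic_rel ::
    "('g, 'm) monoid_scheme \<Rightarrow> 'g set \<Rightarrow> 'g set \<Rightarrow> ((nat \<Rightarrow> 'g) \<times> (nat \<Rightarrow> 'g)) set" where
  "asymptotic_rel G H S = {(\<alpha>, \<beta>). \<alpha> \<in> geodesic_rays G H S \<and> \<beta> \<in> geodesic_rays G H S \<and>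
     (\<exists>C. \<forall>i. word_dist G S (\<alpha> i) (\<beta> i) \<le> C)}"

text \<open>The Gromov boundary: asymptoty classes of geodesic rays from the identity.\<close>

definition gromov_boundary ::
    "('g, 'm) monoid_scheme \<Rightarrow> 'g set \<Rightarrow> 'g set \<Rightarrow> (nat \<Rightarrow> 'g) set set" where
  "gromov_boundary G H S = geodesic_rays G H S // asymptotic_rel G H S"

section \<open>Projective Anosov subgroups\<close>

definition projective_anosov ::
    "(real^'n \<Rightarrow> real^'n \<Rightarrow> real) \<Rightarrow> (real^'n^'n) set set \<Rightarrow> bool" where
  "projective_anosov B \<Gamma> \<longleftrightarrow> subgroup \<Gamma> PGL \<and>
     (\<exists>S. finite_gen_set PGL \<Gamma> S \<and>
       (\<exists>c>0. \<exists>\<mu>>0. \<forall>\<gamma>\<in>\<Gamma>.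
          sv B \<gamma> 2 / sv B \<gamma> 1 \<le> c * exp (- \<mu> * real (word_length PGL S \<gamma>))))"

section \<open>Projective space and the limit set\<close>

text \<open>Points of projective space are the one-dimensional linear subspaces.\<close>

definition proj_space :: "(real^'n) set set" where
  "proj_space = {L. subspace L \<and> dim L = 1}"

definition sp_angle :: "(real^'n \<Rightarrow> real^'n \<Rightarrow> real) \<Rightarrow> real^'n \<Rightarrow> real^'n \<Rightarrow> real" where
  "sp_angle B v w = arccos (B v w / (sp_norm B v * sp_norm B w))"

text \<open>The sine below does not depend on the chosen nonzero vectors of \<open>L\<close> and \<open>M\<close>.\<close>

definition proj_dist ::
    "(real^'n \<Rightarrow> real^'n \<Rightarrow> real) \<Rightarrow> (real^'n) set \<Rightarrow> (real^'n) set \<Rightarrow> real" where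
  "proj_dist B L M = sin (sp_angle B (SOME v. v \<in> L \<and> v \<noteq> 0) (SOME w. w \<in> M \<and> w \<noteq> 0))"

text \<open>The line spanned by a longest vector of the ellipsoid \<open>{A v | \<parallel>v\<parallel> = 1}\<close>. This line is
  uniquely determined only if the first two singular values differ.\<close>

definition U1 :: "(real^'n \<Rightarrow> real^'n \<Rightarrow> real) \<Rightarrow> (real^'n^'n) set \<Rightarrow> (real^'n) set" where
  "U1 B \<gamma> = span {arg_max_on (sp_norm B) {unimod_rep \<gamma> *v v |v. sp_norm B v = 1}}"

definition xi1 ::
    "(real^'n \<Rightarrow> real^'n \<Rightarrow> real) \<Rightarrow> (nat \<Rightarrow> (real^'n^'n) set) set \<Rightarrow> (real^'n) set" where
  "xi1 B x = (THE L. L \<in> proj_space \<and>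
     (\<forall>\<alpha>\<in>x. (\<lambda>i. proj_dist B (U1 B (\<alpha> i)) L) \<longlonglongrightarrow> 0))"

text \<open>The boundary is modelled with the word metric of \<open>S\<close>.\<close>

definition limit_set ::
    "(real^'n \<Rightarrow> real^'n \<Rightarrow> real) \<Rightarrow> (real^'n^'n) set set \<Rightarrow> (real^'n^'n) set set
       \<Rightarrow> (real^'n) set set" where
  "limit_set B \<Gamma> S = xi1 B ` gromov_boundary PGL \<Gamma> S"

section \<open>Hausdorff dimension in a space \<open>X\<close> with distance function \<open>d\<close>\<close>

definition ediam :: "('a \<Rightarrow> 'a \<Rightarrow> real) \<Rightarrow> 'a set \<Rightarrow> ennreal" where
  "ediam d U = (SUP x\<in>U. SUP y\<in>U. ennreal (d x y))"

text \<open>Only used for \<open>s > 0\<close>, so that sets of diameter 0 contribute \<open>0 powr s = 0\<close>;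
  all diameters that occur are finite.\<close>

definition hausdorff_premeasure ::
    "'a set \<Rightarrow> ('a \<Rightarrow> 'a \<Rightarrow> real) \<Rightarrow> real \<Rightarrow> real \<Rightarrow> 'a set \<Rightarrow> ennreal" where
  "hausdorff_premeasure X d s \<delta> A =
     (INF U \<in> {U :: nat \<Rightarrow> 'a set. A \<subseteq> (\<Union>i. U i) \<and>
                  (\<forall>i. U i \<subseteq> X \<and> ediam d (U i) \<le> ennreal \<delta>)}.
        \<Sum>i. ennreal (enn2real (ediam d (U i)) powr s))"

definition hausdorff_measure ::
    "'a set \<Rightarrow> ('a \<Rightarrow> 'a \<Rightarrow> real) \<Rightarrow> real \<Rightarrow> 'a set \<Rightarrow> ennreal" where
  "hausdorff_measure X d s A = (SUP \<delta>\<in>{0<..}. hausdorff_premeasure X d s \<delta> A)"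

definition hausdorff_dim :: "'a set \<Rightarrow> ('a \<Rightarrow> 'a \<Rightarrow> real) \<Rightarrow> 'a set \<Rightarrow> ereal" where
  "hausdorff_dim X d A = Inf {ereal s |s. s > 0 \<and> hausdorff_measure X d s A = 0}"

end

theory Submission
  imports Defs
begin

text \<open>
The limit set is covered by shadows of the group elements of word length \<open>n\<close>, and every shadow is cut
into small cubes. Let \<open>\<sigma>\<^sub>1 \<ge> \<sigma>\<^sub>2 \<ge> \<dots>\<close> be the singular values of \<open>\<gamma>\<close> and \<open>f\<^sub>1, f\<^sub>2, \<dots>\<close> the axes of
the image of the unit ball. If a geodesic ray passes through \<open>\<gamma>\<close>, then its limit point is spanned by a
unit vector \<open>y\<close> with \<open>\<bar>y \<bullet> f\<^sub>k\<bar> \<le> D \<sigma>\<^sub>k / \<sigma>\<^sub>1\<close> for all \<open>k\<close>, where \<open>D\<close> does not depend on the ray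
(\<open>limit_set_shadow\<close>). In the chart given by the coordinates \<open>2, \<dots>, d\<close> such vectors fill a box, which
is covered by cubes of side \<open>x = \<sigma>\<^sub>p\<^sub>+\<^sub>1 / \<sigma>\<^sub>1\<close>; up to a constant, their number is the product of
\<open>\<sigma>\<^sub>k / \<sigma>\<^sub>p\<^sub>+\<^sub>1\<close> over \<open>2 \<le> k \<le> p\<close> (\<open>shadow_covered\<close>). With \<open>J\<close> the \<open>p\<close>-th unstable Jacobian
of \<open>\<gamma>\<close> and \<open>Q = exp (- J)\<close>, which is the product of \<open>\<sigma>\<^sub>k / \<sigma>\<^sub>1\<close> over \<open>2 \<le> k \<le> p + 1\<close>, the number of
cubes is \<open>Q / x\<^sup>p\<close>, so that \<open>\<gamma>\<close> contributes \<open>Q x powr (s - p)\<close> to the \<open>s\<close>-dimensional premeasure.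

Clearly \<open>x\<^sup>p \<le> Q \<le> x\<close>. Hence the contribution is at most \<open>Q powr t = exp (- t J)\<close> both for \<open>s = p t\<close>
with \<open>t \<ge> 1\<close> and for \<open>s = p - 1 + t\<close> with \<open>t \<le> 1\<close>. If \<open>t\<close> exceeds the critical exponent \<open>h\<close>, the sum of
\<open>exp (- t J)\<close> over the elements of length \<open>n\<close> tends to 0, because \<open>J\<close> grows at least linearly in \<open>n\<close>
(\<open>sum_exp_tail\<close>); so the \<open>s\<close>-dimensional measure vanishes (\<open>hausdorff_measure_zero\<close>). When \<open>h < 1\<close>,
some \<open>t < 1\<close> shows that the dimension is smaller than \<open>p\<close>, against the assumption; when \<open>h \<ge> 1\<close>,
letting \<open>t\<close> decrease to \<open>h\<close> bounds the dimension by \<open>p h\<close>.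

The shadow estimate rests on the fact that the operator norm is almost multiplicative along geodesics:
\<open>\<sigma>\<^sub>1(g) \<sigma>\<^sub>1(h) \<le> D \<sigma>\<^sub>1(g h)\<close> when \<open>g h\<close> is cut out of a geodesic at any place
(\<open>chain_almost_multiplicative\<close>). The loss \<open>\<sigma>\<^sub>1(g h) / (\<sigma>\<^sub>1(g) \<sigma>\<^sub>1(h))\<close> is, up to exponentially small
errors, the cosine of the angle between the direction that \<open>g\<close> stretches most and the major axis of the
image of the ball under \<open>h\<close>. These two directions hardly move when the factors become longer. If the
cosine were almost 0 at one place of a geodesic, it would therefore be almost 0 along a long window, and
every product taken within the window would lose a factor exponential in the length of its shorter
half. Halving the window repeatedly, the logarithm of the norm of the whole product would fall below every
fixed negative multiple of its length, which is impossible, as each letter shrinks vectors by a bounded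
factor only (\<open>almost_additive\<close>).
\<close>

section \<open>Almost additive arrays\<close>

text \<open>The array \<open>a i j\<close> is meant to be the logarithm of the norm of a product of matrices with indices in
\<open>{i..<j}\<close>. The last hypothesis on \<open>a\<close> says that a large defect \<open>a i j + a j k - a i k\<close> is inherited by all
shorter products that meet at \<open>j\<close>, up to the precision allowed by their lengths. Moving \<open>j\<close> by one
changes the defect by at most \<open>2 \<kappa>\<close>, so a defect larger than \<open>D\<close> persists in a window of length \<open>W = 2\<^sup>r\<close>
to the right of \<open>j\<close>. There the defect of a product of two halves of length \<open>2\<^sup>s\<close> is at least
\<open>\<mu> 2\<^sup>s - c\<close>, and adding these gains over all dyadic scales contradicts \<open>a j (j + W) \<ge> - \<kappa> W\<close>.\<close>

lemma almost_additive:
  fixes \<kappa> \<mu> C :: real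
  assumes \<kappa>: "\<kappa> > 0" and \<mu>: "\<mu> > 0" and C: "C \<ge> 0"
  shows "\<exists>D. \<forall>a :: nat \<Rightarrow> nat \<Rightarrow> real.
    (\<forall>i. a i i = 0) \<longrightarrow>
    (\<forall>i j. i \<le> j \<longrightarrow> \<bar>a i (Suc j) - a i j\<bar> \<le> \<kappa>) \<longrightarrow>
    (\<forall>i j. i < j \<longrightarrow> \<bar>a i j - a (Suc i) j\<bar> \<le> \<kappa>) \<longrightarrow>
    (\<forall>i i' j k' k. i \<le> i' \<and> i' \<le> j \<and> j \<le> k' \<and> k' \<le> k \<longrightarrow>
       exp (a i' k' - a i' j - a j k') \<le> exp (a i k - a i j - a j k)
         + C * exp (- \<mu> * real (j - i')) + C * exp (- \<mu> * real (k' - j))) \<longrightarrow>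
    (\<forall>i j k. i \<le> j \<and> j \<le> k \<longrightarrow> a i j + a j k \<le> a i k + D)"
proof -
  define c where "c = ln (1 + 2 * C)"
  have c0: "c \<ge> 0" using C by (simp add: c_def)
  \<comment> \<open>The number of scales is chosen so large that the total gain \<open>\<mu> r W / 2\<close> exceeds
    \<open>(2 \<kappa> + c) W\<close>; the bound \<open>D\<close> leaves \<open>\<mu> W\<close> after \<open>W\<close> moves of the cutting point.\<close>
  obtain r :: nat where r: "real r > 2 * (2 * \<kappa> + c) / \<mu>" using reals_Archimedean2 by blast
  define W where "W = (2::nat) ^ r"
  define D where "D = (2 * \<kappa> + \<mu>) * real W"
  show ?thesis
  proof (rule exI[of _ D], intro allI impI)
    fix a :: "nat \<Rightarrow> nat \<Rightarrow> real" and i j k :: nat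
    assume diag: "\<forall>i. a i i = 0"
      and right: "\<forall>i j. i \<le> j \<longrightarrow> \<bar>a i (Suc j) - a i j\<bar> \<le> \<kappa>"
      and left: "\<forall>i j. i < j \<longrightarrow> \<bar>a i j - a (Suc i) j\<bar> \<le> \<kappa>"
      and pr: "\<forall>i i' j k' k. i \<le> i' \<and> i' \<le> j \<and> j \<le> k' \<and> k' \<le> k \<longrightarrow>
       exp (a i' k' - a i' j - a j k') \<le> exp (a i k - a i j - a j k)
         + C * exp (- \<mu> * real (j - i')) + C * exp (- \<mu> * real (k' - j))"
      and ijk: "i \<le> j \<and> j \<le> k"
    have right': "\<bar>a x (y + n) - a x y\<bar> \<le> \<kappa> * real n" if "x \<le> y" for x y n
    proof (induction n)
      case (Suc n)
      have "\<bar>a x (Suc (y + n)) - a x (y + n)\<bar> \<le> \<kappa>" using right that by simp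
      then show ?case using Suc by (simp add: algebra_simps)
    qed simp
    have left': "\<bar>a x y - a (x + n) y\<bar> \<le> \<kappa> * real n" if "x + n \<le> y" for x y n
      using that
    proof (induction n)
      case (Suc n)
      have "\<bar>a (x + n) y - a (Suc (x + n)) y\<bar> \<le> \<kappa>" using left Suc.prems by simp
      then show ?case using Suc by (simp add: algebra_simps)
    qed simp
    show "a i j + a j k \<le> a i k + D"
    proof (rule ccontr)
      assume "\<not> ?thesis"
      then have big: "a i j + a j k > a i k + D" by simp
      \<comment> \<open>A defect is at most \<open>2 \<kappa>\<close> times the length of the second factor, so the window fits.\<close>
      have long: "j + W \<le> k"
      proof (rule ccontr)
        assume "\<not> ?thesis"
        then have "k - j < W" using ijk by auto
        then have kj: "real (k - j) \<le> real W" by simp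
        have "\<bar>a i k - a i j\<bar> \<le> \<kappa> * real (k - j)" "\<bar>a j k\<bar> \<le> \<kappa> * real (k - j)"
          using right'[of i j "k - j"] right'[of j j "k - j"] ijk diag by auto
        moreover have "\<kappa> * real (k - j) \<le> \<kappa> * real W" using kj \<kappa> by simp
        moreover have "D \<ge> 2 * \<kappa> * real W" using \<mu> by (simp add: D_def algebra_simps)
        ultimately show False using big by linarith
      qed
      have defect: "a x y + a y z \<ge> a x z + \<mu> * real (min (y - x) (z - y)) - c"
        if xyz: "j \<le> x" "x \<le> y" "y \<le> z" "z \<le> j + W" for x y z
      proof -
        let ?m = "real (min (y - x) (z - y))"
        have m: "?m \<le> real W" using xyz by auto
        have yj: "\<kappa> * real (y - j) \<le> \<kappa> * real W" using xyz \<kappa> by auto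
        have "\<bar>a i y - a i j\<bar> \<le> \<kappa> * real (y - j)"
          using right'[of i j "y - j"] ijk xyz by auto
        moreover have "\<bar>a j k - a y k\<bar> \<le> \<kappa> * real (y - j)"
          using left'[of j "y - j" k] long xyz by auto
        ultimately have "a i k - a i y - a y k \<le> - D + 2 * \<kappa> * real W"
          using big yj by linarith
        also have "\<dots> = - \<mu> * real W" by (simp add: D_def algebra_simps)
        also have "\<dots> \<le> - \<mu> * ?m" using m \<mu> by simp
        finally have 1: "exp (a i k - a i y - a y k) \<le> exp (- \<mu> * ?m)" by simp
        have 2: "C * exp (- \<mu> * real (y - x)) \<le> C * exp (- \<mu> * ?m)"
          "C * exp (- \<mu> * real (z - y)) \<le> C * exp (- \<mu> * ?m)"
          using C \<mu> by (auto intro!: mult_left_mono)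
        have "exp (a x z - a x y - a y z) \<le> exp (a i k - a i y - a y k)
            + C * exp (- \<mu> * real (y - x)) + C * exp (- \<mu> * real (z - y))"
          using pr ijk xyz long by auto
        also have "\<dots> \<le> (1 + 2 * C) * exp (- \<mu> * ?m)" unfolding distrib_right using 1 2 by linarith
        also have "\<dots> = exp (c - \<mu> * ?m)" using C by (simp add: c_def exp_diff exp_minus field_simps)
        finally show ?thesis by simp
      qed
      have dyadic: "a x (x + 2 ^ s) \<le> 2 ^ s * (\<kappa> - \<mu> * real s / 2) + c * (2 ^ s - 1)"
        if "j \<le> x" "x + 2 ^ s \<le> j + W" for x s
        using that
      proof (induction s arbitrary: x)
        case 0
        then show ?case using right'[of x x 1] diag by auto
      next
        case (Suc s)
        let ?y = "x + 2 ^ s" let ?z = "x + 2 ^ Suc s"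
        have z: "?z = ?y + 2 ^ s" by simp
        have "a x ?y + a ?y ?z \<ge> a x ?z + \<mu> * real (min (?y - x) (?z - ?y)) - c"
          using Suc.prems by (intro defect) auto
        moreover have "?z - ?y = 2 ^ s" "?y - x = 2 ^ s" by auto
        ultimately have "a x ?y + a ?y ?z \<ge> a x ?z + \<mu> * 2 ^ s - c" by simp
        moreover have "a x ?y \<le> 2 ^ s * (\<kappa> - \<mu> * real s / 2) + c * (2 ^ s - 1)"
          using Suc.prems by (intro Suc.IH) auto
        moreover have "a ?y ?z \<le> 2 ^ s * (\<kappa> - \<mu> * real s / 2) + c * (2 ^ s - 1)"
          unfolding z using Suc.prems by (intro Suc.IH) auto
        ultimately show ?case by (simp add: field_simps)
      qed
      have "a j (j + W) \<le> real W * (\<kappa> - \<mu> * real r / 2) + c * (real W - 1)"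
        using dyadic[of j r] by (simp add: W_def)
      moreover have "a j (j + W) \<ge> - \<kappa> * real W"
        using right'[of j j W] diag by auto
      ultimately have "0 \<le> real W * (2 * \<kappa> - \<mu> * real r / 2 + c) - c" by (simp add: algebra_simps)
      also have "\<dots> < 0"
      proof -
        have "2 * \<kappa> - \<mu> * real r / 2 + c < 0" using r \<mu> by (simp add: field_simps)
        moreover have "real W > 0" by (simp add: W_def)
        ultimately have "real W * (2 * \<kappa> - \<mu> * real r / 2 + c) < 0" by (simp add: mult_pos_neg)
        then show ?thesis using c0 by linarith
      qed
      finally show False by simp
    qed
  qed
qed

section \<open>Orthonormal frames diagonalising a quadratic form\<close>

definition orthonormal_frame :: "(nat \<Rightarrow> real^'n) \<Rightarrow> bool" where
  "orthonormal_frame e \<longleftrightarrow> (\<forall>i\<in>{1..CARD('n)}. \<forall>j\<in>{1..CARD('n)}. e i \<bullet> e j = (if i = j then 1 else 0))"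

lemma orthonormal_frame_expand:
  fixes e :: "nat \<Rightarrow> real^'n"
  assumes "orthonormal_frame e"
  shows "(\<Sum>i=1..CARD('n). (x \<bullet> e i) *\<^sub>R e i) = x"
proof -
  let ?I = "{1..CARD('n)}"
  have on: "e i \<bullet> e j = (if i = j then 1 else 0)" if "i \<in> ?I" "j \<in> ?I" for i j
    using assms that unfolding orthonormal_frame_def by blast
  have inj: "inj_on e ?I"
    by (rule inj_onI) (metis on zero_neq_one)
  have po: "pairwise orthogonal (e ` ?I)"
    unfolding pairwise_def orthogonal_def using on by auto
  have n1: "norm b = 1" if "b \<in> e ` ?I" for b
    using that on by (auto simp: norm_eq_1)
  have ind: "independent (e ` ?I)"
    by (rule pairwise_orthogonal_independent[OF po]) (use n1 in fastforce)
  have "card (e ` ?I) = CARD('n)" using card_image[OF inj] by simp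
  then have "span (e ` ?I) = UNIV"
    using card_eq_dim[of "e ` ?I" UNIV] ind by (auto simp: dim_UNIV)
  then have "(\<Sum>b\<in>e ` ?I. (x \<bullet> b) *\<^sub>R b) = x"
    by (intro orthonormal_basis_expand po n1) auto
  then show ?thesis by (simp add: sum.reindex[OF inj] del: One_nat_def)
qed

lemma orthonormal_frame_inner:
  fixes e :: "nat \<Rightarrow> real^'n"
  assumes "orthonormal_frame e"
  shows "x \<bullet> y = (\<Sum>i=1..CARD('n). (x \<bullet> e i) * (y \<bullet> e i))"
proof -
  have "x \<bullet> y = (\<Sum>i=1..CARD('n). (x \<bullet> e i) *\<^sub>R e i) \<bullet> y"
    using orthonormal_frame_expand[OF assms, of x] by simp
  also have "\<dots> = (\<Sum>i=1..CARD('n). (x \<bullet> e i) * (y \<bullet> e i))"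
    by (simp only: inner_sum_left inner_scaleR_left) (simp only: inner_commute)
  finally show ?thesis .
qed

text \<open>The vectors are chosen one after the other, each maximising the form on the unit sphere of the
orthogonal complement of its predecessors. For a later vector \<open>w\<close> the maximality at \<open>e i + t w\<close> for all
real \<open>t\<close> forces the mixed term to vanish. Applied to the pullback of the inner product under a matrix
this gives the singular value decomposition, applied to a scalar product it gives an orthonormal basis.\<close>

lemma diagonalise_form:
  fixes Q :: "real^'n \<Rightarrow> real^'n \<Rightarrow> real"
  assumes Q: "bilinear Q" and sym: "\<And>v w. Q v w = Q w v"
  shows "\<exists>e. orthonormal_frame e \<and>
    (\<forall>i\<in>{1..CARD('n)}. \<forall>j\<in>{1..CARD('n)}. i \<noteq> j \<longrightarrow> Q (e i) (e j) = 0) \<and>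
    (\<forall>i\<in>{1..CARD('n)}. \<forall>j\<in>{1..CARD('n)}. i \<le> j \<longrightarrow> Q (e j) (e j) \<le> Q (e i) (e i))"
proof -
  let ?P = "\<lambda>k (e :: nat \<Rightarrow> real^'n). (\<forall>i\<in>{1..k}. \<forall>j\<in>{1..k}. e i \<bullet> e j = (if i = j then 1 else 0)) \<and>
     (\<forall>i\<in>{1..k}. \<forall>w. (\<forall>j\<in>{1..<i}. w \<bullet> e j = 0) \<longrightarrow> Q w w \<le> Q (e i) (e i) * (w \<bullet> w))"
  have "\<exists>e. ?P k e" if "k \<le> CARD('n)" for k
    using that
  proof (induction k)
    case 0
    then show ?case by simp
  next
    case (Suc k)
    then obtain e where e: "?P k e" by auto
    let ?W = "{w. \<forall>j\<in>{1..k}. w \<bullet> e j = 0}"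
    have "dim (e ` {1..k}) \<le> card (e ` {1..k})" by (rule dim_le_card') simp
    also have "\<dots> \<le> k" using card_image_le[of "{1..k}" e] by simp
    finally have "dim (e ` {1..k}) < DIM(real^'n)" using Suc.prems by simp
    then obtain x where x: "x \<noteq> 0" "\<And>y. y \<in> span (e ` {1..k}) \<Longrightarrow> orthogonal x y"
      using orthogonal_to_subspace_exists by blast
    have xW: "(1 / norm x) *\<^sub>R x \<in> sphere 0 1 \<inter> ?W"
      using x by (auto simp: orthogonal_def span_base)
    have "closed ?W"
      unfolding ball_conj_distrib Collect_ball_eq
      by (intro closed_INT ballI closed_Collect_eq continuous_intros)
    then have comp: "compact (sphere 0 1 \<inter> ?W)" by (intro compact_Int_closed) auto
    have bb: "bounded_bilinear Q" using Q bilinear_conv_bounded_bilinear by blast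
    have "continuous_on (sphere 0 1 \<inter> ?W) (\<lambda>w. Q w w)"
      by (intro bounded_bilinear.continuous_on[OF bb] continuous_intros)
    then obtain u where u: "u \<in> sphere 0 1 \<inter> ?W" "\<And>w. w \<in> sphere 0 1 \<inter> ?W \<Longrightarrow> Q w w \<le> Q u u"
      using continuous_attains_sup[OF comp, of "\<lambda>w. Q w w"] xW by blast
    have max: "Q w w \<le> Q u u * (w \<bullet> w)" if "w \<in> ?W" for w
    proof (cases "w = 0")
      case True
      then show ?thesis using Q by (simp add: bilinear_lzero)
    next
      case False
      have "(1 / norm w) *\<^sub>R w \<in> sphere 0 1 \<inter> ?W" using that False by auto
      from u(2)[OF this] have "(1 / norm w) * ((1 / norm w) * Q w w) \<le> Q u u"
        using Q by (simp add: bilinear_lmul bilinear_rmul)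
      then show ?thesis using False
        by (simp add: field_simps dot_square_norm power2_eq_square)
    qed
    have "?P (Suc k) (e(Suc k := u))"
    proof (intro conjI ballI allI impI)
      fix i j assume "i \<in> {1..Suc k}" "j \<in> {1..Suc k}"
      then consider "i \<in> {1..k}" "j \<in> {1..k}" | "i = Suc k" "j \<in> {1..k}" | "j = Suc k" "i \<in> {1..k}"
        | "i = Suc k" "j = Suc k" by force
      then show "(e(Suc k := u)) i \<bullet> (e(Suc k := u)) j = (if i = j then 1 else 0)"
        by cases (use e u(1) in \<open>auto simp: inner_commute norm_eq_1\<close>)
    next
      fix i w assume i: "i \<in> {1..Suc k}" and w: "\<forall>j\<in>{1..<i}. w \<bullet> (e(Suc k := u)) j = 0"
      show "Q w w \<le> Q ((e(Suc k := u)) i) ((e(Suc k := u)) i) * (w \<bullet> w)"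
      proof (cases "i = Suc k")
        case True
        then show ?thesis using max[of w] w by auto
      next
        case False
        then show ?thesis using e i w by auto
      qed
    qed
    then show ?case by blast
  qed
  from this[of "CARD('n)"] obtain e where e: "?P (CARD('n)) e" by blast
  have on: "orthonormal_frame e" using e unfolding orthonormal_frame_def by blast
  have ii: "e i \<bullet> e j = (if i = j then 1 else 0)" if "i \<in> {1..CARD('n)}" "j \<in> {1..CARD('n)}" for i j
    using on that unfolding orthonormal_frame_def by blast
  have max: "Q w w \<le> Q (e i) (e i) * (w \<bullet> w)"
    if "i \<in> {1..CARD('n)}" "\<And>j. j \<in> {1..<i} \<Longrightarrow> w \<bullet> e j = 0" for i w
    using e that by blast
  have lt: "Q (e i) (e j) = 0" if ij: "i \<in> {1..CARD('n)}" "j \<in> {1..CARD('n)}" "i < j" for i j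
  proof -
    have *: "2 * t * Q (e i) (e j) \<le> t\<^sup>2 * (Q (e i) (e i) - Q (e j) (e j))" for t
    proof -
      have "Q (e i + t *\<^sub>R e j) (e i + t *\<^sub>R e j) \<le> Q (e i) (e i) * ((e i + t *\<^sub>R e j) \<bullet> (e i + t *\<^sub>R e j))"
        using ij by (intro max) (auto simp: inner_add_left ii)
      moreover have "(e i + t *\<^sub>R e j) \<bullet> (e i + t *\<^sub>R e j) = 1 + t\<^sup>2"
        using ij by (simp add: inner_add_left inner_add_right ii power2_eq_square)
      moreover have "Q (e i + t *\<^sub>R e j) (e i + t *\<^sub>R e j)
          = Q (e i) (e i) + 2 * t * Q (e i) (e j) + t\<^sup>2 * Q (e j) (e j)"
        using Q sym[of "e j" "e i"]
        by (simp add: bilinear_ladd bilinear_radd bilinear_lmul bilinear_rmul power2_eq_square algebra_simps)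
      ultimately have "Q (e i) (e i) + 2 * t * Q (e i) (e j) + t\<^sup>2 * Q (e j) (e j) \<le> Q (e i) (e i) * (1 + t\<^sup>2)" by simp
      then show ?thesis by (simp add: algebra_simps)
    qed
    show ?thesis
    proof (rule ccontr)
      assume nz: "Q (e i) (e j) \<noteq> 0"
      define q where "q = Q (e i) (e j)"
      define D where "D = Q (e i) (e i) - Q (e j) (e j)"
      have D0: "D \<ge> 0" using max[of i "e j"] ij ii by (auto simp: D_def)
      \<comment> \<open>\<open>t = q / (D + 1)\<close> makes the linear term win over the quadratic one.\<close>
      have "2 * (q / (D + 1)) * q \<le> (q / (D + 1))\<^sup>2 * D" using * unfolding q_def D_def by blast
      also have "\<dots> \<le> (q / (D + 1))\<^sup>2 * (D + 1)" by (intro mult_left_mono) auto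
      also have "\<dots> = (q / (D + 1)) * q" using D0 by (simp add: power2_eq_square add_nonneg_eq_0_iff)
      finally have "q * q / (D + 1) \<le> 0" by simp
      moreover have "q * q / (D + 1) > 0"
        using nz D0 by (intro divide_pos_pos) (auto simp: q_def zero_less_mult_iff)
      ultimately show False by simp
    qed
  qed
  have "Q (e i) (e j) = 0" if "i \<in> {1..CARD('n)}" "j \<in> {1..CARD('n)}" "i \<noteq> j" for i j
    using lt that sym by (metis nat_neq_iff)
  moreover have "Q (e j) (e j) \<le> Q (e i) (e i)"
    if "i \<in> {1..CARD('n)}" "j \<in> {1..CARD('n)}" "i \<le> j" for i j
    using max[of i "e j"] ii[of j] that by (auto simp: ii)
  ultimately show ?thesis using on by blast
qed

section \<open>Singular values\<close>

text \<open>The first rule would turn products with a transposed matrix into products of row vectors, the second one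
would rewrite the first index of the frames.\<close>

declare transpose_matrix_vector [simp del] One_nat_def [simp del]

lemma minus_matrix_vector_mult: "(- A) *v x = - (A *v x)" for A :: "real^'n^'m"
  by (simp add: matrix_vector_mult_def vec_eq_iff sum_negf)

lemma matrix_vector_mult_minus: "A *v (- x) = - (A *v x)" for A :: "real^'n^'m"
  by (simp add: matrix_vector_mult_def vec_eq_iff sum_negf)

lemma transpose_adjoint:
  fixes A :: "real^'n^'m"
  shows "(A *v x) \<bullet> y = x \<bullet> (transpose A *v y)"
  by (metis dot_lmul_matrix inner_commute transpose_matrix_vector)

text \<open>The images of the frame \<open>e\<close> are the axes \<open>s i *\<^sub>R f i\<close> of the ellipsoid. The sequence is 0 outside
\<open>{1..CARD('n)}\<close> to match the normalisation of \<open>singular_value\<close>.\<close>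

definition svd :: "real^'n^'n \<Rightarrow> (nat \<Rightarrow> real^'n) \<Rightarrow> (nat \<Rightarrow> real^'n) \<Rightarrow> (nat \<Rightarrow> real) \<Rightarrow> bool" where
  "svd A e f s \<longleftrightarrow> orthonormal_frame e \<and> orthonormal_frame f \<and>
     (\<forall>i\<in>{1..CARD('n)}. s i > 0 \<and> A *v e i = s i *\<^sub>R f i \<and> transpose A *v f i = s i *\<^sub>R e i) \<and>
     (\<forall>i\<in>{1..CARD('n)}. \<forall>j\<in>{1..CARD('n)}. i \<le> j \<longrightarrow> s j \<le> s i) \<and>
     (\<forall>i. i \<notin> {1..CARD('n)} \<longrightarrow> s i = 0)"

lemma svd_exists:
  fixes A :: "real^'n^'n"
  assumes "invertible A"
  obtains e f s where "svd A e f s"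
proof -
  let ?Q = "\<lambda>v w. (A *v v) \<bullet> (A *v w)"
  have "bilinear ?Q"
    by (auto simp: bilinear_def linear_iff matrix_vector_right_distrib
        inner_add_left inner_add_right matrix_vector_mult_scaleR)
  from diagonalise_form[OF this inner_commute] obtain e where e: "orthonormal_frame e"
    "\<And>i j. i \<in> {1..CARD('n)} \<Longrightarrow> j \<in> {1..CARD('n)} \<Longrightarrow> i \<noteq> j \<Longrightarrow> ?Q (e i) (e j) = 0"
    "\<And>i j. i \<in> {1..CARD('n)} \<Longrightarrow> j \<in> {1..CARD('n)} \<Longrightarrow> i \<le> j \<Longrightarrow> ?Q (e j) (e j) \<le> ?Q (e i) (e i)"
    by blast
  have ii: "e i \<bullet> e j = (if i = j then 1 else 0)" if "i \<in> {1..CARD('n)}" "j \<in> {1..CARD('n)}" for i j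
    using e(1) that unfolding orthonormal_frame_def by blast
  define s where "s i = (if i \<in> {1..CARD('n)} then norm (A *v e i) else 0)" for i
  define f where "f i = (1 / s i) *\<^sub>R (A *v e i)" for i
  have pos: "s i > 0" if "i \<in> {1..CARD('n)}" for i
  proof -
    have "e i \<noteq> 0" using ii[OF that that] by auto
    then have "A *v e i \<noteq> 0"
      using assms by (metis invertible_def matrix_left_invertible_ker)
    then show ?thesis using that by (simp add: s_def)
  qed
  have Q: "?Q (e i) (e j) = (if i = j then s i * s i else 0)"
    if "i \<in> {1..CARD('n)}" "j \<in> {1..CARD('n)}" for i j
    using e(2)[of i j] that by (auto simp: s_def dot_square_norm power2_eq_square)
  have f: "orthonormal_frame f" unfolding orthonormal_frame_def
    using pos less_numeral_extra(3) by (fastforce simp: f_def Q simp del: One_nat_def)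
  have Ae: "A *v e i = s i *\<^sub>R f i" if "i \<in> {1..CARD('n)}" for i
    using pos[OF that] by (simp add: f_def)
  have Af: "transpose A *v f i = s i *\<^sub>R e i" if i: "i \<in> {1..CARD('n)}" for i
  proof -
    have "(transpose A *v f i) \<bullet> e j = s i * (e i \<bullet> e j)" if "j \<in> {1..CARD('n)}" for j
    proof -
      have "(transpose A *v f i) \<bullet> e j = f i \<bullet> (A *v e j)"
        by (metis transpose_adjoint inner_commute)
      also have "\<dots> = s j * (f i \<bullet> f j)" using Ae[OF that] by simp
      also have "\<dots> = s i * (e i \<bullet> e j)"
        using f i that ii[OF i that] unfolding orthonormal_frame_def by auto
      finally show ?thesis .
    qed
    then have "(\<Sum>j=1..CARD('n). ((transpose A *v f i) \<bullet> e j) *\<^sub>R e j)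
        = (\<Sum>j=1..CARD('n). ((s i *\<^sub>R e i) \<bullet> e j) *\<^sub>R e j)"
      by (intro sum.cong) auto
    then show ?thesis by (simp only: orthonormal_frame_expand[OF e(1)])
  qed
  have mono: "s j \<le> s i" if "i \<in> {1..CARD('n)}" "j \<in> {1..CARD('n)}" "i \<le> j" for i j
    using e(3)[of i j] that pos[of i] by (auto simp: s_def norm_le)
  have "s i = 0" if "i \<notin> {1..CARD('n)}" for i
    using that by (simp only: s_def if_False)
  then have "svd A e f s"
    unfolding svd_def using e(1) f pos Ae Af mono by blast
  then show thesis by (rule that)
qed

lemma svdD:
  fixes A :: "real^'n^'n"
  assumes "svd A e f s"
  shows "orthonormal_frame e" "orthonormal_frame f"
    "\<And>i. i \<in> {1..CARD('n)} \<Longrightarrow> s i > 0"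
    "\<And>i. i \<in> {1..CARD('n)} \<Longrightarrow> A *v e i = s i *\<^sub>R f i"
    "\<And>i. i \<in> {1..CARD('n)} \<Longrightarrow> transpose A *v f i = s i *\<^sub>R e i"
    "\<And>i j. 1 \<le> i \<Longrightarrow> i \<le> j \<Longrightarrow> j \<le> CARD('n) \<Longrightarrow> s j \<le> s i"
    "\<And>i. i \<notin> {1..CARD('n)} \<Longrightarrow> s i = 0"
  using assms unfolding svd_def by auto

lemma svd_transpose: "svd A e f s \<Longrightarrow> svd (transpose A) f e s"
  unfolding svd_def by auto

lemma svd_norm:
  fixes A :: "real^'n^'n"
  assumes "svd A e f s"
  shows "(norm (A *v x))\<^sup>2 = (\<Sum>i=1..CARD('n). (s i)\<^sup>2 * (x \<bullet> e i)\<^sup>2)"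
proof -
  note D = svdD[OF assms]
  have "(A *v x) \<bullet> f i = s i * (x \<bullet> e i)" if "i \<in> {1..CARD('n)}" for i
    using D(5)[OF that] by (simp add: transpose_adjoint)
  then have "(A *v x) \<bullet> (A *v x) = (\<Sum>i=1..CARD('n). (s i * (x \<bullet> e i)) * (s i * (x \<bullet> e i)))"
    by (subst orthonormal_frame_inner[OF D(2)]) (intro sum.cong, auto)
  then show ?thesis unfolding power2_norm_eq_inner by (simp add: power2_eq_square ac_simps)
qed

lemma orthonormal_frame_norm:
  fixes e :: "nat \<Rightarrow> real^'n"
  assumes "orthonormal_frame e"
  shows "(norm x)\<^sup>2 = (\<Sum>i=1..CARD('n). (x \<bullet> e i)\<^sup>2)"
  using orthonormal_frame_inner[OF assms, of x x] unfolding power2_norm_eq_inner by (simp add: power2_eq_square)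

lemma orthonormal_frame_unit: "orthonormal_frame (e :: nat \<Rightarrow> real^'n) \<Longrightarrow> i \<in> {1..CARD('n)} \<Longrightarrow> norm (e i) = 1"
  unfolding orthonormal_frame_def norm_eq_1 by auto

lemma card_ge1: "1 \<in> {1..CARD('n::finite)}"
  by (simp add: Suc_leI One_nat_def)

lemma svd_bound:
  fixes A :: "real^'n^'n"
  assumes "svd A e f s"
  shows "norm (A *v x) \<le> s 1 * norm x"
proof (rule power2_le_imp_le)
  note D = svdD[OF assms]
  show "0 \<le> s 1 * norm x" using D(3)[OF card_ge1] by simp
  have "(norm (A *v x))\<^sup>2 \<le> (\<Sum>i=1..CARD('n). (s 1)\<^sup>2 * (x \<bullet> e i)\<^sup>2)"
    unfolding svd_norm[OF assms]
    by (intro sum_mono mult_right_mono power_mono) (use D(3,6) in \<open>auto simp: less_imp_le\<close>)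
  also have "\<dots> = (s 1 * norm x)\<^sup>2"
    by (simp only: sum_distrib_left[symmetric] orthonormal_frame_norm[OF D(1)] power_mult_distrib)
  finally show "(norm (A *v x))\<^sup>2 \<le> (s 1 * norm x)\<^sup>2" .
qed

lemma svd_bound_orth:
  fixes A :: "real^'n^'n"
  assumes "svd A e f s" and d: "CARD('n) \<ge> 2" and x: "x \<bullet> e 1 = 0"
  shows "norm (A *v x) \<le> s 2 * norm x"
proof (rule power2_le_imp_le)
  note D = svdD[OF assms(1)]
  have s2: "s 2 > 0" using D(3)[of 2] d by simp
  then show "0 \<le> s 2 * norm x" by simp
  have "(norm (A *v x))\<^sup>2 \<le> (\<Sum>i=1..CARD('n). (s 2)\<^sup>2 * (x \<bullet> e i)\<^sup>2)"
    unfolding svd_norm[OF assms(1)]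
  proof (intro sum_mono)
    fix i assume i: "i \<in> {1..CARD('n)}"
    show "(s i)\<^sup>2 * (x \<bullet> e i)\<^sup>2 \<le> (s 2)\<^sup>2 * (x \<bullet> e i)\<^sup>2"
    proof (cases "i = 1")
      case False
      then have "s i \<le> s 2" "s i > 0" using D(6)[of 2 i] D(3)[OF i] i by auto
      then show ?thesis by (intro mult_right_mono power_mono) auto
    qed (use x in simp)
  qed
  also have "\<dots> = (s 2 * norm x)\<^sup>2"
    by (simp only: sum_distrib_left[symmetric] orthonormal_frame_norm[OF D(1)] power_mult_distrib)
  finally show "(norm (A *v x))\<^sup>2 \<le> (s 2 * norm x)\<^sup>2" .
qed

lemma svd_onorm:
  fixes A :: "real^'n^'n"
  assumes "svd A e f s"
  shows "onorm ((*v) A) = s 1"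
proof (rule antisym)
  note D = svdD[OF assms]
  show "onorm ((*v) A) \<le> s 1" by (rule onorm_le) (rule svd_bound[OF assms])
  have "norm (A *v e 1) \<le> onorm ((*v) A) * norm (e 1)"
    by (rule onorm) (rule matrix_vector_mul_bounded_linear)
  then show "s 1 \<le> onorm ((*v) A)"
    using D(3,4)[OF card_ge1] orthonormal_frame_unit[OF D(1) card_ge1] orthonormal_frame_unit[OF D(2) card_ge1]
    by simp
qed

text \<open>The level sets determine the number of indices with value at least \<open>t\<close>, and the \<open>i\<close>-th entry of a
decreasing sequence is at least \<open>t\<close> exactly when this number is at least \<open>i\<close>.\<close>

lemma decreasing_determined_by_levels:
  fixes s s' :: "nat \<Rightarrow> real"
  assumes s: "\<And>i j. 1 \<le> i \<Longrightarrow> i \<le> j \<Longrightarrow> j \<le> d \<Longrightarrow> s j \<le> s i"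
    and s': "\<And>i j. 1 \<le> i \<Longrightarrow> i \<le> j \<Longrightarrow> j \<le> d \<Longrightarrow> s' j \<le> s' i"
    and lev: "\<And>t. t \<in> s ` {1..d} \<union> s' ` {1..d} \<Longrightarrow> card {i\<in>{1..d}. s i = t} = card {i\<in>{1..d}. s' i = t}"
    and i: "i \<in> {1..d}"
  shows "s i = s' i"
proof -
  have eq: "card {i\<in>{1..d}. s i \<ge> t} = card {i\<in>{1..d}. s' i \<ge> t}" for t
  proof -
    let ?T = "{u \<in> s ` {1..d} \<union> s' ` {1..d}. u \<ge> t}"
    have "card {i\<in>{1..d}. z i \<ge> t} = (\<Sum>u\<in>?T. card {i\<in>{1..d}. z i = u})"
      if "z = s \<or> z = s'" for z
    proof -
      have "{i\<in>{1..d}. z i \<ge> t} = (\<Union>u\<in>?T. {i\<in>{1..d}. z i = u})" using that by auto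
      then show ?thesis by (simp only:) (subst card_UN_disjoint; auto)
    qed
    then show ?thesis using lev by simp
  qed
  have le: "z i \<le> z' i"
    if z: "\<And>i j. 1 \<le> i \<Longrightarrow> i \<le> j \<Longrightarrow> j \<le> d \<Longrightarrow> z j \<le> z i"
      and z': "\<And>i j. 1 \<le> i \<Longrightarrow> i \<le> j \<Longrightarrow> j \<le> d \<Longrightarrow> z' j \<le> z' i"
      and c: "\<And>t. card {i\<in>{1..d}. z i \<ge> t} = card {i\<in>{1..d}. z' i \<ge> t}" for z z' :: "nat \<Rightarrow> real"
  proof (rule ccontr)
    assume n: "\<not> z i \<le> z' i"
    have "card {1..i} \<le> card {j\<in>{1..d}. z j \<ge> z i}"
      using i z by (intro card_mono) auto
    also have "\<dots> = card {j\<in>{1..d}. z' j \<ge> z i}" by (rule c)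
    also have "\<dots> \<le> card {1..<i}"
    proof (intro card_mono subsetI)
      fix j assume j: "j \<in> {j\<in>{1..d}. z' j \<ge> z i}"
      show "j \<in> {1..<i}"
      proof (rule ccontr)
        assume "j \<notin> {1..<i}"
        then have "z' j \<le> z' i" using z'[of i j] i j by auto
        then show False using n j by auto
      qed
    qed auto
    finally show False using i by auto
  qed
  show ?thesis using le[OF s s' eq] le[OF s' s eq[symmetric]] by simp
qed

text \<open>In the frame \<open>e\<close> the matrix acts diagonally, so the eigenspace is spanned by the \<open>e i\<close> with \<open>s i = t\<close>.\<close>

lemma eigenspace_dim:
  fixes A :: "real^'n^'n"
  assumes "svd A e f s" and t: "t \<ge> 0"
  shows "dim {x. transpose A *v (A *v x) = t\<^sup>2 *\<^sub>R x} = card {i\<in>{1..CARD('n)}. s i = t}"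
proof -
  note D = svdD[OF assms(1)]
  let ?I = "{i\<in>{1..CARD('n)}. s i = t}"
  let ?V = "{x. transpose A *v (A *v x) = t\<^sup>2 *\<^sub>R x}"
  have ii: "e i \<bullet> e j = (if i = j then 1 else 0)" if "i \<in> {1..CARD('n)}" "j \<in> {1..CARD('n)}" for i j
    using D(1) that unfolding orthonormal_frame_def by blast
  have AAe: "transpose A *v (A *v e i) = (s i)\<^sup>2 *\<^sub>R e i" if "i \<in> {1..CARD('n)}" for i
    using D(4,5)[OF that] by (simp add: matrix_vector_mult_scaleR power2_eq_square)
  have "subspace ?V"
    by (auto simp: subspace_def matrix_vector_right_distrib matrix_vector_mult_scaleR scaleR_add_right)
  moreover have "e ` ?I \<subseteq> ?V" using AAe by auto
  ultimately have 1: "span (e ` ?I) \<subseteq> ?V" by (simp add: span_minimal)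
  have 2: "?V \<subseteq> span (e ` ?I)"
  proof
    fix x assume "x \<in> ?V"
    then have x: "transpose A *v (A *v x) = t\<^sup>2 *\<^sub>R x" by simp
    have z: "x \<bullet> e i = 0" if i: "i \<in> {1..CARD('n)}" "s i \<noteq> t" for i
    proof -
      have "t\<^sup>2 * (x \<bullet> e i) = (transpose A *v (A *v x)) \<bullet> e i" using x by simp
      also have "\<dots> = x \<bullet> (transpose A *v (A *v e i))"
        by (metis transpose_adjoint inner_commute)
      also have "\<dots> = (s i)\<^sup>2 * (x \<bullet> e i)" using AAe[OF i(1)] by simp
      finally have "(t\<^sup>2 - (s i)\<^sup>2) * (x \<bullet> e i) = 0" by (simp add: algebra_simps)
      moreover have "t\<^sup>2 \<noteq> (s i)\<^sup>2" using D(3)[OF i(1)] t i(2) by (simp add: power2_eq_iff_nonneg)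
      ultimately show ?thesis by simp
    qed
    have "x = (\<Sum>i=1..CARD('n). (x \<bullet> e i) *\<^sub>R e i)" by (simp only: orthonormal_frame_expand[OF D(1)])
    also have "\<dots> \<in> span (e ` ?I)"
    proof (intro span_sum)
      fix i assume i: "i \<in> {1..CARD('n)}"
      show "(x \<bullet> e i) *\<^sub>R e i \<in> span (e ` ?I)"
      proof (cases "s i = t")
        case True then show ?thesis using i by (intro span_scale span_base) auto
      next
        case False then show ?thesis using z[OF i] by (simp add: span_zero)
      qed
    qed
    finally show "x \<in> span (e ` ?I)" .
  qed
  have inj: "inj_on e ?I"
  proof (rule inj_onI)
    fix i j assume "i \<in> ?I" "j \<in> ?I" "e i = e j"
    then show "i = j" using ii[of i j] ii[of i i] by (auto split: if_splits)
  qed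
  have ind: "independent (e ` ?I)"
  proof (rule pairwise_orthogonal_independent)
    show "pairwise orthogonal (e ` ?I)" unfolding pairwise_def orthogonal_def using ii by auto
    show "0 \<notin> e ` ?I"
    proof
      assume "0 \<in> e ` ?I"
      then obtain i where "i \<in> {1..CARD('n)}" "e i = 0" by auto
      then show False using orthonormal_frame_unit[OF D(1), of i] by simp
    qed
  qed
  have "dim (e ` ?I) = card ?I"
    by (simp only: dim_eq_card_independent[OF ind] card_image[OF inj])
  then have "dim (span (e ` ?I)) = card ?I" by (simp only: dim_span)
  then show ?thesis by (simp only: subset_antisym[OF 2 1])
qed

text \<open>A linear change of coordinates \<open>P\<close>, with inverse \<open>R\<close>, that carries the scalar product \<open>B\<close> to the standard
one. All estimates are made for the conjugated matrices and the standard inner product.\<close>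

locale euclidean_chart =
  fixes B :: "real^'n \<Rightarrow> real^'n \<Rightarrow> real" and P R :: "real^'n^'n"
  assumes B_eq: "B v w = (P *v v) \<bullet> (P *v w)"
    and PR: "P ** R = mat 1" and RP: "R ** P = mat 1"
begin

definition conjugate :: "real^'n^'n \<Rightarrow> real^'n^'n" where "conjugate A = P ** A ** R"

lemma PRv [simp]: "P *v (R *v x) = x" and RPv [simp]: "R *v (P *v x) = x"
  by (simp_all add: matrix_vector_mul_assoc PR RP)

lemma conjugate_P: "conjugate A *v (P *v x) = P *v (A *v x)"
  unfolding conjugate_def by (metis RPv matrix_vector_mul_assoc)

lemma conjugate_mult: "conjugate (A ** C) = conjugate A ** conjugate C"
  unfolding conjugate_def by (metis RP matrix_mul_assoc matrix_mul_rid)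

lemma conjugate_minus: "conjugate (- A) = - conjugate A"
  unfolding conjugate_def by (simp add: matrix_eq minus_matrix_vector_mult matrix_vector_mult_minus flip: matrix_vector_mul_assoc)

lemma conjugate_invertible: "invertible A \<Longrightarrow> invertible (conjugate A)"
  unfolding conjugate_def using PR RP by (metis invertible_def invertible_mult)

lemma sp_adjoint_eq: "sp_adjoint B A = R ** transpose (conjugate A) ** P"
  unfolding sp_adjoint_def
proof (rule the_equality)
  have *: "B (A *v v) w = B v ((R ** transpose (conjugate A) ** P) *v w)" for v w
  proof -
    have "B (A *v v) w = (P *v v) \<bullet> (transpose (conjugate A) *v (P *v w))"
      by (simp only: B_eq conjugate_P[symmetric] transpose_adjoint[of "conjugate A"])
    then show ?thesis by (simp add: B_eq flip: matrix_vector_mul_assoc)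
  qed
  then show "\<forall>v w. B (A *v v) w = B v ((R ** transpose (conjugate A) ** P) *v w)" by blast
  fix A' assume "\<forall>v w. B (A *v v) w = B v (A' *v w)"
  then have "B v (A' *v w) = B v ((R ** transpose (conjugate A) ** P) *v w)" for v w
    using * by metis
  then have "(P *v v) \<bullet> (P *v (A' *v w) - P *v ((R ** transpose (conjugate A) ** P) *v w)) = 0" for v w
    by (simp add: B_eq inner_diff_right)
  then have "P *v (A' *v w) = P *v ((R ** transpose (conjugate A) ** P) *v w)" for w
    by (metis PRv eq_iff_diff_eq_0 inner_eq_zero_iff)
  then show "A' = R ** transpose (conjugate A) ** P" unfolding matrix_eq by (metis RPv)
qed

lemma singular_value_eq:
  assumes "svd (conjugate A) e f s"
  shows "singular_value B A = s"
  unfolding singular_value_def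
proof (rule the_equality)
  note D = svdD[OF assms]
  have dim: "dim {v. (sp_adjoint B A ** A) *v v = t\<^sup>2 *\<^sub>R v} = card {i\<in>{1..CARD('n)}. s i = t}"
    if t: "t \<ge> 0" for t
  proof -
    let ?V = "{x. transpose (conjugate A) *v (conjugate A *v x) = t\<^sup>2 *\<^sub>R x}"
    have eq: "(sp_adjoint B A ** A) *v v = R *v (transpose (conjugate A) *v (conjugate A *v (P *v v)))" for v
      by (simp add: sp_adjoint_eq conjugate_P flip: matrix_vector_mul_assoc)
    have "{v. (sp_adjoint B A ** A) *v v = t\<^sup>2 *\<^sub>R v} = (*v) R ` ?V"
    proof (intro subset_antisym subsetI)
      fix v assume "v \<in> {v. (sp_adjoint B A ** A) *v v = t\<^sup>2 *\<^sub>R v}"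
      then have "P *v v \<in> ?V" unfolding mem_Collect_eq eq
        by (metis PRv matrix_vector_mult_scaleR)
      then show "v \<in> (*v) R ` ?V" by (metis RPv image_eqI)
    next
      fix v assume "v \<in> (*v) R ` ?V"
      then show "v \<in> {v. (sp_adjoint B A ** A) *v v = t\<^sup>2 *\<^sub>R v}"
        by (auto simp: eq matrix_vector_mult_scaleR)
    qed
    moreover have "dim ((*v) R ` ?V) = dim ?V"
      by (rule dim_image_eq) (auto intro!: inj_on_inverseI[of _ "(*v) P"])
    ultimately show ?thesis using eigenspace_dim[OF assms t] by simp
  qed
  show ok: "(\<forall>i. i \<notin> {1..CARD('n)} \<longrightarrow> s i = 0) \<and>
     (\<forall>i\<in>{1..CARD('n)}. s i \<ge> 0) \<and>
     (\<forall>i\<in>{1..CARD('n)}. \<forall>j\<in>{1..CARD('n)}. i \<le> j \<longrightarrow> s j \<le> s i) \<and>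
     (\<forall>t\<ge>0. card {i\<in>{1..CARD('n)}. s i = t} = dim {v. (sp_adjoint B A ** A) *v v = t\<^sup>2 *\<^sub>R v})"
    using D(3,6,7) dim by (auto simp: less_imp_le)
  fix s' assume s': "(\<forall>i. i \<notin> {1..CARD('n)} \<longrightarrow> s' i = 0) \<and>
     (\<forall>i\<in>{1..CARD('n)}. s' i \<ge> 0) \<and>
     (\<forall>i\<in>{1..CARD('n)}. \<forall>j\<in>{1..CARD('n)}. i \<le> j \<longrightarrow> s' j \<le> s' i) \<and>
     (\<forall>t\<ge>0. card {i\<in>{1..CARD('n)}. s' i = t} = dim {v. (sp_adjoint B A ** A) *v v = t\<^sup>2 *\<^sub>R v})"
  have "s' i = s i" if "i \<in> {1..CARD('n)}" for i
    by (rule decreasing_determined_by_levels[of "CARD('n)"]) (use that s' ok in auto)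
  then show "s' = s" using s' ok by (metis (no_types, lifting) ext)
qed

end

text \<open>Diagonalise \<open>B\<close> in a standard orthonormal frame and rescale the axes by the square roots of its values.\<close>

lemma euclidean_chart_exists:
  fixes B :: "real^'n \<Rightarrow> real^'n \<Rightarrow> real"
  assumes "is_scalar_product B"
  obtains P R where "euclidean_chart B P R"
proof -
  have B: "bilinear B" "\<And>v w. B v w = B w v" "\<And>v. v \<noteq> 0 \<Longrightarrow> B v v > 0"
    using assms unfolding is_scalar_product_def by auto
  obtain e where e: "orthonormal_frame e"
    "\<And>i j. i \<in> {1..CARD('n)} \<Longrightarrow> j \<in> {1..CARD('n)} \<Longrightarrow> i \<noteq> j \<Longrightarrow> B (e i) (e j) = 0"
    using diagonalise_form[OF B(1) B(2)] by blast
  let ?I = "{1..CARD('n)}"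
  have ii: "e i \<bullet> e j = (if i = j then 1 else 0)" if "i \<in> ?I" "j \<in> ?I" for i j
    using e(1) that unfolding orthonormal_frame_def by blast
  define q where "q i = sqrt (B (e i) (e i))" for i
  have q: "q i > 0" if "i \<in> ?I" for i
  proof -
    have "e i \<noteq> 0" using orthonormal_frame_unit[OF e(1) that] by (metis norm_zero zero_neq_one)
    then show ?thesis using B(3) by (simp add: q_def)
  qed
  define p where "p g x = (\<Sum>i\<in>?I. (g i * (x \<bullet> e i)) *\<^sub>R e i)" for g :: "nat \<Rightarrow> real" and x
  have lin: "linear (p g)" for g
  proof (rule linearI)
    show "p g (x + y) = p g x + p g y" for x y
      by (simp add: p_def inner_add_left distrib_left scaleR_add_left sum.distrib)
    show "p g (c *\<^sub>R x) = c *\<^sub>R p g x" for c x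
      by (simp add: p_def scaleR_sum_right mult.left_commute)
  qed
  have pe: "p g x \<bullet> e j = g j * (x \<bullet> e j)" if "j \<in> ?I" for g x j
  proof -
    have "p g x \<bullet> e j = (\<Sum>i\<in>?I. if i = j then g j * (x \<bullet> e j) else 0)"
      unfolding p_def inner_sum_left by (intro sum.cong) (auto simp: ii[OF _ that])
    then show ?thesis using that by simp
  qed
  have pp: "p g (p h x) = x" if "\<And>i. i \<in> ?I \<Longrightarrow> g i * h i = 1" for g h x
  proof -
    have "p g (p h x) = (\<Sum>i\<in>?I. (x \<bullet> e i) *\<^sub>R e i)"
      unfolding p_def[of g] using that by (intro sum.cong) (auto simp: pe mult.assoc[symmetric])
    then show ?thesis by (simp only: orthonormal_frame_expand[OF e(1)])
  qed
  have B_eq: "B v w = p q v \<bullet> p q w" for v w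
  proof -
    have "B v w = B (\<Sum>i\<in>?I. (v \<bullet> e i) *\<^sub>R e i) (\<Sum>j\<in>?I. (w \<bullet> e j) *\<^sub>R e j)"
      by (simp only: orthonormal_frame_expand[OF e(1)])
    also have "\<dots> = (\<Sum>i\<in>?I. \<Sum>j\<in>?I. (v \<bullet> e i) * ((w \<bullet> e j) * B (e i) (e j)))"
      by (simp only: bilinear_sum[OF B(1)] sum.cartesian_product bilinear_lmul[OF B(1)] bilinear_rmul[OF B(1)]
            real_scaleR_def) (simp only: mult.left_commute)
    also have "\<dots> = (\<Sum>i\<in>?I. \<Sum>j\<in>?I. if i = j then (v \<bullet> e i) * ((w \<bullet> e i) * B (e i) (e i)) else 0)"
      using e(2) by (intro sum.cong) auto
    also have "\<dots> = (\<Sum>i\<in>?I. (v \<bullet> e i) * ((w \<bullet> e i) * B (e i) (e i)))"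
      by (intro sum.cong) auto
    also have "\<dots> = (\<Sum>i\<in>?I. (p q v \<bullet> e i) * (p q w \<bullet> e i))"
    proof (intro sum.cong refl)
      fix i assume i: "i \<in> ?I"
      have "B (e i) (e i) = q i * q i" using q[OF i] unfolding q_def by simp
      then show "(v \<bullet> e i) * ((w \<bullet> e i) * B (e i) (e i)) = (p q v \<bullet> e i) * (p q w \<bullet> e i)"
        by (simp add: pe[OF i])
    qed
    also have "\<dots> = p q v \<bullet> p q w" by (rule orthonormal_frame_inner[OF e(1), symmetric])
    finally show ?thesis .
  qed
  have m: "matrix (p g) *v x = p g x" for g x
    using lin by (simp add: matrix_works)
  have "matrix (p g) ** matrix (p h) = mat 1" if "\<And>i. i \<in> ?I \<Longrightarrow> g i * h i = 1" for g h
    unfolding matrix_eq using pp[OF that] by (simp add: m flip: matrix_vector_mul_assoc)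
  then have "euclidean_chart B (matrix (p q)) (matrix (p (\<lambda>i. 1 / q i)))"
  proof unfold_locales
    show "B v w = (matrix (p q) *v v) \<bullet> (matrix (p q) *v w)" for v w
      by (simp only: m B_eq)
  qed (use q in force)+
  then show thesis by (rule that)
qed

section \<open>Most stretched directions and their stability\<close>

text \<open>Unit vectors matter only up to sign, as representatives of lines; on lines this is a metric comparable
to the sine of the angle, for which the triangle inequality is immediate.\<close>

definition line_gap :: "real^'n \<Rightarrow> real^'n \<Rightarrow> real" where
  "line_gap x y = min (norm (x - y)) (norm (x + y))"
lemma line_gap_nonneg: "line_gap x y \<ge> 0"
  by (simp add: line_gap_def)
lemma line_gap_self [simp]: "line_gap x x = 0"
  by (simp add: line_gap_def)

lemma line_gap_commute: "line_gap x y = line_gap y x"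
  by (simp add: line_gap_def norm_minus_commute add.commute)
lemma line_gap_triangle: "line_gap x z \<le> line_gap x y + line_gap y z"
proof -
  have 1: "line_gap x z \<le> norm (x - z)" "line_gap x z \<le> norm (x + z)" by (auto simp: line_gap_def)
  have "norm (x - z) \<le> norm (x - y) + norm (y - z)"
    using norm_triangle_ineq[of "x - y" "y - z"] by simp
  moreover have "norm (x - z) \<le> norm (x + y) + norm (y + z)"
    using norm_triangle_ineq4[of "x + y" "y + z"] by simp
  moreover have "norm (x + z) \<le> norm (x - y) + norm (y + z)"
    using norm_triangle_ineq[of "x - y" "y + z"] by simp
  moreover have "norm (x + z) \<le> norm (x + y) + norm (y - z)"
    using norm_triangle_ineq4[of "x + y" "y - z"] by simp
  ultimately show ?thesis
    using 1 unfolding line_gap_def[of x y] line_gap_def[of y z] min_def by (smt (verit))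
qed
lemma line_gap_inner: "\<bar>x \<bullet> z\<bar> \<le> \<bar>y \<bullet> z\<bar> + line_gap x y * norm z"
proof -
  have "\<bar>x \<bullet> z\<bar> \<le> \<bar>y \<bullet> z\<bar> + norm (x - y) * norm z"
    using Cauchy_Schwarz_ineq2[of "x - y" z] by (simp add: inner_diff_left)
  moreover have "\<bar>x \<bullet> z\<bar> \<le> \<bar>y \<bullet> z\<bar> + norm (x + y) * norm z"
    using Cauchy_Schwarz_ineq2[of "x + y" z] by (simp add: inner_add_left)
  ultimately show ?thesis by (simp add: line_gap_def min_def)
qed
text \<open>The bound controls the component of \<open>y\<close> orthogonal to \<open>x\<close>; the component along \<open>x\<close> is then close to
\<open>1\<close> or \<open>- 1\<close>.\<close>

lemma line_gap_le_orthogonal_part: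
  assumes x: "norm x = 1" and y: "norm y = 1"
    and b0: "b \<ge> 0" and b: "\<And>w. w \<bullet> x = 0 \<Longrightarrow> \<bar>y \<bullet> w\<bar> \<le> b * norm w"
  shows "line_gap x y \<le> 2 * b"
proof -
  have xx: "x \<bullet> x = 1" "y \<bullet> y = 1" using x y by (simp_all add: norm_eq_1)
  define c where "c = y \<bullet> x"
  define w where "w = y - c *\<^sub>R x"
  have wx: "w \<bullet> x = 0" by (simp add: w_def c_def inner_diff_left xx)
  have yw: "y \<bullet> w = w \<bullet> w"
    using wx by (simp add: w_def inner_diff_left inner_diff_right inner_commute)
  have w2: "(norm w)\<^sup>2 = 1 - c\<^sup>2"
    unfolding power2_norm_eq_inner yw[symmetric]
    by (simp add: w_def c_def inner_diff_right xx power2_eq_square)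
  have wb: "norm w \<le> b"
  proof (cases "w = 0")
    case True
    then show ?thesis
      by (simp add: b0)
  next
    case False
    have "norm w * norm w \<le> b * norm w"
      using b[OF wx] yw by (simp add: dot_square_norm power2_eq_square)
    then show ?thesis using False by simp
  qed
  have w1: "norm w \<le> 1" by (rule power2_le_imp_le) (use w2 in simp_all)
  have c1: "\<bar>c\<bar> \<le> 1" using Cauchy_Schwarz_ineq2[of y x] x y by (simp add: c_def)
  have "1 - \<bar>c\<bar> \<le> 1 - c\<^sup>2"
    using c1 by (simp add: power2_eq_square) (metis abs_ge_zero abs_mult_self_eq mult_left_le)
  also have "\<dots> \<le> norm w"
    unfolding w2[symmetric] power2_eq_square[of "norm w"] using w1 by (simp add: mult_left_le)
  finally have cw: "1 - \<bar>c\<bar> \<le> norm w" .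
  show ?thesis
  proof (cases "c \<ge> 0")
    case True
    have "x - y = (1 - c) *\<^sub>R x - w" by (simp add: w_def algebra_simps)
    then have "norm (x - y) \<le> (1 - c) + norm w"
      using norm_triangle_ineq4[of "(1 - c) *\<^sub>R x" w] c1 x True by simp
    then show ?thesis using cw wb True by (simp add: line_gap_def)
  next
    case False
    have "x + y = (1 + c) *\<^sub>R x + w" by (simp add: w_def algebra_simps)
    then have "norm (x + y) \<le> (1 + c) + norm w"
      using norm_triangle_ineq[of "(1 + c) *\<^sub>R x" w] c1 x False by simp
    then show ?thesis using cw wb False by (simp add: line_gap_def)
  qed
qed
lemma line_gap_telescope:
  assumes q: "0 < q" "q < 1" and b: "b \<ge> 0"
    and step: "\<And>n. m \<le> n \<Longrightarrow> n < m + l \<Longrightarrow> line_gap (f n) (f (Suc n)) \<le> b * q ^ n"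
  shows "line_gap (f m) (f (m + l)) \<le> b * q ^ m / (1 - q)"
proof -
  have "line_gap (f m) (f (m + l)) \<le> b * q ^ m * (1 - q ^ l) / (1 - q)"
    using step
  proof (induction l)
    case (Suc l)
    have "line_gap (f m) (f (m + Suc l)) \<le> line_gap (f m) (f (m + l)) + line_gap (f (m + l)) (f (Suc (m + l)))"
      using line_gap_triangle by simp
    also have "\<dots> \<le> b * q ^ m * (1 - q ^ l) / (1 - q) + b * q ^ (m + l)"
      using Suc by (intro add_mono) auto
    also have "\<dots> = b * q ^ m * (1 - q ^ Suc l) / (1 - q)"
      using q by (simp add: field_simps power_add)
    finally show ?case .
  qed simp
  also have "\<dots> \<le> b * q ^ m / (1 - q)"
    using q b by (intro divide_right_mono) (auto simp: mult_left_le)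
  finally show ?thesis .
qed
definition opnorm :: "real^'n^'n \<Rightarrow> real" where
  "opnorm A = onorm ((*v) A)"
lemma opnorm: "norm (A *v x) \<le> opnorm A * norm x" for A :: "real^'n^'n"
  unfolding opnorm_def by (rule onorm) (rule matrix_vector_mul_bounded_linear)
lemma opnorm_le: "(\<And>x. norm (A *v x) \<le> b * norm x) \<Longrightarrow> opnorm A \<le> b" for A :: "real^'n^'n"
  unfolding opnorm_def by (rule onorm_le)
lemma opnorm_nonneg: "opnorm A \<ge> 0" for A :: "real^'n^'n"
  unfolding opnorm_def by (rule onorm_pos_le) (rule matrix_vector_mul_bounded_linear)
lemma opnorm_svd: "svd A e f s \<Longrightarrow> opnorm A = s 1"
  unfolding opnorm_def by (rule svd_onorm)
lemma opnorm_pos: "invertible A \<Longrightarrow> opnorm A > 0" for A :: "real^'n^'n"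
  by (metis svd_exists opnorm_svd svdD(3) card_ge1)
lemma opnorm_minus: "opnorm (- A) = opnorm A" for A :: "real^'n^'n"
  by (simp add: opnorm_def minus_matrix_vector_mult[abs_def] onorm_neg)
lemma opnorm_transpose_le: "opnorm (transpose A) \<le> opnorm A" for A :: "real^'n^'n"
proof (rule opnorm_le)
  fix x
  have "norm (transpose A *v x) * norm (transpose A *v x) = (A *v (transpose A *v x)) \<bullet> x"
    by (simp add: transpose_adjoint dot_square_norm power2_eq_square)
  also have "\<dots> \<le> norm (A *v (transpose A *v x)) * norm x" by (rule norm_cauchy_schwarz)
  also have "\<dots> \<le> (opnorm A * norm (transpose A *v x)) * norm x"
    by (intro mult_right_mono opnorm) auto
  finally have "norm (transpose A *v x) * norm (transpose A *v x) \<le> (opnorm A * norm x) * norm (transpose A *v x)"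
    by (simp add: ac_simps)
  then show "norm (transpose A *v x) \<le> opnorm A * norm x"
    using opnorm_nonneg[of A] by (cases "norm (transpose A *v x) = 0") auto
qed
lemma opnorm_transpose: "opnorm (transpose A) = opnorm A" for A :: "real^'n^'n"
  using opnorm_transpose_le[of A] opnorm_transpose_le[of "transpose A"] by simp
text \<open>A unit vector that is stretched most. It need not be unique, as the two largest singular values may agree.\<close>

definition topvec :: "real^'n^'n \<Rightarrow> real^'n \<Rightarrow> bool" where
  "topvec A v \<longleftrightarrow> norm v = 1 \<and> norm (A *v v) = opnorm A"
lemma topvec_minus: "topvec (- A) v \<longleftrightarrow> topvec A v"
  by (simp add: topvec_def opnorm_minus minus_matrix_vector_mult)
text \<open>The Cauchy-Schwarz bound \<open>opnorm A\<close> for the transposed matrix leaves no room: the square of the norm of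
the difference of both sides is not positive.\<close>

lemma topvec_eigen:
  assumes "topvec A v"
  shows "transpose A *v (A *v v) = (opnorm A)\<^sup>2 *\<^sub>R v"
proof -
  let ?N = "opnorm A" let ?z = "transpose A *v (A *v v)"
  have v: "norm v = 1" "norm (A *v v) = ?N" using assms by (auto simp: topvec_def)
  have zv: "?z \<bullet> v = ?N\<^sup>2"
    using v(2) by (metis transpose_adjoint inner_commute power2_norm_eq_inner)
  have "norm ?z \<le> ?N * ?N"
    using opnorm[of "transpose A" "A *v v"] v by (simp add: opnorm_transpose)
  then have z2: "?z \<bullet> ?z \<le> ?N\<^sup>2 * ?N\<^sup>2"
    unfolding power2_norm_eq_inner[symmetric]
    by (metis norm_ge_zero power2_eq_square power_mono)
  have "(?z - ?N\<^sup>2 *\<^sub>R v) \<bullet> (?z - ?N\<^sup>2 *\<^sub>R v) = ?z \<bullet> ?z - 2 * (?N\<^sup>2 * (?z \<bullet> v)) + ?N\<^sup>2 * ?N\<^sup>2 * (v \<bullet> v)"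
    by (simp add: inner_diff_left inner_diff_right inner_commute algebra_simps)
  also have "\<dots> \<le> 0"
  proof -
    have "?N\<^sup>2 * ?N\<^sup>2 * (v \<bullet> v) = ?N\<^sup>2 * ?N\<^sup>2" using v(1) by (simp add: norm_eq_1)
    then show ?thesis unfolding zv using z2 by linarith
  qed
  finally show ?thesis by (metis inner_ge_zero inner_eq_zero_iff order_antisym eq_iff_diff_eq_0)
qed
text \<open>A most stretched vector on whose orthogonal complement the matrix is smaller by the factor \<open>\<epsilon>\<close>; for
\<open>\<epsilon> < 1\<close> this amounts to a bound by \<open>\<epsilon>\<close> on the ratio of the second to the first singular value.\<close>

definition gapvec :: "real^'n^'n \<Rightarrow> real \<Rightarrow> real^'n \<Rightarrow> bool" where
  "gapvec A \<epsilon> v \<longleftrightarrow> topvec A v \<and> (\<forall>w. w \<bullet> v = 0 \<longrightarrow> norm (A *v w) \<le> \<epsilon> * opnorm A * norm w)"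
text \<open>Composing with \<open>C\<close> on the left changes lengths of images by bounded factors, so vectors orthogonal to \<open>v0\<close>
stay short under \<open>C ** A\<close> and cannot contribute much to its most stretched vector \<open>v\<close>: the form
\<open>(C A v) \<bullet> (C A w)\<close> is \<open>(opnorm (C A))\<^sup>2 (v \<bullet> w)\<close>.\<close>

lemma topvec_near_gapvec:
  fixes A C :: "real^'n^'n"
  assumes v0: "gapvec A \<epsilon> v0" and \<epsilon>: "\<epsilon> \<ge> 0" and K: "K \<ge> 1"
    and C: "\<And>x. norm (C *v x) \<le> K * norm x" "\<And>x. norm x \<le> K * norm (C *v x)"
    and pos: "opnorm A > 0" and v: "topvec (C ** A) v"
  shows "line_gap v0 v \<le> 2 * (K\<^sup>2 * \<epsilon>)"
proof (rule line_gap_le_orthogonal_part)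
  let ?X = "C ** A" let ?N = "opnorm ?X"
  show "norm v0 = 1" "norm v = 1" using v0 v by (auto simp: gapvec_def topvec_def)
  have AX: "opnorm A \<le> K * ?N"
  proof (rule opnorm_le)
    fix x
    have "norm (A *v x) \<le> K * norm (?X *v x)" using C(2)[of "A *v x"] by (simp add: matrix_vector_mul_assoc)
    also have "\<dots> \<le> K * (?N * norm x)" using K by (intro mult_left_mono opnorm) auto
    finally show "norm (A *v x) \<le> K * ?N * norm x" by simp
  qed
  then have N: "?N > 0" using pos K less_le_trans[OF pos AX] by (simp add: zero_less_mult_iff)
  fix w assume w: "w \<bullet> v0 = 0"
  have "norm (?X *v w) \<le> K * norm (A *v w)" using C(1)[of "A *v w"] by (simp add: matrix_vector_mul_assoc)
  also have "\<dots> \<le> K * (\<epsilon> * opnorm A * norm w)"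
    using v0 w K by (intro mult_left_mono) (auto simp: gapvec_def)
  also have "\<dots> \<le> K * (\<epsilon> * (K * ?N) * norm w)"
    using AX K \<epsilon> by (intro mult_left_mono mult_right_mono) auto
  finally have Xw: "norm (?X *v w) \<le> K\<^sup>2 * \<epsilon> * norm w * ?N" by (simp add: power2_eq_square ac_simps)
  have "?N\<^sup>2 * (v \<bullet> w) = (?X *v v) \<bullet> (?X *v w)"
    using topvec_eigen[OF v] transpose_adjoint[of ?X w "?X *v v"] by (simp add: inner_commute)
  then have "?N\<^sup>2 * \<bar>v \<bullet> w\<bar> = \<bar>(?X *v v) \<bullet> (?X *v w)\<bar>" by (metis abs_mult abs_power2)
  also have "\<dots> \<le> norm (?X *v v) * norm (?X *v w)" by (rule Cauchy_Schwarz_ineq2)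
  also have "\<dots> \<le> ?N * (K\<^sup>2 * \<epsilon> * norm w * ?N)"
    using v Xw N by (intro mult_mono) (auto simp: topvec_def)
  finally have "?N\<^sup>2 * \<bar>v \<bullet> w\<bar> \<le> ?N\<^sup>2 * (K\<^sup>2 * \<epsilon> * norm w)" by (simp add: power2_eq_square ac_simps)
  then show "\<bar>v \<bullet> w\<bar> \<le> K\<^sup>2 * \<epsilon> * norm w" using N by simp
qed (use \<epsilon> in simp)
text \<open>Both vectors are near the vector that realises the gap of \<open>A\<close>, by the preceding lemma with \<open>C\<close> and with
the identity.\<close>

lemma topvec_close:
  fixes A C :: "real^'n^'n"
  assumes gap: "\<exists>v. gapvec A \<epsilon> v" and \<epsilon>: "\<epsilon> \<ge> 0" and K: "K \<ge> 1"
    and C: "\<And>x. norm (C *v x) \<le> K * norm x" "\<And>x. norm x \<le> K * norm (C *v x)"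
    and pos: "opnorm A > 0" and v: "topvec A v" and v': "topvec (C ** A) v'"
  shows "line_gap v v' \<le> 4 * K\<^sup>2 * \<epsilon>"
proof -
  obtain v0 where v0: "gapvec A \<epsilon> v0" using gap by blast
  have "line_gap v0 v \<le> 2 * (K\<^sup>2 * \<epsilon>)"
  proof -
    have "line_gap v0 v \<le> 2 * (1\<^sup>2 * \<epsilon>)"
      by (rule topvec_near_gapvec[OF v0 \<epsilon> _ _ _ pos, where C = "mat 1"]) (use v in auto)
    also have "\<dots> \<le> 2 * (K\<^sup>2 * \<epsilon>)" using K \<epsilon> by (intro mult_left_mono mult_right_mono power_mono) auto
    finally show ?thesis .
  qed
  moreover have "line_gap v0 v' \<le> 2 * (K\<^sup>2 * \<epsilon>)"
    by (rule topvec_near_gapvec[OF v0 \<epsilon> K C pos v'])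
  ultimately show ?thesis
    using line_gap_triangle[of v v' v0] by (simp add: line_gap_commute)
qed
text \<open>Split \<open>C x\<close> into its part along the major axis \<open>u\<close> and the rest, which is small, and then split \<open>u\<close> along
\<open>v\<close>. With the next lemma, the loss of norm in the product is measured by \<open>v \<bullet> u\<close>.\<close>

lemma opnorm_mult_upper:
  fixes A C :: "real^'n^'n"
  assumes v: "gapvec A \<epsilon> v" and u: "gapvec (transpose C) \<delta> u" and \<epsilon>: "\<epsilon> \<ge> 0" "\<delta> \<ge> 0"
  shows "opnorm (A ** C) \<le> opnorm A * opnorm C * (\<bar>v \<bullet> u\<bar> + \<epsilon> + \<delta>)"
proof (rule opnorm_le)
  fix x
  have v1: "norm v = 1" "v \<bullet> v = 1" and u1: "norm u = 1" "u \<bullet> u = 1"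
    using v u by (auto simp: gapvec_def topvec_def norm_eq_1)
  define \<alpha> where "\<alpha> = (C *v x) \<bullet> u"
  define z where "z = C *v x - \<alpha> *\<^sub>R u"
  have Cx: "C *v x = \<alpha> *\<^sub>R u + z" by (simp add: z_def)
  have zu: "z \<bullet> u = 0" by (simp add: z_def \<alpha>_def inner_diff_left u1)
  have \<alpha>: "\<bar>\<alpha>\<bar> \<le> opnorm C * norm x"
    using Cauchy_Schwarz_ineq2[of "C *v x" u] opnorm[of C x] u1 by (simp add: \<alpha>_def)
  have z: "norm z \<le> \<delta> * opnorm C * norm x"
  proof -
    have "z \<bullet> z = z \<bullet> (C *v x)" using zu by (simp add: Cx inner_add_right)
    also have "\<dots> = (transpose C *v z) \<bullet> x" by (metis transpose_adjoint inner_commute)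
    also have "\<dots> \<le> norm (transpose C *v z) * norm x" by (rule norm_cauchy_schwarz)
    also have "\<dots> \<le> (\<delta> * opnorm C * norm z) * norm x"
      using u zu by (intro mult_right_mono) (auto simp: gapvec_def opnorm_transpose)
    finally have "norm z * norm z \<le> (\<delta> * opnorm C * norm x) * norm z"
      by (simp add: dot_square_norm power2_eq_square ac_simps)
    then show ?thesis using \<epsilon> opnorm_nonneg[of C] by (cases "norm z = 0") auto
  qed
  define \<beta> where "\<beta> = v \<bullet> u"
  define y where "y = u - \<beta> *\<^sub>R v"
  have yv: "y \<bullet> v = 0" by (simp add: y_def \<beta>_def inner_diff_left v1 inner_commute[of v u])
  have "y \<bullet> y = 1 - \<beta>\<^sup>2"
    by (simp add: y_def \<beta>_def inner_diff_left inner_diff_right v1 u1 inner_commute power2_eq_square)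
  then have "(norm y)\<^sup>2 \<le> 1" by (simp add: power2_norm_eq_inner)
  then have y1: "norm y \<le> 1" by (simp add: power2_le_imp_le abs_square_le_1)
  have "A *v u = \<beta> *\<^sub>R (A *v v) + A *v y"
    by (simp add: y_def matrix_vector_mult_diff_distrib matrix_vector_mult_scaleR)
  then have "norm (A *v u) \<le> \<bar>\<beta>\<bar> * norm (A *v v) + norm (A *v y)"
    by (metis norm_scaleR norm_triangle_ineq)
  also have "\<dots> \<le> \<bar>\<beta>\<bar> * opnorm A + \<epsilon> * opnorm A * norm y"
    using v yv by (intro add_mono mult_left_mono) (auto simp: gapvec_def topvec_def)
  also have "\<dots> \<le> \<bar>\<beta>\<bar> * opnorm A + \<epsilon> * opnorm A * 1"
    using y1 \<epsilon> opnorm_nonneg[of A] by (intro add_left_mono mult_left_mono) auto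
  finally have Au: "norm (A *v u) \<le> opnorm A * (\<bar>\<beta>\<bar> + \<epsilon>)" by (simp add: algebra_simps)
  have "norm ((A ** C) *v x) = norm (\<alpha> *\<^sub>R (A *v u) + A *v z)"
    by (simp add: Cx matrix_vector_right_distrib matrix_vector_mult_scaleR flip: matrix_vector_mul_assoc)
  also have "\<dots> \<le> \<bar>\<alpha>\<bar> * norm (A *v u) + norm (A *v z)"
    by (metis norm_scaleR norm_triangle_ineq)
  also have "\<dots> \<le> (opnorm C * norm x) * (opnorm A * (\<bar>\<beta>\<bar> + \<epsilon>)) + opnorm A * (\<delta> * opnorm C * norm x)"
  proof (intro add_mono mult_mono \<alpha> Au)
    show "norm (A *v z) \<le> opnorm A * (\<delta> * opnorm C * norm x)"
      using opnorm[of A z] mult_left_mono[OF z opnorm_nonneg[of A]] by linarith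
  qed (use opnorm_nonneg[of C] in auto)
  finally show "norm ((A ** C) *v x) \<le> opnorm A * opnorm C * (\<bar>v \<bullet> u\<bar> + \<epsilon> + \<delta>) * norm x"
    by (simp add: \<beta>_def algebra_simps)
qed
text \<open>The unit vector that \<open>C\<close> sends to a multiple of \<open>u\<close> witnesses the bound.\<close>

lemma opnorm_mult_lower:
  fixes A C :: "real^'n^'n"
  assumes v: "topvec A v" and u: "topvec (transpose C) u" and pos: "opnorm A > 0" "opnorm C > 0"
  shows "opnorm A * opnorm C * \<bar>v \<bullet> u\<bar> \<le> opnorm (A ** C)"
proof -
  define w where "w = (1 / opnorm C) *\<^sub>R (transpose C *v u)"
  have w1: "norm w = 1" using u pos by (simp add: w_def topvec_def opnorm_transpose)
  have Cw: "C *v w = opnorm C *\<^sub>R u"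
    using topvec_eigen[OF u] pos
    by (simp add: w_def opnorm_transpose matrix_vector_mult_scaleR power2_eq_square)
  have "opnorm A * (opnorm A * \<bar>v \<bullet> u\<bar>) = \<bar>(A *v v) \<bullet> (A *v u)\<bar>"
    using topvec_eigen[OF v] pos
    by (subst inner_commute) (simp add: transpose_adjoint abs_mult inner_commute power2_eq_square)
  also have "\<dots> \<le> norm (A *v v) * norm (A *v u)" by (rule Cauchy_Schwarz_ineq2)
  also have "\<dots> = opnorm A * norm (A *v u)" using v by (simp add: topvec_def)
  finally have "opnorm A * \<bar>v \<bullet> u\<bar> \<le> norm (A *v u)" using pos by simp
  then have "opnorm C * (opnorm A * \<bar>v \<bullet> u\<bar>) \<le> opnorm C * norm (A *v u)" using pos by simp
  also have "\<dots> = norm ((A ** C) *v w)"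
    using pos by (simp add: Cw matrix_vector_mult_scaleR flip: matrix_vector_mul_assoc)
  also have "\<dots> \<le> opnorm (A ** C)" using opnorm[of "A ** C" w] w1 by simp
  finally show ?thesis by (simp add: ac_simps)
qed

section \<open>Products with uniform singular value gaps\<close>

lemma transpose_minus: "transpose (- A) = - transpose A" for A :: "real^'n^'n"
  by (simp add: transpose_def vec_eq_iff)

lemma transpose_expansion_bounds:
  fixes C :: "real^'n^'n"
  assumes inv: "invertible C"
    and C: "\<And>x. norm (C *v x) \<le> K * norm x" "\<And>x. norm x \<le> K * norm (C *v x)"
  shows "norm (transpose C *v x) \<le> K * norm x" "norm x \<le> K * norm (transpose C *v x)"
proof -
  have "opnorm (transpose C) \<le> K" using opnorm_le[of C K] C(1) by (simp add: opnorm_transpose)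
  then show "norm (transpose C *v x) \<le> K * norm x"
    by (meson opnorm mult_right_mono norm_ge_zero order_trans)
  obtain y where y: "x = C *v y"
    using inv by (metis invertible_def matrix_vector_mul_assoc matrix_vector_mul_lid)
  have "norm x * norm x = y \<bullet> (transpose C *v x)"
    using transpose_adjoint[of C y x] y by (simp add: dot_square_norm power2_eq_square)
  also have "\<dots> \<le> norm y * norm (transpose C *v x)" by (rule norm_cauchy_schwarz)
  also have "\<dots> \<le> (K * norm x) * norm (transpose C *v x)"
    using C(2)[of y] y by (intro mult_right_mono) auto
  finally have "norm x * norm x \<le> norm x * (K * norm (transpose C *v x))" by (simp add: ac_simps)
  moreover have "0 \<le> K * norm (transpose C *v x)" if "x = 0" using that by simp
  ultimately show "norm x \<le> K * norm (transpose C *v x)" by (cases "x = 0") auto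
qed

text \<open>\<open>M i j\<close> is the product of the letters with indices in \<open>{i..<j}\<close>. Representatives in the projective
linear group are unique up to sign only, so the products are compatible up to sign.\<close>

definition gap_chain :: "real \<Rightarrow> real \<Rightarrow> real \<Rightarrow> (nat \<Rightarrow> nat \<Rightarrow> real^'n^'n) \<Rightarrow> bool" where
  "gap_chain c q K M \<longleftrightarrow>
     (\<forall>i j k. i \<le> j \<and> j \<le> k \<longrightarrow> M i k = M i j ** M j k \<or> M i k = - (M i j ** M j k)) \<and>
     (\<forall>i j. i \<le> j \<longrightarrow> invertible (M i j)) \<and>
     (\<forall>i x. norm (M i (Suc i) *v x) \<le> K * norm x \<and> norm x \<le> K * norm (M i (Suc i) *v x)) \<and>
     (\<forall>i j. i \<le> j \<longrightarrow> (\<exists>v. gapvec (M i j) (c * q ^ (j - i)) v) \<and>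
                      (\<exists>u. gapvec (transpose (M i j)) (c * q ^ (j - i)) u))"

context
  fixes c q K :: real
  assumes c: "c \<ge> 0" and q: "0 < q" "q < 1" and K: "K \<ge> 1"
begin

context
  fixes M :: "nat \<Rightarrow> nat \<Rightarrow> real^'n^'n"
  assumes M: "gap_chain c q K M"
begin

lemma chain_mult: "i \<le> j \<Longrightarrow> j \<le> k \<Longrightarrow> M i k = M i j ** M j k \<or> M i k = - (M i j ** M j k)"
  and chain_invertible: "i \<le> j \<Longrightarrow> invertible (M i j)"
  and chain_bounds: "norm (M i (Suc i) *v x) \<le> K * norm x" "norm x \<le> K * norm (M i (Suc i) *v x)"
  and chain_gap: "i \<le> j \<Longrightarrow> \<exists>v. gapvec (M i j) (c * q ^ (j - i)) v"
    "i \<le> j \<Longrightarrow> \<exists>u. gapvec (transpose (M i j)) (c * q ^ (j - i)) u"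
  using M unfolding gap_chain_def by blast+

lemma chain_pos: "i \<le> j \<Longrightarrow> opnorm (M i j) > 0"
  by (intro opnorm_pos chain_invertible)

lemma chain_opnorm: "i \<le> j \<Longrightarrow> j \<le> k \<Longrightarrow> opnorm (M i k) = opnorm (M i j ** M j k)"
  by (metis chain_mult opnorm_minus)

lemma chain_left_step:
  assumes "i < j" "topvec (M (Suc i) j) v" "topvec (M i j) v'"
  shows "line_gap v v' \<le> 4 * K\<^sup>2 * c * q ^ (j - Suc i)"
proof -
  have "topvec (M i (Suc i) ** M (Suc i) j) v'"
    using chain_mult[of i "Suc i" j] assms topvec_minus by (metis Suc_leI lessI less_imp_le)
  then have "line_gap v v' \<le> 4 * K\<^sup>2 * (c * q ^ (j - Suc i))"
    using assms c q
    by (intro topvec_close[OF chain_gap(1) _ K chain_bounds chain_pos]) auto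
  then show ?thesis by simp
qed

lemma chain_right_step:
  assumes "i \<le> j" "topvec (transpose (M i j)) u" "topvec (transpose (M i (Suc j))) u'"
  shows "line_gap u u' \<le> 4 * K\<^sup>2 * c * q ^ (j - i)"
proof -
  have "topvec (transpose (M j (Suc j)) ** transpose (M i j)) u'"
    using chain_mult[of i j "Suc j"] assms topvec_minus[of "transpose (M j (Suc j)) ** transpose (M i j)" u']
    by (auto simp: matrix_transpose_mul transpose_minus)
  moreover have "norm (transpose (M j (Suc j)) *v x) \<le> K * norm x"
    "norm x \<le> K * norm (transpose (M j (Suc j)) *v x)" for x
    using transpose_expansion_bounds[OF chain_invertible chain_bounds] by simp_all
  moreover have "opnorm (transpose (M i j)) > 0" using chain_pos assms by (simp add: opnorm_transpose)
  ultimately have "line_gap u u' \<le> 4 * K\<^sup>2 * (c * q ^ (j - i))"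
    using assms c q by (intro topvec_close[OF chain_gap(2) _ K]) auto
  then show ?thesis by simp
qed

text \<open>Lengthening a product on the right moves its major axis by a geometric series of small steps, that starts
at the scale of the shorter product.\<close>

lemma chain_right_near:
  assumes u: "\<And>j. i \<le> j \<Longrightarrow> topvec (transpose (M i j)) (u j)" and jk: "i \<le> j" "j \<le> k"
  shows "line_gap (u j) (u k) \<le> 4 * K\<^sup>2 * c / (1 - q) * q ^ (j - i)"
proof -
  have "line_gap (u (i + (j - i))) (u (i + (j - i + (k - j)))) \<le> 4 * K\<^sup>2 * c * q ^ (j - i) / (1 - q)"
  proof (rule line_gap_telescope[where f = "\<lambda>n. u (i + n)"])
    fix n
    show "line_gap (u (i + n)) (u (i + Suc n)) \<le> 4 * K\<^sup>2 * c * q ^ n"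
      using chain_right_step[OF _ u u, of "i + n"] by simp
  qed (use c q in auto)
  then show ?thesis using jk by simp
qed

lemma chain_left_near:
  assumes v: "\<And>i. i \<le> j \<Longrightarrow> topvec (M i j) (v i)" and ij: "i \<le> i'" "i' \<le> j"
  shows "line_gap (v i') (v i) \<le> 4 * K\<^sup>2 * c / (1 - q) * q ^ (j - i')"
proof -
  have "line_gap (v (j - (j - i'))) (v (j - (j - i' + (i' - i)))) \<le> 4 * K\<^sup>2 * c * q ^ (j - i') / (1 - q)"
  proof (rule line_gap_telescope[where f = "\<lambda>n. v (j - n)"])
    fix n assume "n < j - i' + (i' - i)"
    then have *: "Suc (j - Suc n) = j - n" "j - (j - n) = n" using ij by auto
    show "line_gap (v (j - n)) (v (j - Suc n)) \<le> 4 * K\<^sup>2 * c * q ^ n"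
      using chain_left_step[of "j - Suc n" j "v (j - n)" "v (j - Suc n)"] v[of "j - n"] v[of "j - Suc n"] *
      by simp
  qed (use c q in auto)
  then show ?thesis using ij by simp
qed

lemma chain_diag: "opnorm (M i i) = 1"
proof -
  have iso: "norm (M i i *v x) = norm x" for x
  proof -
    obtain y where y: "x = M i i *v y"
      using chain_invertible[of i i]
      by (metis invertible_def matrix_vector_mul_assoc matrix_vector_mul_lid order_refl)
    from chain_mult[of i i i] consider "M i i = M i i ** M i i" | "M i i = - (M i i ** M i i)" by auto
    then have "norm (M i i *v y) = norm ((M i i ** M i i) *v y)"
    proof cases
      case 1
      then show ?thesis by (rule arg_cong)
    next
      case 2
      then have "norm (M i i *v y) = norm ((- (M i i ** M i i)) *v y)" by (rule arg_cong)
      then show ?thesis by (simp only: minus_matrix_vector_mult norm_minus_cancel)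
    qed
    then have "norm (M i i *v y) = norm (M i i *v (M i i *v y))" by (simp only: matrix_vector_mul_assoc)
    then show ?thesis using y by simp
  qed
  obtain x :: "real^'n" where "norm x = 1" using vector_choose_size[of 1] by auto
  then have "1 \<le> opnorm (M i i)" using opnorm[of "M i i" x] iso by simp
  moreover have "opnorm (M i i) \<le> 1" by (rule opnorm_le) (simp add: iso)
  ultimately show ?thesis by simp
qed

lemma chain_opnorm_right:
  assumes "i \<le> j"
  shows "opnorm (M i (Suc j)) \<le> K * opnorm (M i j)" "opnorm (M i j) \<le> K * opnorm (M i (Suc j))"
proof -
  have eq: "norm (transpose (M i (Suc j)) *v x) = norm (transpose (M j (Suc j)) *v (transpose (M i j) *v x))" for x
    using chain_mult[of i j "Suc j"] assms
    by (auto simp: matrix_transpose_mul transpose_minus minus_matrix_vector_mult matrix_vector_mul_assoc)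
  note b = transpose_expansion_bounds[OF chain_invertible chain_bounds, of j]
  have "opnorm (transpose (M i (Suc j))) \<le> K * opnorm (transpose (M i j))"
  proof (rule opnorm_le)
    fix x
    have "norm (transpose (M i (Suc j)) *v x) \<le> K * norm (transpose (M i j) *v x)" unfolding eq by (rule b) auto
    also have "\<dots> \<le> K * (opnorm (transpose (M i j)) * norm x)" using K by (intro mult_left_mono opnorm) auto
    finally show "norm (transpose (M i (Suc j)) *v x) \<le> K * opnorm (transpose (M i j)) * norm x" by simp
  qed
  then show "opnorm (M i (Suc j)) \<le> K * opnorm (M i j)" by (simp add: opnorm_transpose)
  have "opnorm (transpose (M i j)) \<le> K * opnorm (transpose (M i (Suc j)))"
  proof (rule opnorm_le)
    fix x
    have "norm (transpose (M i j) *v x) \<le> K * norm (transpose (M i (Suc j)) *v x)" unfolding eq by (rule b) auto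
    also have "\<dots> \<le> K * (opnorm (transpose (M i (Suc j))) * norm x)" using K by (intro mult_left_mono opnorm) auto
    finally show "norm (transpose (M i j) *v x) \<le> K * opnorm (transpose (M i (Suc j))) * norm x" by simp
  qed
  then show "opnorm (M i j) \<le> K * opnorm (M i (Suc j))" by (simp add: opnorm_transpose)
qed

lemma chain_opnorm_left:
  assumes "i < j"
  shows "opnorm (M i j) \<le> K * opnorm (M (Suc i) j)" "opnorm (M (Suc i) j) \<le> K * opnorm (M i j)"
proof -
  have eq: "norm (M i j *v x) = norm (M i (Suc i) *v (M (Suc i) j *v x))" for x
    using chain_mult[of i "Suc i" j] assms by (auto simp: minus_matrix_vector_mult matrix_vector_mul_assoc)
  show "opnorm (M i j) \<le> K * opnorm (M (Suc i) j)"
  proof (rule opnorm_le)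
    fix x
    have "norm (M i j *v x) \<le> K * norm (M (Suc i) j *v x)" unfolding eq by (rule chain_bounds)
    also have "\<dots> \<le> K * (opnorm (M (Suc i) j) * norm x)" using K by (intro mult_left_mono opnorm) auto
    finally show "norm (M i j *v x) \<le> K * opnorm (M (Suc i) j) * norm x" by simp
  qed
  show "opnorm (M (Suc i) j) \<le> K * opnorm (M i j)"
  proof (rule opnorm_le)
    fix x
    have "norm (M (Suc i) j *v x) \<le> K * norm (M i j *v x)" unfolding eq by (rule chain_bounds)
    also have "\<dots> \<le> K * (opnorm (M i j) * norm x)" using K by (intro mult_left_mono opnorm) auto
    finally show "norm (M (Suc i) j *v x) \<le> K * opnorm (M i j) * norm x" by simp
  qed
qed

text \<open>The loss at \<open>j\<close> for the long product bounds \<open>v i \<bullet> u k\<close>; passing to the shorter products moves the two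
directions and introduces errors that are exponentially small in the lengths of the shorter factors.\<close>

lemma chain_defect_propagates:
  assumes ijk: "i \<le> i'" "i' \<le> j" "j \<le> k'" "k' \<le> k"
  defines "C \<equiv> 4 * K\<^sup>2 * c / (1 - q) + c"
  shows "opnorm (M i' k') / (opnorm (M i' j) * opnorm (M j k'))
    \<le> opnorm (M i k) / (opnorm (M i j) * opnorm (M j k)) + C * q ^ (j - i') + C * q ^ (k' - j)"
proof -
  define v where "v x = (SOME w. gapvec (M x j) (c * q ^ (j - x)) w)" for x
  define u where "u y = (SOME w. gapvec (transpose (M j y)) (c * q ^ (y - j)) w)" for y
  have v: "gapvec (M x j) (c * q ^ (j - x)) (v x)" if "x \<le> j" for x
    unfolding v_def by (rule someI_ex) (rule chain_gap(1)[OF that])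
  have u: "gapvec (transpose (M j y)) (c * q ^ (y - j)) (u y)" if "j \<le> y" for y
    unfolding u_def by (rule someI_ex) (rule chain_gap(2)[OF that])
  have tv: "x \<le> j \<Longrightarrow> topvec (M x j) (v x)" for x using v by (simp add: gapvec_def)
  have tu: "j \<le> y \<Longrightarrow> topvec (transpose (M j y)) (u y)" for y using u by (simp add: gapvec_def)
  have n1: "norm (v i) = 1" "norm (u k') = 1"
    using tv[of i] tu[of k'] ijk by (auto simp: topvec_def)
  have pos: "opnorm (M i' j) > 0" "opnorm (M j k') > 0" "opnorm (M i j) > 0" "opnorm (M j k) > 0"
    using ijk by (auto intro!: chain_pos)
  have "opnorm (M i' k') \<le> opnorm (M i' j) * opnorm (M j k') *
      (\<bar>v i' \<bullet> u k'\<bar> + c * q ^ (j - i') + c * q ^ (k' - j))"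
    using opnorm_mult_upper[OF v u, of i' k'] chain_opnorm[of i' j k'] ijk c q by simp
  then have up: "opnorm (M i' k') / (opnorm (M i' j) * opnorm (M j k'))
      \<le> \<bar>v i' \<bullet> u k'\<bar> + c * q ^ (j - i') + c * q ^ (k' - j)"
    using pos by (simp add: pos_divide_le_eq mult.commute)
  have "opnorm (M i j) * opnorm (M j k) * \<bar>v i \<bullet> u k\<bar> \<le> opnorm (M i k)"
    using opnorm_mult_lower[OF tv tu, of i k] chain_opnorm[of i j k] ijk pos by simp
  then have lo: "\<bar>v i \<bullet> u k\<bar> \<le> opnorm (M i k) / (opnorm (M i j) * opnorm (M j k))"
    using pos by (simp add: pos_le_divide_eq mult.commute)
  have "\<bar>v i' \<bullet> u k'\<bar> \<le> \<bar>v i \<bullet> u k'\<bar> + line_gap (v i') (v i)"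
    using line_gap_inner[of "v i'" "u k'" "v i"] n1 by simp
  moreover have "\<bar>v i \<bullet> u k'\<bar> \<le> \<bar>v i \<bullet> u k\<bar> + line_gap (u k') (u k)"
    using line_gap_inner[of "u k'" "v i" "u k"] n1 by (simp add: inner_commute)
  moreover have "line_gap (v i') (v i) \<le> 4 * K\<^sup>2 * c / (1 - q) * q ^ (j - i')"
    using ijk by (intro chain_left_near tv) auto
  moreover have "line_gap (u k') (u k) \<le> 4 * K\<^sup>2 * c / (1 - q) * q ^ (k' - j)"
    using ijk by (intro chain_right_near tu) auto
  ultimately show ?thesis using up lo unfolding C_def distrib_right by linarith
qed

end

text \<open>The constant depends on \<open>c\<close>, \<open>q\<close> and \<open>K\<close> only. The logarithms of the norms satisfy the hypotheses of
\<open>almost_additive\<close> with \<open>\<mu> = - ln q\<close>; the summand 1 in \<open>ln K + 1\<close> makes the Lipschitz constant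
positive.\<close>

lemma chain_almost_multiplicative:
  "\<exists>D>0. \<forall>M :: nat \<Rightarrow> nat \<Rightarrow> real^'n^'n. gap_chain c q K M \<longrightarrow>
     (\<forall>i j k. i \<le> j \<longrightarrow> j \<le> k \<longrightarrow> opnorm (M i j) * opnorm (M j k) \<le> D * opnorm (M i k))"
proof -
  define C where "C = 4 * K\<^sup>2 * c / (1 - q) + c"
  define \<mu> where "\<mu> = - ln q"
  have C0: "C \<ge> 0" using c q by (simp add: C_def)
  have \<mu>: "\<mu> > 0" using q by (simp add: \<mu>_def)
  have qe: "q ^ n = exp (- \<mu> * real n)" for n
    using q by (simp add: \<mu>_def exp_of_nat2_mult[symmetric] mult.commute) (simp add: exp_of_nat_mult)
  have \<kappa>: "ln K + 1 > 0" using K by (simp add: ln_ge_zero add_nonneg_pos)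
  from almost_additive[OF \<kappa> \<mu> C0] obtain D where D: "\<And>a :: nat \<Rightarrow> nat \<Rightarrow> real.
    (\<forall>i. a i i = 0) \<Longrightarrow>
    (\<forall>i j. i \<le> j \<longrightarrow> \<bar>a i (Suc j) - a i j\<bar> \<le> ln K + 1) \<Longrightarrow>
    (\<forall>i j. i < j \<longrightarrow> \<bar>a i j - a (Suc i) j\<bar> \<le> ln K + 1) \<Longrightarrow>
    (\<forall>i i' j k' k. i \<le> i' \<and> i' \<le> j \<and> j \<le> k' \<and> k' \<le> k \<longrightarrow>
       exp (a i' k' - a i' j - a j k') \<le> exp (a i k - a i j - a j k)
         + C * exp (- \<mu> * real (j - i')) + C * exp (- \<mu> * real (k' - j))) \<Longrightarrow>
    (\<forall>i j k. i \<le> j \<and> j \<le> k \<longrightarrow> a i j + a j k \<le> a i k + D)"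
    by blast
  have main: "opnorm (M i j) * opnorm (M j k) \<le> exp D * opnorm (M i k)"
    if M: "gap_chain c q K M" and ijk: "i \<le> j" "j \<le> k" for M :: "nat \<Rightarrow> nat \<Rightarrow> real^'n^'n" and i j k
  proof -
    define a where "a i j = ln (opnorm (M i j))" for i j
    note pos = chain_pos[OF M]
    have lnK: "\<bar>ln x - ln y\<bar> \<le> ln K + 1" if "x > 0" "y > 0" "x \<le> K * y" "y \<le> K * x" for x y
    proof -
      have "ln x \<le> ln (K * y)" "ln y \<le> ln (K * x)" using that K by (auto intro!: ln_mono)
      then show ?thesis using that K by (simp add: ln_mult)
    qed
    have ea: "exp (a x z - a x y - a y z) = opnorm (M x z) / (opnorm (M x y) * opnorm (M y z))"
      if "x \<le> y" "y \<le> z" for x y z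
      using that pos[of x z] pos[of x y] pos[of y z] by (simp add: a_def exp_diff)
    have "\<forall>i j k. i \<le> j \<and> j \<le> k \<longrightarrow> a i j + a j k \<le> a i k + D"
    proof (rule D; intro allI impI)
      show "a i i = 0" for i by (simp add: a_def chain_diag[OF M])
      show "\<bar>a i (Suc j) - a i j\<bar> \<le> ln K + 1" if "i \<le> j" for i j
        unfolding a_def using that chain_opnorm_right[OF M that] by (intro lnK pos) auto
      show "\<bar>a i j - a (Suc i) j\<bar> \<le> ln K + 1" if "i < j" for i j
        unfolding a_def using that chain_opnorm_left[OF M that] by (intro lnK pos) auto
      fix i i' j k' k :: nat assume *: "i \<le> i' \<and> i' \<le> j \<and> j \<le> k' \<and> k' \<le> k"
      then show "exp (a i' k' - a i' j - a j k') \<le> exp (a i k - a i j - a j k)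
         + C * exp (- \<mu> * real (j - i')) + C * exp (- \<mu> * real (k' - j))"
        using chain_defect_propagates[OF M, of i i' j k' k] by (simp add: ea C_def qe)
    qed
    then have "a i j + a j k \<le> a i k + D" using ijk by blast
    then have "exp (a i j + a j k) \<le> exp (a i k + D)" by simp
    then show ?thesis using ijk pos[of i j] pos[of j k] pos[of i k]
      by (simp add: a_def exp_add mult.commute)
  qed
  show ?thesis by (rule exI[of _ "exp D"]) (use main in auto)
qed

text \<open>The major axes form a Cauchy sequence of lines; compactness of the sphere provides the limit and, along a
subsequence, convergence of the representing vectors themselves.\<close>

lemma chain_limit:
  fixes M :: "nat \<Rightarrow> nat \<Rightarrow> real^'n^'n"
  assumes M: "gap_chain c q K M" and u: "\<And>j. topvec (transpose (M 0 j)) (u j)"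
  obtains x r where "norm x = 1" "(\<lambda>j. line_gap (u j) x) \<longlonglongrightarrow> 0" "strict_mono r" "(u \<circ> r) \<longlonglongrightarrow> x"
proof -
  let ?b = "4 * K\<^sup>2 * c / (1 - q)"
  have "\<forall>j. u j \<in> sphere 0 1" using u by (auto simp: topvec_def)
  then obtain x r where x: "x \<in> sphere 0 1" and r: "strict_mono r" "(u \<circ> r) \<longlonglongrightarrow> x"
    using compact_sphere[of "0::real^'n" 1] unfolding compact_def by metis
  have le: "line_gap (u j) x \<le> ?b * q ^ j" for j
  proof (rule field_le_epsilon)
    fix e :: real assume "e > 0"
    then obtain n0 where n0: "\<And>n. n \<ge> n0 \<Longrightarrow> dist ((u \<circ> r) n) x < e"
      using r(2) unfolding lim_sequentially by blast
    define n where "n = max n0 j"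
    have "j \<le> r n" using seq_suble[OF r(1), of n] by (simp add: n_def)
    then have "line_gap (u j) (u (r n)) \<le> ?b * q ^ (j - 0)"
      using u by (intro chain_right_near[OF M]) auto
    moreover have "line_gap (u (r n)) x \<le> e"
      using n0[of n] by (simp add: n_def line_gap_def dist_norm min.coboundedI1)
    ultimately show "line_gap (u j) x \<le> ?b * q ^ j + e" using line_gap_triangle[of "u j" x "u (r n)"] by simp
  qed
  have "(\<lambda>j. line_gap (u j) x) \<longlonglongrightarrow> 0"
  proof (rule tendsto_sandwich[of "\<lambda>_. 0"])
    have "(\<lambda>j. ?b * q ^ j) \<longlonglongrightarrow> ?b * 0"
      using q by (intro tendsto_mult_left LIMSEQ_realpow_zero) auto
    then show "(\<lambda>j. ?b * q ^ j) \<longlonglongrightarrow> 0" by simp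
  qed (use le in \<open>auto simp: line_gap_nonneg\<close>)
  then show thesis using that x r by auto
qed

end

text \<open>The major axis of a longer product \<open>M 0 j\<close> is \<open>M 0 i\<close> applied to a vector of norm at most
\<open>opnorm (M i j) / opnorm (M 0 j) \<le> D / s 1\<close>, so it lies in the ellipsoid with axes \<open>D s k / s 1\<close>. The
condition is closed and insensitive to signs, hence passes to the limit.\<close>

lemma chain_shadow:
  fixes M :: "nat \<Rightarrow> nat \<Rightarrow> real^'n^'n"
  assumes M: "gap_chain c q K M"
    and D: "\<And>i j k. i \<le> j \<Longrightarrow> j \<le> k \<Longrightarrow> opnorm (M i j) * opnorm (M j k) \<le> D * opnorm (M i k)"
    and u: "\<And>j. topvec (transpose (M 0 j)) (u j)"
    and r: "strict_mono r" "(u \<circ> r) \<longlonglongrightarrow> x"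
    and svd: "svd (M 0 i) e f s" and k: "k \<in> {1..CARD('n)}"
  shows "\<bar>x \<bullet> f k\<bar> \<le> D * s k / s 1"
proof -
  note S = svdD[OF svd]
  have s1: "s 1 > 0" and sk: "s k > 0" using S(3)[OF card_ge1] S(3)[OF k] by auto
  have le: "\<bar>u j \<bullet> f k\<bar> \<le> D * s k / s 1" if j: "i \<le> j" for j
  proof -
    let ?N = "opnorm (M 0 j)"
    have N: "?N > 0" using M by (intro opnorm_pos) (auto simp: gap_chain_def)
    define w where "w = (1 / ?N) *\<^sub>R (transpose (M 0 j) *v u j)"
    have w1: "norm w = 1" using u[of j] N by (simp add: w_def topvec_def opnorm_transpose)
    have Mw: "M 0 j *v w = ?N *\<^sub>R u j"
      using topvec_eigen[OF u[of j]] N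
      by (simp add: w_def opnorm_transpose matrix_vector_mult_scaleR power2_eq_square)
    have "M 0 j = M 0 i ** M i j \<or> M 0 j = - (M 0 i ** M i j)"
      using M j by (auto simp: gap_chain_def)
    then have "\<bar>(M 0 j *v w) \<bullet> f k\<bar> = \<bar>(M 0 i *v (M i j *v w)) \<bullet> f k\<bar>"
      by (auto simp: minus_matrix_vector_mult matrix_vector_mul_assoc)
    also have "\<dots> = s k * \<bar>(M i j *v w) \<bullet> e k\<bar>"
      using S(5)[OF k] sk by (simp add: transpose_adjoint abs_mult)
    also have "\<dots> \<le> s k * opnorm (M i j)"
    proof (intro mult_left_mono)
      have "\<bar>(M i j *v w) \<bullet> e k\<bar> \<le> norm (M i j *v w) * norm (e k)" by (rule Cauchy_Schwarz_ineq2)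
      also have "\<dots> \<le> opnorm (M i j)" using opnorm[of "M i j" w] w1 orthonormal_frame_unit[OF S(1) k] by simp
      finally show "\<bar>(M i j *v w) \<bullet> e k\<bar> \<le> opnorm (M i j)" .
    qed (use sk in simp)
    finally have 1: "?N * \<bar>u j \<bullet> f k\<bar> \<le> s k * opnorm (M i j)"
      using N by (simp add: Mw abs_mult)
    have "opnorm (M i j) * s 1 \<le> D * ?N"
      using D[of 0 i j] j opnorm_svd[OF svd] by (simp add: mult.commute)
    then have "s k * (opnorm (M i j) * s 1) \<le> s k * (D * ?N)" using sk by (intro mult_left_mono) auto
    moreover have "?N * \<bar>u j \<bullet> f k\<bar> * s 1 \<le> s k * opnorm (M i j) * s 1"
      using 1 s1 by (intro mult_right_mono) auto
    ultimately have "?N * (\<bar>u j \<bullet> f k\<bar> * s 1) \<le> ?N * (D * s k)" by (simp add: ac_simps)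
    then have "\<bar>u j \<bullet> f k\<bar> * s 1 \<le> D * s k" using N by simp
    then show ?thesis using s1 by (simp add: pos_le_divide_eq)
  qed
  have "(\<lambda>n. \<bar>(u \<circ> r) n \<bullet> f k\<bar>) \<longlonglongrightarrow> \<bar>x \<bullet> f k\<bar>"
    by (intro tendsto_intros r(2))
  moreover have "\<forall>n\<ge>i. \<bar>(u \<circ> r) n \<bullet> f k\<bar> \<le> D * s k / s 1"
  proof (intro allI impI)
    fix n assume "n \<ge> i"
    then show "\<bar>(u \<circ> r) n \<bullet> f k\<bar> \<le> D * s k / s 1"
      using le[of "r n"] seq_suble[OF r(1), of n] by simp
  qed
  ultimately show ?thesis using LIMSEQ_le_const2 by blast
qed

section \<open>Representatives in the linear group and word length\<close>

lemma det_scaleR: "det (c *\<^sub>R A) = c ^ CARD('n) * det A" for A :: "real^'n^'n"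
proof -
  have "c *\<^sub>R A = (\<chi> i. c *s A $ i)" by (simp add: vec_eq_iff)
  then have "det (c *\<^sub>R A) = prod (\<lambda>i. c) (UNIV :: 'n set) * det (\<chi> i. A $ i)"
    using det_rows_mul[of "\<lambda>i::'n. c" "\<lambda>i. A $ i"] by simp
  then show ?thesis by simp
qed

lemma PGL_carrierE:
  fixes \<gamma> :: "(real^'n^'n) set"
  assumes "\<gamma> \<in> carrier PGL"
  obtains A where "invertible A" "\<gamma> = {c *\<^sub>R A |c. c \<noteq> 0}"
proof -
  from assms obtain A where A: "A \<in> carrier GL" "\<gamma> = scalar_matrices #>\<^bsub>GL\<^esub> A"
    by (auto simp: PGL_def FactGroup_def RCOSETS_def)
  have "\<gamma> = {c *\<^sub>R A |c. c \<noteq> 0}"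
    unfolding A(2) r_coset_def scalar_matrices_def GL_def by (auto simp flip: scalar_matrix_assoc)
  then show thesis using that A(1) by (simp add: GL_def)
qed

lemma unimod_rep:
  fixes \<gamma> :: "(real^'n^'n) set"
  assumes "\<gamma> \<in> carrier PGL"
  shows "unimod_rep \<gamma> \<in> \<gamma>" "\<bar>det (unimod_rep \<gamma>)\<bar> = 1"
proof -
  obtain A where A: "invertible A" "\<gamma> = {c *\<^sub>R A |c. c \<noteq> 0}" using PGL_carrierE[OF assms] .
  have d: "\<bar>det A\<bar> > 0" using A(1) by (simp add: invertible_det_nz)
  define c where "c = root CARD('n) (1 / \<bar>det A\<bar>)"
  have c: "c > 0" "c ^ CARD('n) = 1 / \<bar>det A\<bar>" using d by (auto simp: c_def)
  have "\<bar>det (c *\<^sub>R A)\<bar> = 1" using c d by (simp add: det_scaleR abs_mult)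
  moreover have "c *\<^sub>R A \<in> \<gamma>" using A(2) c(1) by auto
  ultimately have "\<exists>X. X \<in> \<gamma> \<and> \<bar>det X\<bar> = 1" by blast
  from someI_ex[OF this] show "unimod_rep \<gamma> \<in> \<gamma>" "\<bar>det (unimod_rep \<gamma>)\<bar> = 1"
    unfolding unimod_rep_def by auto
qed

lemma unimod_rep_invertible: "\<gamma> \<in> carrier PGL \<Longrightarrow> invertible (unimod_rep \<gamma>)"
  using unimod_rep(2)[of \<gamma>] by (auto simp: invertible_det_nz)

text \<open>Two matrices that represent the same element differ by a scalar, and determinant of absolute value 1 on
both sides makes it a sign.\<close>

lemma unimod_rep_mult:
  fixes \<gamma> \<delta> :: "(real^'n^'n) set"
  assumes "\<gamma> \<in> carrier PGL" "\<delta> \<in> carrier PGL"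
  shows "unimod_rep (\<gamma> \<otimes>\<^bsub>PGL\<^esub> \<delta>) = unimod_rep \<gamma> ** unimod_rep \<delta> \<or>
         unimod_rep (\<gamma> \<otimes>\<^bsub>PGL\<^esub> \<delta>) = - (unimod_rep \<gamma> ** unimod_rep \<delta>)"
proof -
  let ?X = "unimod_rep (\<gamma> \<otimes>\<^bsub>PGL\<^esub> \<delta>)" and ?Y = "unimod_rep \<gamma> ** unimod_rep \<delta>"
  have in_carrier: "\<gamma> \<otimes>\<^bsub>PGL\<^esub> \<delta> \<in> carrier PGL"
    using assms by (intro monoid.m_closed group.is_monoid group_PGL)
  have Y: "?Y \<in> \<gamma> \<otimes>\<^bsub>PGL\<^esub> \<delta>"
    using unimod_rep(1) assms by (auto simp: PGL_def FactGroup_def set_mult_def GL_def)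
  obtain A where A: "invertible A" "\<gamma> \<otimes>\<^bsub>PGL\<^esub> \<delta> = {c *\<^sub>R A |c. c \<noteq> 0}"
    by (rule PGL_carrierE[OF in_carrier])
  obtain b where b: "b \<noteq> 0" "?Y = b *\<^sub>R A" using Y unfolding A(2) by blast
  obtain a where a: "?X = a *\<^sub>R A" using unimod_rep(1)[OF in_carrier] unfolding A(2) by blast
  have X: "?X = (a / b) *\<^sub>R ?Y" unfolding a b(2) using b(1) by simp
  have "\<bar>det ?Y\<bar> = 1" using unimod_rep(2)[OF assms(1)] unimod_rep(2)[OF assms(2)] by (simp add: det_mul abs_mult)
  moreover have "\<bar>det ?X\<bar> = 1" by (rule unimod_rep(2)[OF in_carrier])
  moreover have "\<bar>det ?X\<bar> = \<bar>a / b\<bar> ^ CARD('n) * \<bar>det ?Y\<bar>"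
    by (subst X) (simp only: det_scaleR abs_mult power_abs)
  ultimately have "\<bar>a / b\<bar> ^ CARD('n) = 1 ^ CARD('n)" by simp
  then have "\<bar>a / b\<bar> = 1" by (rule power_eq_imp_eq_base) auto
  then show ?thesis using X by (auto simp: abs_if split: if_splits)
qed

context group
begin

definition represents :: "'a set \<Rightarrow> 'a list \<Rightarrow> 'a \<Rightarrow> bool" where
  "represents S xs x \<longleftrightarrow> set xs \<subseteq> S \<union> (\<lambda>s. inv s) ` S \<and> foldr (\<otimes>) xs \<one> = x"

lemma word_length_eq_Least: "word_length G S x = (LEAST n. \<exists>xs. length xs = n \<and> represents S xs x)"
  by (simp add: word_length_def represents_def)

lemma foldr_mult_append:
  assumes "set xs \<subseteq> carrier G" "set ys \<subseteq> carrier G"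
  shows "foldr (\<otimes>) (xs @ ys) \<one> = foldr (\<otimes>) xs \<one> \<otimes> foldr (\<otimes>) ys \<one>"
proof -
  have cl: "foldr (\<otimes>) zs \<one> \<in> carrier G" if "set zs \<subseteq> carrier G" for zs
    using that by (induction zs) auto
  show ?thesis using assms by (induction xs) (auto simp: cl m_assoc)
qed

lemma represents_mult:
  assumes "S \<subseteq> carrier G" "represents S xs x" "represents S ys y"
  shows "represents S (xs @ ys) (x \<otimes> y)"
proof -
  have "S \<union> (\<lambda>s. inv s) ` S \<subseteq> carrier G" using assms(1) by auto
  then have "set xs \<subseteq> carrier G" "set ys \<subseteq> carrier G"
    using assms(2,3) unfolding represents_def by (meson order_trans)+
  then show ?thesis using assms(2,3) foldr_mult_append[of xs ys] by (simp add: represents_def)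
qed

lemma represents_exists:
  assumes "S \<subseteq> carrier G" "x \<in> generate G S"
  shows "\<exists>xs. represents S xs x"
  using assms(2)
proof induction
  case one
  then show ?case by (intro exI[of _ "[]"]) (simp add: represents_def)
next
  case (incl h)
  then show ?case using assms(1) by (intro exI[of _ "[h]"]) (auto simp: represents_def)
next
  case (inv h)
  then have "h \<in> carrier G" using assms(1) by auto
  then show ?case using inv by (intro exI[of _ "[inv h]"]) (auto simp: represents_def)
next
  case (eng h1 h2)
  then show ?case using represents_mult[OF assms(1)] by blast
qed

lemma word_length_le: "represents S xs x \<Longrightarrow> word_length G S x \<le> length xs"
  unfolding word_length_eq_Least by (rule Least_le) blast

lemma word_length_attained:
  assumes "S \<subseteq> carrier G" "x \<in> generate G S"
  obtains xs where "represents S xs x" "length xs = word_length G S x"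
proof -
  have "\<exists>n xs. length xs = n \<and> represents S xs x" using represents_exists[OF assms] by blast
  from LeastI_ex[OF this] show thesis using that unfolding word_length_eq_Least by auto
qed

lemma word_length_one [simp]: "word_length G S \<one> = 0"
  using word_length_le[of S "[]" \<one>] by (simp add: represents_def)

lemma word_length_mult:
  assumes S: "S \<subseteq> carrier G" and "x \<in> generate G S" "y \<in> generate G S"
  shows "word_length G S (x \<otimes> y) \<le> word_length G S x + word_length G S y"
  using word_length_attained[OF S assms(2)] word_length_attained[OF S assms(3)]
    represents_mult[OF S] word_length_le by (metis length_append)

lemma finite_word_ball:
  assumes "finite S" and S: "S \<subseteq> carrier G"
  shows "finite {x \<in> generate G S. word_length G S x \<le> n}"
proof (rule finite_subset)
  let ?L = "{xs. set xs \<subseteq> S \<union> (\<lambda>s. inv s) ` S \<and> length xs \<le> n}"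
  show "finite ((\<lambda>xs. foldr (\<otimes>) xs \<one>) ` ?L)"
    using assms by (intro finite_imageI finite_lists_length_le) auto
  show "{x \<in> generate G S. word_length G S x \<le> n} \<subseteq> (\<lambda>xs. foldr (\<otimes>) xs \<one>) ` ?L"
  proof
    fix x assume x: "x \<in> {x \<in> generate G S. word_length G S x \<le> n}"
    then obtain xs where "represents S xs x" "length xs = word_length G S x"
      using word_length_attained[OF S, of x] by blast
    then show "x \<in> (\<lambda>xs. foldr (\<otimes>) xs \<one>) ` ?L" using x by (auto simp: represents_def)
  qed
qed

text \<open>Every letter of one generating set is a word of bounded length in the other.\<close>

lemma word_length_compare:
  assumes S: "finite_gen_set G H S" and S': "finite_gen_set G H S'" and H: "H \<subseteq> carrier G"
  obtains K :: nat where "K > 0" "\<And>x. x \<in> H \<Longrightarrow> word_length G S x \<le> K * word_length G S' x"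
proof -
  have S_c: "S \<subseteq> carrier G" "generate G S = H" and S'_c: "S' \<subseteq> carrier G" "generate G S' = H" "finite S'" "S' \<subseteq> H"
    using S S' H by (auto simp: finite_gen_set_def)
  let ?T = "S' \<union> (\<lambda>s. inv s) ` S'"
  define K where "K = Suc (\<Sum>s\<in>?T. word_length G S s)"
  have TH: "?T \<subseteq> H" using S'_c generate.inv[of _ S' G] by auto
  have le: "word_length G S s \<le> K" if "s \<in> ?T" for s
    using member_le_sum[OF that, of "word_length G S"] S'_c(3) by (simp add: K_def)
  have "word_length G S (foldr (\<otimes>) xs \<one>) \<le> K * length xs \<and> foldr (\<otimes>) xs \<one> \<in> H"
    if "set xs \<subseteq> ?T" for xs
    using that
  proof (induction xs)
    case Nil
    then show ?case using generate.one[of G S'] S'_c(2) by simp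
  next
    case (Cons s xs)
    then have IH: "word_length G S (foldr (\<otimes>) xs \<one>) \<le> K * length xs" "foldr (\<otimes>) xs \<one> \<in> H"
      and s: "s \<in> ?T" "s \<in> H" using TH by auto
    have "s \<otimes> foldr (\<otimes>) xs \<one> \<in> H" using s IH S'_c(2) generate.eng by metis
    moreover have "word_length G S (s \<otimes> foldr (\<otimes>) xs \<one>) \<le> word_length G S s + word_length G S (foldr (\<otimes>) xs \<one>)"
      using s IH S_c by (intro word_length_mult) auto
    ultimately show ?case using le[OF s(1)] IH by simp
  qed
  then have "word_length G S x \<le> K * word_length G S' x" if "x \<in> H" for x
    using word_length_attained[OF S'_c(1), of x] that S'_c(2) by (metis represents_def)
  then show thesis using that[of K] by (simp add: K_def)
qed

end

text \<open>The defining estimate holds for one generating set; a change of generators alters the rate only.\<close>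

lemma anosov_gap:
  assumes "projective_anosov B \<Gamma>" and S: "finite_gen_set PGL \<Gamma> S"
  obtains c \<mu> where "c > 0" "\<mu> > 0"
    "\<And>\<gamma>. \<gamma> \<in> \<Gamma> \<Longrightarrow> sv B \<gamma> 2 / sv B \<gamma> 1 \<le> c * exp (- \<mu> * real (word_length PGL S \<gamma>))"
proof -
  obtain S' c \<mu> where S': "finite_gen_set PGL \<Gamma> S'" and c: "c > 0" "\<mu> > 0"
    and gap: "\<And>\<gamma>. \<gamma> \<in> \<Gamma> \<Longrightarrow> sv B \<gamma> 2 / sv B \<gamma> 1 \<le> c * exp (- \<mu> * real (word_length PGL S' \<gamma>))"
    using assms(1) by (auto simp: projective_anosov_def)
  have H: "\<Gamma> \<subseteq> carrier PGL" using assms(1) by (simp add: projective_anosov_def subgroup.subset)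
  obtain K where K: "K > 0" "\<And>x. x \<in> \<Gamma> \<Longrightarrow> word_length PGL S x \<le> K * word_length PGL S' x"
    using group.word_length_compare[OF group_PGL S S' H] by metis
  show thesis
  proof (rule that[of c "\<mu> / real K"])
    fix \<gamma> assume \<gamma>: "\<gamma> \<in> \<Gamma>"
    have "real (word_length PGL S \<gamma>) \<le> real K * real (word_length PGL S' \<gamma>)"
      using K(2)[OF \<gamma>] by (metis of_nat_le_iff of_nat_mult)
    then have "real (word_length PGL S \<gamma>) / real K \<le> real (word_length PGL S' \<gamma>)"
      using K(1) by (simp add: pos_divide_le_eq mult.commute)
    then have "\<mu> * (real (word_length PGL S \<gamma>) / real K) \<le> \<mu> * real (word_length PGL S' \<gamma>)"
      using c by (intro mult_left_mono) auto
    then have "exp (- \<mu> * real (word_length PGL S' \<gamma>)) \<le> exp (- (\<mu> / real K) * real (word_length PGL S \<gamma>))"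
      by simp
    then have "c * exp (- \<mu> * real (word_length PGL S' \<gamma>)) \<le> c * exp (- (\<mu> / real K) * real (word_length PGL S \<gamma>))"
      using c by (intro mult_left_mono) auto
    then show "sv B \<gamma> 2 / sv B \<gamma> 1 \<le> c * exp (- (\<mu> / real K) * real (word_length PGL S \<gamma>))"
      using gap[OF \<gamma>] by linarith
  qed (use c K in auto)
qed

lemma expansion_bound_exists:
  fixes A :: "real^'n^'n"
  assumes "invertible A"
  obtains K where "K \<ge> 1" "\<And>x. norm (A *v x) \<le> K * norm x" "\<And>x. norm x \<le> K * norm (A *v x)"
proof -
  obtain A' where A': "A' ** A = mat 1" using assms by (auto simp: invertible_def)
  define K where "K = 1 + opnorm A + opnorm A'"
  have nn: "opnorm A \<ge> 0" "opnorm A' \<ge> 0" by (rule opnorm_nonneg)+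
  show thesis
  proof (rule that[of K])
    show "K \<ge> 1" using nn by (simp add: K_def)
    fix x :: "real^'n"
    have "opnorm A * norm x \<le> K * norm x" using nn by (intro mult_right_mono) (auto simp: K_def)
    then show "norm (A *v x) \<le> K * norm x" using opnorm[of A x] by linarith
    have "x = A' *v (A *v x)" by (simp add: matrix_vector_mul_assoc A')
    then have "norm x \<le> opnorm A' * norm (A *v x)" using opnorm[of A' "A *v x"] by simp
    moreover have "opnorm A' * norm (A *v x) \<le> K * norm (A *v x)"
      using nn by (intro mult_right_mono) (auto simp: K_def)
    ultimately show "norm x \<le> K * norm (A *v x)" by linarith
  qed
qed

lemma uniform_expansion_bound:
  fixes F :: "(real^'n^'n) set"
  assumes "finite F" "\<And>A. A \<in> F \<Longrightarrow> invertible A"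
  shows "\<exists>K\<ge>1. \<forall>A\<in>F. \<forall>x. norm (A *v x) \<le> K * norm x \<and> norm x \<le> K * norm (A *v x)"
  using assms
proof (induction F)
  case empty
  then show ?case by (intro exI[of _ 1]) simp
next
  case (insert A F)
  then obtain K where K: "K \<ge> 1" "\<And>A x. A \<in> F \<Longrightarrow> norm (A *v x) \<le> K * norm x \<and> norm x \<le> K * norm (A *v x)"
    by auto
  obtain L where L: "L \<ge> 1" "\<And>x. norm (A *v x) \<le> L * norm x" "\<And>x. norm x \<le> L * norm (A *v x)"
    using expansion_bound_exists[of A] insert.prems by blast
  have up: "a * norm (y :: real^'n) \<le> max K L * norm y" if "a = K \<or> a = L" for a y
    using that by (intro mult_right_mono) auto
  show ?case
  proof (intro exI[of _ "max K L"] conjI ballI allI)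
    show "max K L \<ge> 1" using K(1) by simp
    fix A' and x :: "real^'n" assume "A' \<in> insert A F"
    then show "norm (A' *v x) \<le> max K L * norm x" "norm x \<le> max K L * norm (A' *v x)"
      using K(2)[of A' x] L(2,3)[of x] up[of K x] up[of L x] up[of K "A' *v x"] up[of L "A' *v x"]
      by (metis insertE order_trans)+
  qed
qed

lemma svd_gapvec:
  fixes A :: "real^'n^'n"
  assumes A: "svd A e f s" and d: "CARD('n) \<ge> 2" and \<epsilon>: "s 2 / s 1 \<le> \<epsilon>"
  shows "gapvec A \<epsilon> (e 1)"
proof -
  note D = svdD[OF A]
  have s1: "s 1 > 0" by (rule D(3)[OF card_ge1])
  have "topvec A (e 1)"
    using s1 D(4)[OF card_ge1] orthonormal_frame_unit[OF D(1) card_ge1] orthonormal_frame_unit[OF D(2) card_ge1]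
    by (simp add: topvec_def opnorm_svd[OF A])
  moreover have "norm (A *v w) \<le> \<epsilon> * opnorm A * norm w" if "w \<bullet> e 1 = 0" for w
  proof -
    have "norm (A *v w) \<le> s 2 * norm w" by (rule svd_bound_orth[OF A d that])
    also have "\<dots> \<le> (\<epsilon> * s 1) * norm w"
      using \<epsilon> s1 by (intro mult_right_mono) (auto simp: pos_divide_le_eq)
    finally show ?thesis by (simp add: opnorm_svd[OF A])
  qed
  ultimately show ?thesis by (simp add: gapvec_def)
qed

section \<open>Limit points lie in shadows\<close>

lemma line_gap_power2:
  assumes "norm x = 1" "norm y = 1"
  shows "(line_gap x y)\<^sup>2 = 2 - 2 * \<bar>x \<bullet> y\<bar>"
proof -
  have xy: "x \<bullet> x = 1" "y \<bullet> y = 1" using assms by (simp_all add: norm_eq_1)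
  have m: "(norm (x - y))\<^sup>2 = 2 - 2 * (x \<bullet> y)"
    by (simp add: power2_norm_eq_inner inner_diff_left inner_diff_right xy inner_commute[of y x])
  have p: "(norm (x + y))\<^sup>2 = 2 + 2 * (x \<bullet> y)"
    by (simp add: power2_norm_eq_inner inner_add_left inner_add_right xy inner_commute[of y x])
  show ?thesis
  proof (cases "x \<bullet> y \<ge> 0")
    case True
    then have "norm (x - y) \<le> norm (x + y)" using m p by (intro power2_le_imp_le[of "norm (x - y)" "norm (x + y)"] norm_ge_zero) linarith
    then have "line_gap x y = norm (x - y)" by (simp only: line_gap_def min.absorb1)
    then show ?thesis using True m by simp
  next
    case False
    then have "norm (x + y) \<le> norm (x - y)" using m p by (intro power2_le_imp_le[of "norm (x + y)" "norm (x - y)"] norm_ge_zero) linarith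
    then have "line_gap x y = norm (x + y)" by (simp only: line_gap_def min.absorb2)
    then show ?thesis using False p by simp
  qed
qed

lemma sine_le_line_gap:
  assumes "norm x = 1" "norm y = 1"
  shows "sqrt (1 - (x \<bullet> y)\<^sup>2) \<le> line_gap x y"
proof (rule real_le_lsqrt[OF line_gap_nonneg])
  have "0 \<le> (1 - \<bar>x \<bullet> y\<bar>)\<^sup>2" by simp
  then show "1 - (x \<bullet> y)\<^sup>2 \<le> (line_gap x y)\<^sup>2"
    unfolding line_gap_power2[OF assms] by (simp add: power2_diff)
qed

lemma line_gap_le_sine:
  assumes "norm x = 1" "norm y = 1"
  shows "line_gap x y \<le> 2 * sqrt (1 - (x \<bullet> y)\<^sup>2)"
proof (rule power2_le_imp_le)
  have c: "\<bar>x \<bullet> y\<bar> \<le> 1" using Cauchy_Schwarz_ineq2[of x y] assms by simp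
  then have 1: "\<bar>x \<bullet> y\<bar>\<^sup>2 \<le> \<bar>x \<bullet> y\<bar>"
    unfolding power2_eq_square by (intro mult_left_le) auto
  then have nn: "1 - (x \<bullet> y)\<^sup>2 \<ge> 0" using c by simp
  show "(line_gap x y)\<^sup>2 \<le> (2 * sqrt (1 - (x \<bullet> y)\<^sup>2))\<^sup>2"
    unfolding line_gap_power2[OF assms] using 1 nn c by (simp add: power_mult_distrib)
  show "0 \<le> 2 * sqrt (1 - (x \<bullet> y)\<^sup>2)" using nn by simp
qed

lemma line_gap_eq_0: "line_gap x y = 0 \<Longrightarrow> x = y \<or> x = - y"
  by (auto simp: line_gap_def min_def eq_neg_iff_add_eq_0 split: if_splits)

lemma span_scaleR_singleton:
  fixes x :: "'a::real_vector"
  assumes "c \<noteq> 0"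
  shows "span {c *\<^sub>R x} = span {x}"
proof (rule antisym)
  show "span {c *\<^sub>R x} \<subseteq> span {x}" by (intro span_minimal) (auto intro: span_scale span_base)
  have "(1 / c) *\<^sub>R (c *\<^sub>R x) \<in> span {c *\<^sub>R x}" by (intro span_scale span_base) simp
  then show "span {x} \<subseteq> span {c *\<^sub>R x}" using assms by (intro span_minimal) auto
qed

lemma topvec_image:
  assumes "topvec A w" and pos: "opnorm A > 0"
  shows "topvec (transpose A) ((1 / opnorm A) *\<^sub>R (A *v w))"
  using assms topvec_eigen[OF assms(1)]
  by (simp add: topvec_def opnorm_transpose matrix_vector_mult_scaleR power2_eq_square)

context euclidean_chart
begin

lemma sp_norm_eq: "sp_norm B v = norm (P *v v)"
  by (simp add: sp_norm_def B_eq norm_eq_sqrt_inner)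

lemma proj_spaceE:
  assumes "L \<in> proj_space"
  obtains u where "norm u = 1" "L = span {R *v u}"
proof -
  from assms have L: "subspace L" "dim L = 1" by (auto simp: proj_space_def)
  then obtain b where b: "b \<subseteq> L" "independent b" "L \<subseteq> span b" "card b = 1"
    using basis_exists[of L] by metis
  then obtain x where x: "b = {x}" using card_1_singletonE by blast
  have Lx: "L = span {x}" using b x L(1) by (metis span_minimal subset_antisym)
  have "x \<noteq> 0" using b(2) x by (metis dependent_zero singletonI)
  then have n: "norm (P *v x) \<noteq> 0" by (metis RPv norm_eq_zero matrix_vector_mult_0_right)
  show thesis
  proof (rule that)
    show "norm ((1 / norm (P *v x)) *\<^sub>R (P *v x)) = 1" using n by simp
    show "L = span {R *v ((1 / norm (P *v x)) *\<^sub>R (P *v x))}"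
      using n by (simp add: Lx matrix_vector_mult_scaleR span_scaleR_singleton)
  qed
qed

lemma line_in_proj_space: "norm u = 1 \<Longrightarrow> span {R *v u} \<in> proj_space"
proof -
  assume u: "norm u = 1"
  have "R *v u \<noteq> 0" using u by (metis PRv matrix_vector_mult_0_right norm_zero zero_neq_one)
  then have "dim (span {R *v u}) = 1" by (simp add: dim_singleton)
  then show ?thesis by (simp add: proj_space_def)
qed

lemma proj_dist_line:
  assumes u: "norm u = 1" and w: "norm w = 1"
  shows "proj_dist B (span {R *v u}) (span {R *v w}) = sqrt (1 - (u \<bullet> w)\<^sup>2)"
proof -
  have some: "\<exists>k. k \<noteq> 0 \<and> (SOME v. v \<in> span {R *v u} \<and> v \<noteq> 0) = k *\<^sub>R (R *v u)" if "norm u = 1" for u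
  proof -
    have "R *v u \<noteq> 0" using that by (metis PRv matrix_vector_mult_0_right norm_zero zero_neq_one)
    then have "\<exists>v. v \<in> span {R *v u} \<and> v \<noteq> 0" using span_base by blast
    from someI_ex[OF this] show ?thesis by (auto simp: span_singleton)
  qed
  obtain k l where k: "k \<noteq> 0" "(SOME v. v \<in> span {R *v u} \<and> v \<noteq> 0) = k *\<^sub>R (R *v u)"
    and l: "l \<noteq> 0" "(SOME v. v \<in> span {R *v w} \<and> v \<noteq> 0) = l *\<^sub>R (R *v w)"
    using some[OF u] some[OF w] by blast
  define t where "t = (k * l * (u \<bullet> w)) / (\<bar>k\<bar> * \<bar>l\<bar>)"
  have "proj_dist B (span {R *v u}) (span {R *v w}) = sin (arccos t)"
    unfolding proj_dist_def k(2) l(2) sp_angle_def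
    by (simp add: sp_norm_eq B_eq matrix_vector_mult_scaleR t_def u w mult.assoc mult.left_commute)
  moreover have t: "\<bar>t\<bar> = \<bar>u \<bullet> w\<bar>" using k l by (simp add: t_def abs_mult)
  moreover have "\<bar>u \<bullet> w\<bar> \<le> 1" using Cauchy_Schwarz_ineq2[of u w] u w by simp
  ultimately show ?thesis by (simp add: sin_arccos_abs) (metis power2_abs)
qed

lemma proj_dist_le_line_gap:
  assumes u: "norm u = 1" and w: "norm w = 1"
  shows "proj_dist B (span {R *v u}) (span {R *v w}) \<le> line_gap u w"
  unfolding proj_dist_line[OF assms] by (rule sine_le_line_gap[OF assms])

text \<open>A longest vector of the ellipsoid is the image of a most stretched vector, hence in the chart it is a
most stretched vector of the transposed matrix.\<close>

lemma U1_topvec: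
  assumes inv: "invertible (unimod_rep \<gamma>)"
  shows "\<exists>u. topvec (transpose (conjugate (unimod_rep \<gamma>))) u \<and> U1 B \<gamma> = span {R *v u}"
proof -
  let ?A = "unimod_rep \<gamma>" let ?N = "opnorm (conjugate ?A)"
  let ?E = "{?A *v v |v. sp_norm B v = 1}"
  obtain e f s where S: "svd (conjugate ?A) e f s" using svd_exists[OF conjugate_invertible[OF inv]] .
  note D = svdD[OF S]
  have N: "?N > 0" by (rule opnorm_pos[OF conjugate_invertible[OF inv]])
  have le: "sp_norm B y \<le> ?N" if "y \<in> ?E" for y
  proof -
    from that obtain v where v: "y = ?A *v v" "norm (P *v v) = 1" by (auto simp: sp_norm_eq)
    then show ?thesis using opnorm[of "conjugate ?A" "P *v v"] by (simp add: sp_norm_eq conjugate_P)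
  qed
  have "sp_norm B (R *v e 1) = 1" using orthonormal_frame_unit[OF D(1) card_ge1] by (simp add: sp_norm_eq)
  then have E1: "?A *v (R *v e 1) \<in> ?E" by blast
  have Ae: "conjugate ?A *v e 1 = P *v (?A *v (R *v e 1))" using conjugate_P[of ?A "R *v e 1"] by simp
  then have n1: "sp_norm B (?A *v (R *v e 1)) = ?N"
    using D(4)[OF card_ge1] D(3)[OF card_ge1] orthonormal_frame_unit[OF D(2) card_ge1]
    by (simp add: sp_norm_eq opnorm_svd[OF S] flip: Ae)
  define x where "x = arg_max_on (sp_norm B) ?E"
  have "is_arg_max (sp_norm B) (\<lambda>y. y \<in> ?E) (?A *v (R *v e 1))"
    using le n1 E1 unfolding is_arg_max_def by force
  then have max: "is_arg_max (sp_norm B) (\<lambda>y. y \<in> ?E) x"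
    unfolding x_def arg_max_on_def arg_max_def by (rule someI)
  have x: "x \<in> ?E" using max unfolding is_arg_max_def by (rule conjunct1)
  have "\<not> sp_norm B (?A *v (R *v e 1)) > sp_norm B x" using max E1 unfolding is_arg_max_def by blast
  then have xN: "sp_norm B x \<ge> ?N" by (simp only: n1 not_less)
  from x obtain v where v: "x = ?A *v v" "norm (P *v v) = 1" by (auto simp: sp_norm_eq)
  have "topvec (conjugate ?A) (P *v v)"
    using xN v le[OF x] by (simp add: topvec_def sp_norm_eq conjugate_P)
  from topvec_image[OF this N] have "topvec (transpose (conjugate ?A)) ((1 / ?N) *\<^sub>R (P *v x))"
    by (simp add: conjugate_P v(1))
  moreover have "U1 B \<gamma> = span {R *v ((1 / ?N) *\<^sub>R (P *v x))}"
    using N by (simp add: U1_def x_def[symmetric] matrix_vector_mult_scaleR span_scaleR_singleton)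
  ultimately show ?thesis by blast
qed

end

locale anosov_chart = euclidean_chart B P R
  for B :: "real^'n \<Rightarrow> real^'n \<Rightarrow> real" and P R :: "real^'n^'n" +
  fixes \<Gamma> S :: "(real^'n^'n) set set" and c \<mu> :: real
  assumes dim2: "CARD('n) \<ge> 2"
    and sub: "subgroup \<Gamma> PGL"
    and gen: "finite_gen_set PGL \<Gamma> S"
    and c: "c > 0" and \<mu>: "\<mu> > 0"
    and gap: "\<gamma> \<in> \<Gamma> \<Longrightarrow> sv B \<gamma> 2 / sv B \<gamma> 1 \<le> c * exp (- \<mu> * real (word_length PGL S \<gamma>))"
begin

sublocale PGL: group "PGL :: (real^'n^'n) set monoid" by (rule group_PGL)

abbreviation wl :: "(real^'n^'n) set \<Rightarrow> nat" where "wl \<equiv> word_length PGL S"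

abbreviation mat_of :: "(real^'n^'n) set \<Rightarrow> real^'n^'n" where
  "mat_of \<gamma> \<equiv> conjugate (unimod_rep \<gamma>)"

lemma \<Gamma>_carrier: "\<gamma> \<in> \<Gamma> \<Longrightarrow> \<gamma> \<in> carrier PGL"
  using sub by (meson subgroup.mem_carrier)

lemma mat_of_invertible: "\<gamma> \<in> \<Gamma> \<Longrightarrow> invertible (mat_of \<gamma>)"
  by (intro conjugate_invertible unimod_rep_invertible \<Gamma>_carrier)

lemma mat_of_mult:
  assumes "\<gamma> \<in> \<Gamma>" "\<delta> \<in> \<Gamma>"
  shows "mat_of (\<gamma> \<otimes>\<^bsub>PGL\<^esub> \<delta>) = mat_of \<gamma> ** mat_of \<delta> \<or> mat_of (\<gamma> \<otimes>\<^bsub>PGL\<^esub> \<delta>) = - (mat_of \<gamma> ** mat_of \<delta>)"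
  using unimod_rep_mult[OF \<Gamma>_carrier[OF assms(1)] \<Gamma>_carrier[OF assms(2)]]
  by (metis conjugate_mult conjugate_minus)

lemma finite_ball: "finite {\<gamma> \<in> \<Gamma>. wl \<gamma> \<le> n}"
proof -
  have "S \<subseteq> carrier PGL" "finite S" "generate PGL S = \<Gamma>"
    using gen \<Gamma>_carrier by (auto simp: finite_gen_set_def)
  then show ?thesis using PGL.finite_word_ball[of S n] by simp
qed

lemma ball_expansion:
  obtains K where "K \<ge> 1" "\<And>\<gamma> x. \<gamma> \<in> \<Gamma> \<Longrightarrow> wl \<gamma> \<le> n \<Longrightarrow> norm (mat_of \<gamma> *v x) \<le> K * norm x"
    "\<And>\<gamma> x. \<gamma> \<in> \<Gamma> \<Longrightarrow> wl \<gamma> \<le> n \<Longrightarrow> norm x \<le> K * norm (mat_of \<gamma> *v x)"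
proof -
  have "\<exists>K\<ge>1. \<forall>A\<in>mat_of ` {\<gamma> \<in> \<Gamma>. wl \<gamma> \<le> n}. \<forall>x. norm (A *v x) \<le> K * norm x \<and> norm x \<le> K * norm (A *v x)"
    by (rule uniform_expansion_bound) (auto simp: finite_ball mat_of_invertible)
  then show thesis using that by auto
qed

lemma mat_of_gap:
  assumes "\<gamma> \<in> \<Gamma>"
  shows "\<exists>v. gapvec (mat_of \<gamma>) (c * exp (- \<mu>) ^ wl \<gamma>) v"
    "\<exists>u. gapvec (transpose (mat_of \<gamma>)) (c * exp (- \<mu>) ^ wl \<gamma>) u"
proof -
  obtain e f s where S: "svd (mat_of \<gamma>) e f s" using svd_exists[OF mat_of_invertible[OF assms]] .
  have "s 2 / s 1 \<le> c * exp (- \<mu> * real (wl \<gamma>))"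
    using gap[OF assms] by (simp add: singular_value_eq[OF S])
  also have "exp (- \<mu> * real (wl \<gamma>)) = exp (- \<mu>) ^ wl \<gamma>" by (simp flip: exp_of_nat2_mult)
  finally have le: "s 2 / s 1 \<le> c * exp (- \<mu>) ^ wl \<gamma>" .
  show "\<exists>v. gapvec (mat_of \<gamma>) (c * exp (- \<mu>) ^ wl \<gamma>) v"
    using svd_gapvec[OF S dim2 le] by blast
  show "\<exists>u. gapvec (transpose (mat_of \<gamma>)) (c * exp (- \<mu>) ^ wl \<gamma>) u"
    using svd_gapvec[OF svd_transpose[OF S] dim2 le] by blast
qed

definition step :: "(nat \<Rightarrow> (real^'n^'n) set) \<Rightarrow> nat \<Rightarrow> nat \<Rightarrow> (real^'n^'n) set" where
  "step \<alpha> i j = inv\<^bsub>PGL\<^esub> (\<alpha> i) \<otimes>\<^bsub>PGL\<^esub> \<alpha> j"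

lemma rayD:
  assumes "\<alpha> \<in> geodesic_rays PGL \<Gamma> S"
  shows "\<alpha> 0 = \<one>\<^bsub>PGL\<^esub>" "\<alpha> i \<in> \<Gamma>" "i \<le> j \<Longrightarrow> wl (step \<alpha> i j) = j - i"
    "step \<alpha> i j \<in> \<Gamma>" "step \<alpha> 0 j = \<alpha> j"
    "step \<alpha> i j \<otimes>\<^bsub>PGL\<^esub> step \<alpha> j k = step \<alpha> i k"
proof -
  show 0: "\<alpha> 0 = \<one>\<^bsub>PGL\<^esub>" and \<Gamma>: "\<alpha> i \<in> \<Gamma>" for i
    using assms by (auto simp: geodesic_rays_def)
  show "i \<le> j \<Longrightarrow> wl (step \<alpha> i j) = j - i"
    using assms by (auto simp: geodesic_rays_def word_dist_def step_def)
  show "step \<alpha> i j \<in> \<Gamma>" for i j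
    using \<Gamma> sub by (simp add: step_def subgroup.m_closed subgroup.m_inv_closed)
  have C: "\<alpha> i \<in> carrier PGL" for i by (rule \<Gamma>_carrier[OF \<Gamma>])
  show "step \<alpha> 0 j = \<alpha> j" using C by (simp add: step_def 0)
  show "step \<alpha> i j \<otimes>\<^bsub>PGL\<^esub> step \<alpha> j k = step \<alpha> i k"
  proof -
    have "\<alpha> j \<otimes>\<^bsub>PGL\<^esub> (inv\<^bsub>PGL\<^esub> (\<alpha> j) \<otimes>\<^bsub>PGL\<^esub> \<alpha> k) = \<alpha> k"
      using C by (simp flip: PGL.m_assoc)
    then show ?thesis using C by (simp add: step_def PGL.m_assoc)
  qed
qed

lemma ray_gap_chain:
  obtains K where "K \<ge> 1"
    "\<And>\<alpha>. \<alpha> \<in> geodesic_rays PGL \<Gamma> S \<Longrightarrow> gap_chain c (exp (- \<mu>)) K (\<lambda>i j. mat_of (step \<alpha> i j))"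
proof -
  obtain K where K: "K \<ge> 1" "\<And>\<gamma> x. \<gamma> \<in> \<Gamma> \<Longrightarrow> wl \<gamma> \<le> 1 \<Longrightarrow> norm (mat_of \<gamma> *v x) \<le> K * norm x"
    "\<And>\<gamma> x. \<gamma> \<in> \<Gamma> \<Longrightarrow> wl \<gamma> \<le> 1 \<Longrightarrow> norm x \<le> K * norm (mat_of \<gamma> *v x)"
    using ball_expansion[of 1] by blast
  show thesis
  proof (rule that[OF K(1)])
    fix \<alpha> assume \<alpha>: "\<alpha> \<in> geodesic_rays PGL \<Gamma> S"
    note r = rayD[OF \<alpha>]
    show "gap_chain c (exp (- \<mu>)) K (\<lambda>i j. mat_of (step \<alpha> i j))"
      unfolding gap_chain_def
    proof (intro conjI allI impI)
      fix i j k
      show "mat_of (step \<alpha> i k) = mat_of (step \<alpha> i j) ** mat_of (step \<alpha> j k) \<or>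
            mat_of (step \<alpha> i k) = - (mat_of (step \<alpha> i j) ** mat_of (step \<alpha> j k))"
        using mat_of_mult[OF r(4) r(4), of i j j k] r(6)[of i j k] by simp
      show "invertible (mat_of (step \<alpha> i j))" by (rule mat_of_invertible[OF r(4)])
    next
      fix i and x :: "real^'n"
      have "wl (step \<alpha> i (Suc i)) \<le> 1" using r(3)[of i "Suc i"] by simp
      then show "norm (mat_of (step \<alpha> i (Suc i)) *v x) \<le> K * norm x"
        "norm x \<le> K * norm (mat_of (step \<alpha> i (Suc i)) *v x)"
        using K(2,3)[OF r(4)] by auto
    next
      fix i j :: nat assume ij: "i \<le> j"
      show "\<exists>v. gapvec (mat_of (step \<alpha> i j)) (c * exp (- \<mu>) ^ (j - i)) v"
        "\<exists>u. gapvec (transpose (mat_of (step \<alpha> i j))) (c * exp (- \<mu>) ^ (j - i)) u"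
        using mat_of_gap[OF r(4)] r(3)[OF ij] by metis+
    qed
  qed
qed

definition major_axis :: "(real^'n^'n) set \<Rightarrow> real^'n" where
  "major_axis \<gamma> = (SOME u. topvec (transpose (mat_of \<gamma>)) u \<and> U1 B \<gamma> = span {R *v u})"

lemma major_axis:
  assumes "\<gamma> \<in> \<Gamma>"
  shows "topvec (transpose (mat_of \<gamma>)) (major_axis \<gamma>)" "U1 B \<gamma> = span {R *v (major_axis \<gamma>)}"
    "norm (major_axis \<gamma>) = 1"
proof -
  have "topvec (transpose (mat_of \<gamma>)) (major_axis \<gamma>) \<and> U1 B \<gamma> = span {R *v (major_axis \<gamma>)}"
    unfolding major_axis_def
    by (rule someI_ex, rule U1_topvec, rule unimod_rep_invertible, rule \<Gamma>_carrier, rule assms)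
  then show "topvec (transpose (mat_of \<gamma>)) (major_axis \<gamma>)" "U1 B \<gamma> = span {R *v (major_axis \<gamma>)}"
    "norm (major_axis \<gamma>) = 1" by (auto simp: topvec_def)
qed

lemma major_axis_right_mult:
  assumes K: "K \<ge> 1" "\<And>x. norm (mat_of \<delta> *v x) \<le> K * norm x" "\<And>x. norm x \<le> K * norm (mat_of \<delta> *v x)"
    and \<gamma>: "\<gamma> \<in> \<Gamma>" and \<delta>: "\<delta> \<in> \<Gamma>"
  shows "line_gap (major_axis \<gamma>) (major_axis (\<gamma> \<otimes>\<^bsub>PGL\<^esub> \<delta>)) \<le> 4 * K\<^sup>2 * (c * exp (- \<mu>) ^ wl \<gamma>)"
proof (rule topvec_close[OF mat_of_gap(2)[OF \<gamma>] _ K(1) _ _ _ major_axis(1)[OF \<gamma>]])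
  have "\<gamma> \<otimes>\<^bsub>PGL\<^esub> \<delta> \<in> \<Gamma>" using \<gamma> \<delta> sub by (simp add: subgroup.m_closed)
  note m = major_axis(1)[OF this]
  show "topvec (transpose (mat_of \<delta>) ** transpose (mat_of \<gamma>)) (major_axis (\<gamma> \<otimes>\<^bsub>PGL\<^esub> \<delta>))"
  proof -
    from mat_of_mult[OF \<gamma> \<delta>]
    have "transpose (mat_of (\<gamma> \<otimes>\<^bsub>PGL\<^esub> \<delta>)) = transpose (mat_of \<delta>) ** transpose (mat_of \<gamma>) \<or>
      transpose (mat_of (\<gamma> \<otimes>\<^bsub>PGL\<^esub> \<delta>)) = - (transpose (mat_of \<delta>) ** transpose (mat_of \<gamma>))"
      by (elim disjE) (simp_all only: matrix_transpose_mul transpose_minus simp_thms)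
    then show ?thesis using m by (elim disjE) (simp_all only: topvec_minus)
  qed
  show "norm (transpose (mat_of \<delta>) *v x) \<le> K * norm x" "norm x \<le> K * norm (transpose (mat_of \<delta>) *v x)" for x
    by (rule transpose_expansion_bounds[OF mat_of_invertible[OF \<delta>] K(2,3)])+
  show "0 < opnorm (transpose (mat_of \<gamma>))"
    using opnorm_pos[OF mat_of_invertible[OF \<gamma>]] by (simp add: opnorm_transpose)
  show "0 \<le> c * exp (- \<mu>) ^ wl \<gamma>" using c by simp
qed

text \<open>Asymptotic rays differ by right multiplication with elements of bounded length, which moves the major
axis by at most a constant times the singular value gap.\<close>

lemma asymptotic_major_axes:
  assumes "(\<alpha>, \<beta>) \<in> asymptotic_rel PGL \<Gamma> S"
  shows "(\<lambda>i. line_gap (major_axis (\<alpha> i)) (major_axis (\<beta> i))) \<longlonglongrightarrow> 0"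
proof -
  from assms obtain n where \<alpha>: "\<alpha> \<in> geodesic_rays PGL \<Gamma> S" and \<beta>: "\<beta> \<in> geodesic_rays PGL \<Gamma> S"
    and n: "\<And>i. wl (inv\<^bsub>PGL\<^esub> (\<alpha> i) \<otimes>\<^bsub>PGL\<^esub> \<beta> i) \<le> n"
    by (auto simp: asymptotic_rel_def word_dist_def)
  obtain K where K: "K \<ge> 1" "\<And>\<gamma> x. \<gamma> \<in> \<Gamma> \<Longrightarrow> wl \<gamma> \<le> n \<Longrightarrow> norm (mat_of \<gamma> *v x) \<le> K * norm x"
    "\<And>\<gamma> x. \<gamma> \<in> \<Gamma> \<Longrightarrow> wl \<gamma> \<le> n \<Longrightarrow> norm x \<le> K * norm (mat_of \<gamma> *v x)"
    using ball_expansion[of n] by blast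
  have le: "line_gap (major_axis (\<alpha> i)) (major_axis (\<beta> i)) \<le> 4 * K\<^sup>2 * (c * exp (- \<mu>) ^ i)" for i
  proof -
    let ?h = "inv\<^bsub>PGL\<^esub> (\<alpha> i) \<otimes>\<^bsub>PGL\<^esub> \<beta> i"
    have ab: "\<alpha> i \<in> \<Gamma>" "\<beta> i \<in> \<Gamma>" using rayD[OF \<alpha>] rayD[OF \<beta>] by auto
    then have h: "?h \<in> \<Gamma>" using sub by (simp add: subgroup.m_closed subgroup.m_inv_closed)
    have "\<alpha> i \<otimes>\<^bsub>PGL\<^esub> ?h = \<beta> i"
      using \<Gamma>_carrier[OF ab(1)] \<Gamma>_carrier[OF ab(2)] by (simp flip: PGL.m_assoc)
    moreover have "wl (\<alpha> i) = i" using rayD(3)[OF \<alpha>, of 0 i] rayD(5)[OF \<alpha>] by simp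
    ultimately show ?thesis
      using major_axis_right_mult[OF K(1) K(2)[OF h n] K(3)[OF h n] ab(1) h] by simp
  qed
  have "(\<lambda>i. exp (- \<mu>) ^ i) \<longlonglongrightarrow> 0" using \<mu> by (intro LIMSEQ_realpow_zero) auto
  then have "(\<lambda>i. 4 * K\<^sup>2 * (c * exp (- \<mu>) ^ i)) \<longlonglongrightarrow> 4 * K\<^sup>2 * (c * 0)" by (intro tendsto_mult_left)
  then have lim: "(\<lambda>i. 4 * K\<^sup>2 * (c * exp (- \<mu>) ^ i)) \<longlonglongrightarrow> 0" by simp
  show ?thesis
    by (rule tendsto_sandwich[OF _ _ tendsto_const lim]) (simp_all add: le line_gap_nonneg)
qed

text \<open>The limit line of the major axes along a ray is also the limit along every asymptotic ray, and limits of
lines are unique, so it is the value of \<open>xi1\<close>. The element \<open>\<gamma>\<close> is the \<open>n\<close>-th point of the ray.\<close>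

lemma limit_set_shadow:
  "\<exists>D>0. \<forall>L\<in>limit_set B \<Gamma> S. \<forall>n. \<exists>\<gamma>\<in>\<Gamma>. wl \<gamma> = n \<and> (\<exists>y. norm y = 1 \<and> L = span {R *v y} \<and>
     (\<forall>e f s. svd (mat_of \<gamma>) e f s \<longrightarrow> (\<forall>k\<in>{1..CARD('n)}. \<bar>y \<bullet> f k\<bar> \<le> D * s k / s 1)))"
proof -
  obtain K where K: "K \<ge> 1"
    "\<And>\<alpha>. \<alpha> \<in> geodesic_rays PGL \<Gamma> S \<Longrightarrow> gap_chain c (exp (- \<mu>)) K (\<lambda>i j. mat_of (step \<alpha> i j))"
    using ray_gap_chain by blast
  have q: "0 < exp (- \<mu>)" "exp (- \<mu>) < 1" "c \<ge> 0" using \<mu> c by auto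
  obtain D where D: "D > 0" "\<And>M :: nat \<Rightarrow> nat \<Rightarrow> real^'n^'n. gap_chain c (exp (- \<mu>)) K M \<Longrightarrow>
     (\<forall>i j k. i \<le> j \<longrightarrow> j \<le> k \<longrightarrow> opnorm (M i j) * opnorm (M j k) \<le> D * opnorm (M i k))"
    using chain_almost_multiplicative[OF q(3,1,2) K(1)] by metis
  show ?thesis
  proof (intro exI[of _ D] conjI D(1) ballI allI)
    fix L n assume "L \<in> limit_set B \<Gamma> S"
    then obtain \<alpha> where \<alpha>: "\<alpha> \<in> geodesic_rays PGL \<Gamma> S"
      and L: "L = xi1 B (asymptotic_rel PGL \<Gamma> S `` {\<alpha>})"
      by (auto simp: limit_set_def gromov_boundary_def quotient_def)
    note r = rayD[OF \<alpha>] and M = K(2)[OF \<alpha>]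
    define u where "u j = major_axis (\<alpha> j)" for j
    have u: "topvec (transpose (mat_of (step \<alpha> 0 j))) (u j)" for j
      using major_axis(1)[OF r(2)] by (simp add: u_def r(5))
    obtain y t where y: "norm y = 1" "(\<lambda>j. line_gap (u j) y) \<longlonglongrightarrow> 0" "strict_mono t" "(u \<circ> t) \<longlonglongrightarrow> y"
      using chain_limit[OF q(3,1,2) K(1) M u] by blast
    have shadow: "\<bar>y \<bullet> f k\<bar> \<le> D * s k / s 1"
      if "svd (mat_of (\<alpha> n)) e f s" "k \<in> {1..CARD('n)}" for e f s k
      using chain_shadow[OF M _ u y(3,4), of D n e f s k] D(2)[OF M] that by (simp add: r(5))
    have U: "proj_dist B (U1 B \<gamma>) (span {R *v z}) = sqrt (1 - (major_axis \<gamma> \<bullet> z)\<^sup>2)"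
      if "\<gamma> \<in> \<Gamma>" "norm z = 1" for \<gamma> z
      using major_axis(2,3)[OF that(1)] that(2) by (simp add: proj_dist_line)
    have "L = span {R *v y}"
      unfolding L xi1_def
    proof (rule the_equality, intro conjI ballI)
      show "span {R *v y} \<in> proj_space" by (rule line_in_proj_space[OF y(1)])
      fix \<beta> assume "\<beta> \<in> asymptotic_rel PGL \<Gamma> S `` {\<alpha>}"
      then have \<beta>: "(\<alpha>, \<beta>) \<in> asymptotic_rel PGL \<Gamma> S" by simp
      then have \<beta>\<Gamma>: "\<beta> i \<in> \<Gamma>" for i using rayD(2)[of \<beta>] by (auto simp: asymptotic_rel_def)
      have "(\<lambda>i. line_gap (u i) (major_axis (\<beta> i)) + line_gap (u i) y) \<longlonglongrightarrow> 0 + 0"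
        unfolding u_def by (intro tendsto_add asymptotic_major_axes[OF \<beta>] y(2)[unfolded u_def])
      then have lim: "(\<lambda>i. line_gap (u i) (major_axis (\<beta> i)) + line_gap (u i) y) \<longlonglongrightarrow> 0" by simp
      have le: "proj_dist B (U1 B (\<beta> i)) (span {R *v y}) \<le> line_gap (u i) (major_axis (\<beta> i)) + line_gap (u i) y" for i
        using sine_le_line_gap[OF major_axis(3)[OF \<beta>\<Gamma>] y(1), of i] line_gap_triangle[of "major_axis (\<beta> i)" y "u i"]
        by (simp add: U[OF \<beta>\<Gamma> y(1)] line_gap_commute[of _ "u i"])
      have ge: "0 \<le> proj_dist B (U1 B (\<beta> i)) (span {R *v y})" for i
        using Cauchy_Schwarz_ineq2[of "major_axis (\<beta> i)" y] major_axis(3)[OF \<beta>\<Gamma>, of i] y(1)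
        by (simp add: U[OF \<beta>\<Gamma> y(1)] abs_square_le_1)
      show "(\<lambda>i. proj_dist B (U1 B (\<beta> i)) (span {R *v y})) \<longlonglongrightarrow> 0"
        by (rule tendsto_sandwich[OF _ _ tendsto_const lim]) (auto simp: le ge)
    next
      fix L' assume L': "L' \<in> proj_space \<and> (\<forall>\<beta>\<in>asymptotic_rel PGL \<Gamma> S `` {\<alpha>}. (\<lambda>i. proj_dist B (U1 B (\<beta> i)) L') \<longlonglongrightarrow> 0)"
      obtain z where z: "norm z = 1" "L' = span {R *v z}" using proj_spaceE L' by metis
      have "(\<alpha>, \<alpha>) \<in> asymptotic_rel PGL \<Gamma> S"
        using \<alpha> r(3)[of i i for i] by (auto simp: asymptotic_rel_def word_dist_def step_def)
      then have "(\<lambda>i. proj_dist B (U1 B (\<alpha> i)) L') \<longlonglongrightarrow> 0" using L' by auto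
      then have "(\<lambda>i. 2 * sqrt (1 - (u i \<bullet> z)\<^sup>2) + line_gap (u i) y) \<longlonglongrightarrow> 2 * 0 + 0"
        unfolding z(2) U[OF r(2) z(1)] u_def[symmetric] by (intro tendsto_intros y(2))
      then have lim: "(\<lambda>i. 2 * sqrt (1 - (u i \<bullet> z)\<^sup>2) + line_gap (u i) y) \<longlonglongrightarrow> 0" by simp
      have "line_gap y z \<le> 2 * sqrt (1 - (u i \<bullet> z)\<^sup>2) + line_gap (u i) y" for i
        using line_gap_le_sine[of "u i" z] z(1) major_axis(3)[OF r(2), of i] line_gap_triangle[of y z "u i"]
        by (simp add: u_def line_gap_commute[of y])
      then have "line_gap y z \<le> 0" using LIMSEQ_le_const[OF lim] by blast
      then have "y = z \<or> y = - z" using line_gap_nonneg[of y z] by (intro line_gap_eq_0) simp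
      then show "L' = span {R *v y}"
      proof
        assume "y = z" then show ?thesis by (simp only: z(2))
      next
        assume "y = - z"
        then have "R *v y = (- 1) *\<^sub>R (R *v z)" by (simp add: matrix_vector_mult_minus)
        then show ?thesis using span_scaleR_singleton[of "- 1" "R *v z"] by (simp only: z(2))
      qed
    qed
    moreover have "wl (\<alpha> n) = n" using r(3)[of 0 n] r(5) by simp
    ultimately show "\<exists>\<gamma>\<in>\<Gamma>. wl \<gamma> = n \<and> (\<exists>y. norm y = 1 \<and> L = span {R *v y} \<and>
     (\<forall>e f s. svd (mat_of \<gamma>) e f s \<longrightarrow> (\<forall>k\<in>{1..CARD('n)}. \<bar>y \<bullet> f k\<bar> \<le> D * s k / s 1)))"
      using r(2) y(1) shadow by blast
  qed
qed

end

section \<open>Hausdorff measure and exponential sums\<close>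

text \<open>Enumerate the cover and continue with empty sets, which have diameter 0 and contribute \<open>0 powr s = 0\<close>.\<close>

lemma hausdorff_premeasure_finite_cover:
  fixes b :: "'j \<Rightarrow> real"
  assumes J: "finite J" and A: "A \<subseteq> (\<Union>j\<in>J. V j)" and s: "s > 0"
    and VX: "\<And>j. j \<in> J \<Longrightarrow> V j \<subseteq> X"
    and diam: "\<And>j x y. j \<in> J \<Longrightarrow> x \<in> V j \<Longrightarrow> y \<in> V j \<Longrightarrow> d x y \<le> b j"
    and b: "\<And>j. j \<in> J \<Longrightarrow> 0 \<le> b j \<and> b j \<le> \<delta>"
  shows "hausdorff_premeasure X d s \<delta> A \<le> ennreal (\<Sum>j\<in>J. b j powr s)"
proof -
  obtain h where h: "bij_betw h {0..<card J} J" using ex_bij_betw_nat_finite[OF J] by blast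
  define U where "U i = (if i < card J then V (h i) else {})" for i
  have hJ: "h i \<in> J" if "i < card J" for i using h that by (auto simp: bij_betw_def)
  have ediam_le: "ediam d (V j) \<le> ennreal (b j)" if "j \<in> J" for j
    unfolding ediam_def using diam[OF that] by (intro SUP_least ennreal_leI) auto
  have ediam_empty: "ediam d {} = 0" by (simp add: ediam_def bot_ennreal)
  have cover: "A \<subseteq> (\<Union>i. U i)"
  proof
    fix x assume "x \<in> A"
    then obtain j where j: "j \<in> J" "x \<in> V j" using A by auto
    have "h ` {0..<card J} = J" using h by (simp add: bij_betw_def)
    then have "j \<in> h ` {0..<card J}" using j by simp
    then obtain i where "i < card J" "h i = j" by auto
    then show "x \<in> (\<Union>i. U i)" using j by (auto simp: U_def intro!: exI[of _ i])
  qed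
  have U_ok: "U i \<subseteq> X \<and> ediam d (U i) \<le> ennreal \<delta>" for i
  proof (cases "i < card J")
    case True
    have "ennreal (b (h i)) \<le> ennreal \<delta>" using b[OF hJ[OF True]] by (intro ennreal_leI) simp
    then show ?thesis using VX[OF hJ[OF True]] order_trans[OF ediam_le[OF hJ[OF True]]] True
      by (simp add: U_def)
  qed (simp add: U_def ediam_empty)
  have "hausdorff_premeasure X d s \<delta> A \<le> (\<Sum>i. ennreal (enn2real (ediam d (U i)) powr s))"
    unfolding hausdorff_premeasure_def using cover U_ok by (intro INF_lower) auto
  also have "\<dots> = (\<Sum>i<card J. ennreal (enn2real (ediam d (U i)) powr s))"
    by (intro suminf_finite) (auto simp: U_def ediam_empty)
  also have "\<dots> \<le> (\<Sum>i<card J. ennreal (b (h i) powr s))"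
  proof (intro sum_mono ennreal_leI)
    fix i assume "i \<in> {..<card J}"
    then have i: "i < card J" by simp
    have "enn2real (ediam d (U i)) \<le> b (h i)"
      using ediam_le[OF hJ[OF i]] b[OF hJ[OF i]] i by (intro enn2real_leI) (auto simp: U_def)
    then show "enn2real (ediam d (U i)) powr s \<le> b (h i) powr s"
      using s by (intro powr_mono2) auto
  qed
  also have "\<dots> = ennreal (\<Sum>i<card J. b (h i) powr s)" by (rule sum_ennreal) simp
  also have "(\<Sum>i<card J. b (h i) powr s) = (\<Sum>j\<in>J. b j powr s)"
    using sum.reindex_bij_betw[OF h, of "\<lambda>j. b j powr s"] by (simp add: lessThan_atLeast0)
  finally show ?thesis .
qed

text \<open>Fix \<open>u\<close> between the upper limit and \<open>t\<close>. For large \<open>m\<close> at most \<open>exp (u (m + 1))\<close> elements satisfy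
\<open>m \<le> J x < m + 1\<close>, and each contributes about \<open>exp (- t m)\<close>. On \<open>G n\<close> only values
\<open>m \<ge> \<mu> n - b - 1\<close> occur, so the sum is bounded by the tail of a geometric series.\<close>

lemma sum_exp_tail:
  fixes J :: "'a \<Rightarrow> real" and G :: "nat \<Rightarrow> 'a set"
  assumes h: "Limsup at_top (\<lambda>T::real. ereal (1 / T) * ln_card {x \<in> X. J x < T}) < ereal t"
    and G: "\<And>n. finite (G n)" "\<And>n. G n \<subseteq> X"
    and grow: "\<And>n x. x \<in> G n \<Longrightarrow> J x \<ge> \<mu> * real n - b" and \<mu>: "\<mu> > 0"
  shows "(\<lambda>n. \<Sum>x\<in>G n. exp (- t * J x)) \<longlonglongrightarrow> 0"
proof -
  obtain u where u: "Limsup at_top (\<lambda>T::real. ereal (1 / T) * ln_card {x \<in> X. J x < T}) < ereal u"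
    "ereal u < ereal t"
    using ereal_dense2[OF h] by blast
  then have ut: "u < t" by simp
  obtain T0 where T0: "\<And>T. T \<ge> T0 \<Longrightarrow> ereal (1 / T) * ln_card {x \<in> X. J x < T} < ereal u"
    using Limsup_lessD[OF u(1)] unfolding eventually_at_top_linorder by blast
  have count: "finite {x \<in> X. J x < T} \<and> real (card {x \<in> X. J x < T}) \<le> exp (u * T)"
    if T: "T \<ge> T0" "T > 0" for T
  proof -
    let ?Z = "{x \<in> X. J x < T}"
    have fin: "finite ?Z"
    proof (rule ccontr)
      assume "infinite ?Z"
      then have "ereal (1 / T) * \<infinity> < ereal u" using T0[OF T(1)] by (simp add: ln_card_def)
      then show False using T(2) by simp
    qed
    then have "ln (real (card ?Z)) / T < u" using T0[OF T(1)] by (simp add: ln_card_def)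
    then have l: "ln (real (card ?Z)) < u * T" using T(2) by (simp add: pos_divide_less_eq)
    have "real (card ?Z) \<le> exp (u * T)"
    proof (cases "card ?Z = 0")
      case False
      then have "real (card ?Z) = exp (ln (real (card ?Z)))" by (intro exp_ln[symmetric]) linarith
      also have "\<dots> \<le> exp (u * T)" using l by simp
      finally show ?thesis .
    qed simp
    with fin show ?thesis by simp
  qed
  define \<rho> where "\<rho> = exp (u - t)"
  have \<rho>: "0 < \<rho>" "\<rho> < 1" using ut by (auto simp: \<rho>_def)
  define m where "m n = nat \<lfloor>\<mu> * real n - b\<rfloor>" for n
  define E where "E = exp (\<bar>u\<bar> + \<bar>t\<bar>)"
  have bound: "(\<Sum>x\<in>G n. exp (- t * J x)) \<le> E * \<rho> ^ m n / (1 - \<rho>)"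
    if n: "\<mu> * real n - b \<ge> max T0 0" for n
  proof -
    define g where "g x = nat \<lfloor>J x\<rfloor>" for x
    define N where "N = Max (insert (m n) (g ` G n))"
    have J0: "J x \<ge> 0" if "x \<in> G n" for x using grow[OF that] n by simp
    have gm: "m n \<le> g x" if "x \<in> G n" for x
      unfolding m_def g_def using grow[OF that] by (intro nat_mono floor_mono)
    have gJ: "real (g x) \<le> J x" "J x < real (g x) + 1" if "x \<in> G n" for x
      using J0[OF that] by (auto simp: g_def)
    have "g ` G n \<subseteq> {m n..N}" using gm G(1)[of n] by (auto simp: N_def)
    then have "(\<Sum>x\<in>G n. exp (- t * J x)) = (\<Sum>y=m n..N. \<Sum>x\<in>{x\<in>G n. g x = y}. exp (- t * J x))"
      using G(1) by (intro sum.group[symmetric]) auto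
    also have "\<dots> \<le> (\<Sum>y=m n..N. E * \<rho> ^ y)"
    proof (intro sum_mono)
      fix y assume y: "y \<in> {m n..N}"
      have T: "real y + 1 \<ge> T0" "real y + 1 > 0"
      proof -
        have "real_of_int \<lfloor>\<mu> * real n - b\<rfloor> \<le> real (m n)" by (simp add: m_def)
        moreover have "\<mu> * real n - b < real_of_int \<lfloor>\<mu> * real n - b\<rfloor> + 1" by linarith
        moreover have "real (m n) \<le> real y" using y by simp
        ultimately show "real y + 1 \<ge> T0" using n by linarith
      qed simp
      have "(\<Sum>x\<in>{x\<in>G n. g x = y}. exp (- t * J x)) \<le> (\<Sum>x\<in>{x\<in>G n. g x = y}. exp \<bar>t\<bar> * exp (- t * real y))"
      proof (intro sum_mono)
        fix x assume "x \<in> {x\<in>G n. g x = y}"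
        then have "real y \<le> J x" "J x \<le> real y + 1" using gJ[of x] by auto
        then have "\<bar>t\<bar> * \<bar>real y - J x\<bar> \<le> \<bar>t\<bar> * 1" by (intro mult_left_mono) auto
        then have "t * (real y - J x) \<le> \<bar>t\<bar>"
          using abs_ge_self[of "t * (real y - J x)"] by (simp add: abs_mult)
        then show "exp (- t * J x) \<le> exp \<bar>t\<bar> * exp (- t * real y)"
          by (simp add: exp_add[symmetric] algebra_simps)
      qed
      also have "\<dots> = real (card {x\<in>G n. g x = y}) * (exp \<bar>t\<bar> * exp (- t * real y))" by simp
      also have "\<dots> \<le> exp (u * (real y + 1)) * (exp \<bar>t\<bar> * exp (- t * real y))"
      proof (intro mult_right_mono)
        have "card {x\<in>G n. g x = y} \<le> card {x \<in> X. J x < real y + 1}"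
          using count[OF T] gJ G(2)[of n] by (intro card_mono) auto
        then show "real (card {x\<in>G n. g x = y}) \<le> exp (u * (real y + 1))"
          using count[OF T] by linarith
      qed simp
      also have "\<dots> = exp (u + \<bar>t\<bar>) * \<rho> ^ y"
        by (simp add: \<rho>_def exp_of_nat_mult[symmetric] exp_add[symmetric] algebra_simps)
      also have "\<dots> \<le> E * \<rho> ^ y" unfolding E_def using \<rho> by (intro mult_right_mono) auto
      finally show "(\<Sum>x\<in>{x\<in>G n. g x = y}. exp (- t * J x)) \<le> E * \<rho> ^ y" .
    qed
    also have "\<dots> = E * (\<Sum>y=m n..N. \<rho> ^ y)" by (simp add: sum_distrib_left)
    also have "\<dots> \<le> E * (\<rho> ^ m n / (1 - \<rho>))"
      using \<rho> by (intro mult_left_mono) (auto simp: sum_gp E_def divide_right_mono)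
    finally show ?thesis by simp
  qed
  have "filterlim (\<lambda>n. - b + \<mu> * real n) at_top sequentially"
    by (intro filterlim_tendsto_add_at_top[OF tendsto_const]
        filterlim_tendsto_pos_mult_at_top[OF tendsto_const \<mu>] filterlim_real_sequentially)
  then have top: "\<forall>\<^sub>F n in sequentially. Z \<le> \<mu> * real n - b" for Z
    by (simp add: filterlim_at_top)
  have big: "\<forall>\<^sub>F n in sequentially. \<mu> * real n - b \<ge> max T0 0" by (rule top)
  have mtop: "filterlim m at_top sequentially"
    unfolding filterlim_at_top
  proof
    fix Z
    show "\<forall>\<^sub>F n in sequentially. Z \<le> m n"
      using top[of "real Z"] by eventually_elim (simp add: m_def le_nat_floor)
  qed
  have "(\<lambda>n. \<rho> ^ m n) \<longlonglongrightarrow> 0"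
    using \<rho> by (intro filterlim_compose[OF LIMSEQ_realpow_zero mtop]) auto
  then have "(\<lambda>n. E * \<rho> ^ m n / (1 - \<rho>)) \<longlonglongrightarrow> E * 0 / (1 - \<rho>)" using \<rho> by (intro tendsto_intros) auto
  then have lim: "(\<lambda>n. E * \<rho> ^ m n / (1 - \<rho>)) \<longlonglongrightarrow> 0" by simp
  show ?thesis
  proof (rule tendsto_sandwich[OF _ _ tendsto_const lim])
    show "\<forall>\<^sub>F n in sequentially. 0 \<le> (\<Sum>x\<in>G n. exp (- t * J x))" by (simp add: sum_nonneg)
    show "\<forall>\<^sub>F n in sequentially. (\<Sum>x\<in>G n. exp (- t * J x)) \<le> E * \<rho> ^ m n / (1 - \<rho>)"
      using big by eventually_elim (rule bound)
  qed
qed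

text \<open>Here \<open>x powr (p t - p)\<close> is \<open>(x\<^sup>p) powr (t - 1)\<close>, with nonnegative exponent \<open>t - 1\<close>.\<close>

lemma powr_exponent_high:
  fixes P x t :: real
  assumes "0 < P" "0 < x" "x ^ p \<le> P" "t \<ge> 1"
  shows "P / x ^ p * x powr (real p * t) \<le> P powr t"
proof -
  have "x powr (real p * t) = (x ^ p) powr t"
    using assms by (simp add: powr_powr[symmetric] powr_realpow)
  also have "\<dots> = x ^ p * (x ^ p) powr (t - 1)"
    using assms by (simp add: powr_diff)
  also have "\<dots> \<le> x ^ p * P powr (t - 1)"
    using assms by (intro mult_left_mono powr_mono2) auto
  finally have "P / x ^ p * x powr (real p * t) \<le> P / x ^ p * (x ^ p * P powr (t - 1))"
    using assms by (intro mult_left_mono) auto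
  also have "\<dots> = P powr t" using assms by (simp add: powr_diff)
  finally show ?thesis .
qed

text \<open>Here the exponent \<open>t - 1\<close> of \<open>x\<close> is not positive, so \<open>x\<close> may be replaced by the smaller \<open>P\<close>.\<close>

lemma powr_exponent_low:
  fixes P x t :: real
  assumes "0 < P" "P \<le> x" "t \<le> 1"
  shows "P / x ^ p * x powr (real p - 1 + t) \<le> P powr t"
proof -
  have x: "x > 0" using assms by simp
  have "x powr (real p - 1 + t) = x ^ p * x powr (t - 1)"
  proof -
    have "real p - 1 + t = real p + (t - 1)" by simp
    then show ?thesis using x by (simp only: powr_add powr_realpow)
  qed
  also have "\<dots> \<le> x ^ p * P powr (t - 1)"
    using assms x by (intro mult_left_mono powr_mono2') auto
  finally have "P / x ^ p * x powr (real p - 1 + t) \<le> P / x ^ p * (x ^ p * P powr (t - 1))"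
    using assms x by (intro mult_left_mono) auto
  also have "\<dots> = P powr t" using assms x by (simp add: powr_diff)
  finally show ?thesis .
qed

section \<open>Covering the limit set\<close>

context euclidean_chart
begin

definition shadow :: "(nat \<Rightarrow> real^'n) \<Rightarrow> (nat \<Rightarrow> real) \<Rightarrow> real \<Rightarrow> (real^'n) set set" where
  "shadow f s D = {span {R *v y} |y. norm y = 1 \<and> (\<forall>k\<in>{1..CARD('n)}. \<bar>y \<bullet> f k\<bar> \<le> D * s k / s 1)}"

text \<open>The lines whose coordinates \<open>2, \<dots>, d\<close> lie in a cube of side \<open>r\<close>. The condition on the first coordinate
selects the sign of \<open>y\<close> and makes the first coordinate a Lipschitz function of the others.\<close>

definition cell :: "(nat \<Rightarrow> real^'n) \<Rightarrow> real \<Rightarrow> (nat \<Rightarrow> int) \<Rightarrow> (real^'n) set set" where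
  "cell f r z = {span {R *v y} |y. norm y = 1 \<and> y \<bullet> f 1 \<ge> 1/2 \<and>
     (\<forall>k\<in>{2..CARD('n)}. \<lfloor>(y \<bullet> f k) / r\<rfloor> = z k)}"

text \<open>The first coordinates satisfy \<open>(a - a') (a + a') = a\<^sup>2 - a'\<^sup>2\<close> with \<open>a + a' \<ge> 1\<close>, and the difference of the
squares is determined by the other coordinates, as \<open>y\<close> and \<open>y'\<close> are unit vectors.\<close>

lemma cell_diameter:
  assumes f: "orthonormal_frame f" and r: "r > 0" and L: "L \<in> cell f r z" "L' \<in> cell f r z"
  shows "proj_dist B L L' \<le> 3 * real CARD('n) * r"
proof -
  let ?d = "real CARD('n)" and ?I = "{2..CARD('n)}"
  obtain y where y: "L = span {R *v y}" "norm y = 1" "y \<bullet> f 1 \<ge> 1/2" "\<And>k. k \<in> ?I \<Longrightarrow> \<lfloor>(y \<bullet> f k) / r\<rfloor> = z k"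
    using L(1) by (auto simp: cell_def)
  obtain y' where y': "L' = span {R *v y'}" "norm y' = 1" "y' \<bullet> f 1 \<ge> 1/2" "\<And>k. k \<in> ?I \<Longrightarrow> \<lfloor>(y' \<bullet> f k) / r\<rfloor> = z k"
    using L(2) by (auto simp: cell_def)
  have split: "{1..CARD('n)} = insert 1 ?I" using card_ge1[where 'n = 'n] by auto
  have coord: "\<bar>y \<bullet> f k - y' \<bullet> f k\<bar> \<le> r" if "k \<in> ?I" for k
  proof -
    have "\<bar>(y \<bullet> f k) / r - (y' \<bullet> f k) / r\<bar> \<le> 1" using y(4)[OF that] y'(4)[OF that] by linarith
    then have "\<bar>y \<bullet> f k - y' \<bullet> f k\<bar> / r \<le> 1" using r by (simp add: diff_divide_distrib[symmetric])
    then show ?thesis using r by (simp add: pos_divide_le_eq)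
  qed
  have small: "\<bar>x \<bullet> f k\<bar> \<le> 1" if "norm x = 1" "k \<in> ?I" for x k
    using Cauchy_Schwarz_ineq2[of x "f k"] orthonormal_frame_unit[OF f, of k] that by auto
  have sumr: "(\<Sum>k\<in>?I. \<bar>y \<bullet> f k - y' \<bullet> f k\<bar>) \<le> ?d * r"
  proof -
    have "(\<Sum>k\<in>?I. \<bar>y \<bullet> f k - y' \<bullet> f k\<bar>) \<le> (\<Sum>k\<in>?I. r)" by (intro sum_mono coord)
    also have "\<dots> = real (card ?I) * r" by simp
    also have "\<dots> \<le> ?d * r" using r by (intro mult_right_mono) auto
    finally show ?thesis .
  qed
  have first: "\<bar>y \<bullet> f 1 - y' \<bullet> f 1\<bar> \<le> 2 * (?d * r)"
  proof -
    let ?a = "y \<bullet> f 1" and ?a' = "y' \<bullet> f 1"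
    have n: "(norm x)\<^sup>2 = (x \<bullet> f 1)\<^sup>2 + (\<Sum>k\<in>?I. (x \<bullet> f k)\<^sup>2)" for x
      unfolding orthonormal_frame_norm[OF f] split by simp
    have "?a\<^sup>2 - ?a'\<^sup>2 = (\<Sum>k\<in>?I. (y' \<bullet> f k)\<^sup>2) - (\<Sum>k\<in>?I. (y \<bullet> f k)\<^sup>2)"
      using n[of y] n[of y'] y(2) y'(2) by simp
    also have "\<dots> = (\<Sum>k\<in>?I. (y' \<bullet> f k + y \<bullet> f k) * (y' \<bullet> f k - y \<bullet> f k))"
      by (simp add: sum_subtractf[symmetric] power2_eq_square algebra_simps)
    finally have "\<bar>?a\<^sup>2 - ?a'\<^sup>2\<bar> \<le> (\<Sum>k\<in>?I. \<bar>(y' \<bullet> f k + y \<bullet> f k) * (y' \<bullet> f k - y \<bullet> f k)\<bar>)"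
      by (simp only: sum_abs)
    also have "\<dots> \<le> (\<Sum>k\<in>?I. 2 * \<bar>y \<bullet> f k - y' \<bullet> f k\<bar>)"
    proof (intro sum_mono)
      fix k assume k: "k \<in> ?I"
      have "\<bar>y' \<bullet> f k + y \<bullet> f k\<bar> \<le> 2" using small[OF y(2) k] small[OF y'(2) k] by linarith
      then have "\<bar>y' \<bullet> f k + y \<bullet> f k\<bar> * \<bar>y' \<bullet> f k - y \<bullet> f k\<bar> \<le> 2 * \<bar>y' \<bullet> f k - y \<bullet> f k\<bar>"
        by (intro mult_right_mono) auto
      then show "\<bar>(y' \<bullet> f k + y \<bullet> f k) * (y' \<bullet> f k - y \<bullet> f k)\<bar> \<le> 2 * \<bar>y \<bullet> f k - y' \<bullet> f k\<bar>"
        by (simp add: abs_mult abs_minus_commute)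
    qed
    also have "\<dots> \<le> 2 * (?d * r)" using sumr by (simp add: sum_distrib_left[symmetric])
    finally have 1: "\<bar>?a\<^sup>2 - ?a'\<^sup>2\<bar> \<le> 2 * (?d * r)" .
    have "\<bar>?a - ?a'\<bar> * 1 \<le> \<bar>?a - ?a'\<bar> * (?a + ?a')" using y(3) y'(3) by (intro mult_left_mono) auto
    also have "\<dots> = \<bar>(?a - ?a') * (?a + ?a')\<bar>" using y(3) y'(3) by (simp add: abs_mult)
    also have "(?a - ?a') * (?a + ?a') = ?a\<^sup>2 - ?a'\<^sup>2" by (simp add: power2_eq_square algebra_simps)
    finally show ?thesis using 1 by simp
  qed
  have "norm (y - y') = norm (\<Sum>k=1..CARD('n). ((y - y') \<bullet> f k) *\<^sub>R f k)"
    by (simp only: orthonormal_frame_expand[OF f])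
  also have "\<dots> \<le> (\<Sum>k=1..CARD('n). norm (((y - y') \<bullet> f k) *\<^sub>R f k))" by (rule norm_sum)
  also have "\<dots> = (\<Sum>k=1..CARD('n). \<bar>y \<bullet> f k - y' \<bullet> f k\<bar>)"
    using orthonormal_frame_unit[OF f] by (intro sum.cong) (auto simp: inner_diff_left)
  also have "\<dots> = \<bar>y \<bullet> f 1 - y' \<bullet> f 1\<bar> + (\<Sum>k\<in>?I. \<bar>y \<bullet> f k - y' \<bullet> f k\<bar>)"
    unfolding split by simp
  also have "\<dots> \<le> 3 * ?d * r" using first sumr by simp
  finally have "norm (y - y') \<le> 3 * ?d * r" .
  moreover have "proj_dist B L L' \<le> norm (y - y')"
    using proj_dist_le_line_gap[OF y(2) y'(2)] by (simp add: y(1) y'(1) line_gap_def)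
  ultimately show ?thesis by linarith
qed

text \<open>Coordinate \<open>k\<close> needs about \<open>2 D s k / s (p + 1)\<close> cubes for \<open>k \<le> p\<close> and a bounded number for larger \<open>k\<close>.
The smallness assumption leaves at least \<open>1/4\<close> of the squared length of a unit vector to its first
coordinate.\<close>

lemma shadow_covered:
  assumes A: "svd A e f s" and D: "D > 0" and p: "p \<in> {1..CARD('n) - 1}"
    and small: "real CARD('n) * (D * (s 2 / s 1))\<^sup>2 \<le> 3 / 4"
  obtains Z where "finite Z" "shadow f s D \<subseteq> (\<Union>z\<in>Z. cell f (s (p + 1) / s 1) z)"
    "real (card Z) \<le> (2 * D + 3) ^ (CARD('n) - 1) * (\<Prod>k=2..p. s k / s (p + 1))"
proof -
  note S = svdD[OF A]
  have p_le: "p + 1 \<le> CARD('n)" using p card_ge1[where 'n = 'n] by auto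
  let ?I = "{2..CARD('n)}" and ?r = "s (p + 1) / s 1"
  have pos: "s k > 0" if "k \<in> {1..CARD('n)}" for k using S(3)[OF that] .
  have sp: "s (p + 1) > 0" and s1: "s 1 > 0" using pos[of "p + 1"] pos[OF card_ge1] p by auto
  have split: "{1..CARD('n)} = insert 1 ?I" using card_ge1[where 'n = 'n] by auto
  \<comment> \<open>The summand 1 makes room for negative coordinates, which are rounded away from 0.\<close>
  define m where "m k = \<lfloor>D * s k / s (p + 1)\<rfloor> + 1" for k
  define Z where "Z = PiE ?I (\<lambda>k. {- m k..m k})"
  have fin: "finite Z" unfolding Z_def by (intro finite_PiE) auto
  have sub: "shadow f s D \<subseteq> (\<Union>z\<in>Z. cell f ?r z)"
  proof
    fix L assume "L \<in> shadow f s D"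
    then obtain y0 where y0: "L = span {R *v y0}" "norm y0 = 1" "\<And>k. k \<in> {1..CARD('n)} \<Longrightarrow> \<bar>y0 \<bullet> f k\<bar> \<le> D * s k / s 1"
      by (auto simp: shadow_def)
    define y where "y = (if y0 \<bullet> f 1 \<ge> 0 then y0 else - y0)"
    have "span {R *v (- y0)} = span {R *v y0}"
      using span_scaleR_singleton[of "- 1" "R *v y0"] by (simp add: matrix_vector_mult_minus)
    then have y: "L = span {R *v y}" "norm y = 1" "\<And>k. k \<in> {1..CARD('n)} \<Longrightarrow> \<bar>y \<bullet> f k\<bar> \<le> D * s k / s 1"
      "y \<bullet> f 1 \<ge> 0"
      using y0 by (auto simp: y_def)
    have "(\<Sum>k\<in>?I. (y \<bullet> f k)\<^sup>2) \<le> (\<Sum>k\<in>?I. (D * (s 2 / s 1))\<^sup>2)"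
    proof (intro sum_mono)
      fix k assume k: "k \<in> ?I"
      have "\<bar>y \<bullet> f k\<bar> \<le> D * s k / s 1" using y(3) k by simp
      also have "\<dots> \<le> D * (s 2 / s 1)"
        using S(6)[of 2 k] k D s1 by (simp add: divide_right_mono)
      finally have "\<bar>y \<bullet> f k\<bar>\<^sup>2 \<le> (D * (s 2 / s 1))\<^sup>2" by (intro power_mono) auto
      then show "(y \<bullet> f k)\<^sup>2 \<le> (D * (s 2 / s 1))\<^sup>2" by simp
    qed
    also have "\<dots> = real (card ?I) * (D * (s 2 / s 1))\<^sup>2" by simp
    also have "\<dots> \<le> real CARD('n) * (D * (s 2 / s 1))\<^sup>2" by (intro mult_right_mono) auto
    also have "\<dots> \<le> 3 / 4" by (rule small)
    finally have "(\<Sum>k\<in>?I. (y \<bullet> f k)\<^sup>2) \<le> 3 / 4" .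
    moreover have "(norm y)\<^sup>2 = (y \<bullet> f 1)\<^sup>2 + (\<Sum>k\<in>?I. (y \<bullet> f k)\<^sup>2)"
      unfolding orthonormal_frame_norm[OF S(2)] split by simp
    ultimately have "(1/2)\<^sup>2 \<le> (y \<bullet> f 1)\<^sup>2" using y(2) by (simp add: power2_eq_square)
    then have half: "1/2 \<le> y \<bullet> f 1" using y(4) by (rule power2_le_imp_le)
    define z where "z = restrict (\<lambda>k. \<lfloor>(y \<bullet> f k) / ?r\<rfloor>) ?I"
    have "z \<in> Z"
      unfolding Z_def
    proof (rule PiE_I)
      fix k assume k: "k \<in> ?I"
      have "\<bar>y \<bullet> f k\<bar> / ?r \<le> (D * s k / s 1) / ?r"
        using y(3)[of k] k s1 sp by (intro divide_right_mono) auto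
      then have "\<bar>(y \<bullet> f k) / ?r\<bar> \<le> D * s k / s (p + 1)" using s1 sp by (simp add: abs_divide abs_mult)
      then have "\<lfloor>(y \<bullet> f k) / ?r\<rfloor> \<in> {- m k..m k}" unfolding m_def atLeastAtMost_iff by linarith
      then show "z k \<in> {- m k..m k}" using k by (simp add: z_def)
    next
      fix k assume "k \<notin> ?I"
      then show "z k = undefined" unfolding z_def by (rule restrict_apply[THEN trans, OF if_not_P])
    qed
    moreover have "L \<in> cell f ?r z" using y(1,2) half by (auto simp: cell_def z_def)
    ultimately show "L \<in> (\<Union>z\<in>Z. cell f ?r z)" by blast
  qed
  define g where "g k = (if k \<le> p then s k / s (p + 1) else 1)" for k
  have "real (card Z) = (\<Prod>k\<in>?I. real (card {- m k..m k}))"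
    unfolding Z_def by (simp add: card_PiE)
  also have "\<dots> \<le> (\<Prod>k\<in>?I. (2 * D + 3) * g k)"
  proof (intro prod_mono conjI)
    fix k assume k: "k \<in> ?I"
    then have sk: "s k > 0" using pos by simp
    have m0: "m k \<ge> 0" using D sk sp by (simp add: m_def add_nonneg_nonneg)
    then have "real (card {- m k..m k}) = 2 * real_of_int (m k) + 1" by simp
    also have "\<dots> \<le> 2 * (D * s k / s (p + 1)) + 3"
    proof -
      have "2 * real_of_int (\<lfloor>X\<rfloor> + 1) + 1 \<le> 2 * X + 3" for X :: real
        using of_int_floor_le[of X] by simp
      then show ?thesis unfolding m_def .
    qed
    also have "\<dots> \<le> (2 * D + 3) * g k"
    proof (cases "k \<le> p")
      case True
      then have "1 \<le> s k / s (p + 1)" using S(6)[of k "p + 1"] k p_le sp by simp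
      moreover have "(2 * D + 3) * g k = 2 * (D * s k / s (p + 1)) + 3 * (s k / s (p + 1))"
        using True by (simp add: g_def distrib_right add_divide_distrib)
      ultimately show ?thesis by simp
    next
      case False
      then have "s k / s (p + 1) \<le> 1" using S(6)[of "p + 1" k] k p_le sp by simp
      then have "D * (s k / s (p + 1)) \<le> D * 1" using D by (intro mult_left_mono) auto
      then show ?thesis using False by (simp add: g_def)
    qed
    finally show "real (card {- m k..m k}) \<le> (2 * D + 3) * g k" .
  qed simp
  also have "\<dots> = (2 * D + 3) ^ (CARD('n) - 1) * (\<Prod>k\<in>?I. g k)"
    by (simp add: prod.distrib)
  also have "(\<Prod>k\<in>?I. g k) = (\<Prod>k=2..p. g k)"
    using p by (intro prod.mono_neutral_right) (auto simp: g_def)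
  also have "\<dots> = (\<Prod>k=2..p. s k / s (p + 1))" by (intro prod.cong) (auto simp: g_def)
  finally show thesis using that[OF fin sub] by blast
qed

lemma cell_subset: "cell f r z \<subseteq> proj_space"
  by (auto simp: cell_def line_in_proj_space)

end

text \<open>The Jacobian is the sum of \<open>ln (s 1) - ln (s k)\<close>; its term for \<open>k = 1\<close> is 0.\<close>

lemma exp_unstable_jacobian:
  assumes s: "\<And>k. k \<in> {1..p + 1} \<Longrightarrow> s k > 0"
  shows "exp (- unstable_jacobian p (\<lambda>k. ln (s k))) = (\<Prod>k=2..p + 1. s k / s 1)"
proof -
  have split: "{1..p + 1} = insert 1 {2..p + 1}" by auto
  have "unstable_jacobian p (\<lambda>k. ln (s k)) = (\<Sum>k=1..p + 1. ln (s 1) - ln (s k))"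
    by (simp add: unstable_jacobian_def omega_def sum_subtractf)
  also have "\<dots> = (\<Sum>k=2..p + 1. ln (s 1) - ln (s k))" unfolding split by simp
  finally have "- unstable_jacobian p (\<lambda>k. ln (s k)) = (\<Sum>k=2..p + 1. ln (s k) - ln (s 1))"
    by (simp add: sum_negf[symmetric])
  then show ?thesis
    using s s[of 1] by (simp only: exp_sum finite_atLeastAtMost) (intro prod.cong, auto simp: exp_diff)
qed

context anosov_chart
begin

abbreviation jac :: "nat \<Rightarrow> (real^'n^'n) set \<Rightarrow> real" where
  "jac p \<gamma> \<equiv> unstable_jacobian p (cartan B \<gamma>)"

text \<open>All ratios \<open>s k / s 1\<close> with \<open>2 \<le> k \<le> p + 1\<close> lie between \<open>x\<close> and \<open>1\<close>, and \<open>x\<close> is the last of these \<open>p\<close>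
ratios.\<close>

lemma jacobian_svd:
  assumes S: "svd (mat_of \<gamma>) e f s" and p: "p \<in> {1..CARD('n) - 1}"
  defines "x \<equiv> s (p + 1) / s 1" and "Q \<equiv> exp (- jac p \<gamma>)"
  shows "Q / x ^ p = (\<Prod>k=2..p. s k / s (p + 1))" "0 < x" "x ^ p \<le> Q" "Q \<le> x" "x \<le> s 2 / s 1"
proof -
  note D = svdD[OF S]
  have cart: "cartan B \<gamma> = (\<lambda>k. ln (s k))" by (simp add: cartan_def fun_eq_iff singular_value_eq[OF S])
  have pos: "s k > 0" if "k \<in> {1..p + 1}" for k using D(3)[of k] that p by auto
  have s1: "s 1 > 0" and sp: "s (p + 1) > 0" using pos[of 1] pos[of "p + 1"] by auto
  show x0: "0 < x" using s1 sp by (simp add: x_def)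
  have split: "{2..p + 1} = insert (p + 1) {2..p}" using p by auto
  have Q: "Q = (\<Prod>k=2..p + 1. s k / s 1)"
    unfolding Q_def cart by (rule exp_unstable_jacobian[OF pos])
  then have Px: "Q = x * (\<Prod>k=2..p. s k / s 1)" unfolding split by (simp add: x_def)
  have xp: "x ^ p = x * (\<Prod>k=2..p. x)" using p by (cases p) auto
  show "Q / x ^ p = (\<Prod>k=2..p. s k / s (p + 1))"
  proof -
    have "Q / x ^ p = (\<Prod>k=2..p. s k / s 1) / (\<Prod>k=2..p. x)" using x0 by (simp add: Px xp)
    also have "\<dots> = (\<Prod>k=2..p. (s k / s 1) / x)" by (rule prod_dividef[symmetric])
    also have "\<dots> = (\<Prod>k=2..p. s k / s (p + 1))" using s1 sp by (simp add: x_def)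
    finally show ?thesis .
  qed
  have mono: "s j \<le> s i" if "1 \<le> i" "i \<le> j" "j \<le> p + 1" for i j using D(6)[of i j] that p by auto
  have "(\<Prod>k=2..p. x) \<le> (\<Prod>k=2..p. s k / s 1)"
    using x0 s1 mono by (intro prod_mono) (auto simp: x_def intro!: divide_right_mono)
  then show "x ^ p \<le> Q" unfolding xp Px using x0 by (intro mult_left_mono) auto
  have "(\<Prod>k=2..p. s k / s 1) \<le> 1"
    using s1 mono[of 1] pos by (intro prod_le_1) (auto simp: less_imp_le)
  then show "Q \<le> x" unfolding Px using x0 by (simp add: mult_left_le)
  show "x \<le> s 2 / s 1" unfolding x_def using s1 mono[of 2 "p + 1"] p by (intro divide_right_mono) auto
qed

lemma sv_ratio_le:
  assumes "\<gamma> \<in> \<Gamma>" "svd (mat_of \<gamma>) e f s"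
  shows "s 2 / s 1 \<le> c * exp (- \<mu> * real (wl \<gamma>))"
  using gap[OF assms(1)] by (simp add: singular_value_eq[OF assms(2)])

text \<open>The cells of the shadows of all elements of word length \<open>n\<close> cover the limit set. Their diameters tend to 0
with \<open>n\<close>, and so does the sum of their \<open>s\<close>-th powers, by the choice of \<open>s\<close> and \<open>t\<close>.\<close>

lemma hausdorff_measure_zero:
  assumes p: "p \<in> {1..CARD('n) - 1}" and s: "s > 0"
    and crit: "critical_exponent B \<Gamma> (unstable_jacobian p) < ereal t"
    and st: "(s = real p * t \<and> t \<ge> 1) \<or> (s = real p - 1 + t \<and> t \<le> 1)"
  shows "hausdorff_measure proj_space (proj_dist B) s (limit_set B \<Gamma> S) = 0"
proof -
  obtain D where D: "D > 0" and D_shadow: "\<And>L n. L \<in> limit_set B \<Gamma> S \<Longrightarrow> \<exists>\<gamma>\<in>\<Gamma>. wl \<gamma> = n \<and>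
     (\<exists>y. norm y = 1 \<and> L = span {R *v y} \<and>
     (\<forall>e f s. svd (mat_of \<gamma>) e f s \<longrightarrow> (\<forall>k\<in>{1..CARD('n)}. \<bar>y \<bullet> f k\<bar> \<le> D * s k / s 1)))"
    using limit_set_shadow by metis
  let ?d = "real CARD('n)"
  define G where "G n = {\<gamma> \<in> \<Gamma>. wl \<gamma> = n}" for n
  have finG: "finite (G n)" for n
    by (rule finite_subset[OF _ finite_ball[of n]]) (auto simp: G_def)
  define E where "E = (2 * D + 3) ^ (CARD('n) - 1) * (3 * ?d) powr s"
  have E0: "E > 0" using D by (simp add: E_def)
  have ratio: "(\<lambda>n. c * exp (- \<mu> * real n)) \<longlonglongrightarrow> 0"
  proof -
    have "(\<lambda>n. c * exp (- \<mu>) ^ n) \<longlonglongrightarrow> c * 0"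
      using \<mu> by (intro tendsto_mult_left LIMSEQ_realpow_zero) auto
    then show ?thesis by (simp add: exp_of_nat_mult[symmetric] mult.commute)
  qed
  have tail: "(\<lambda>n. \<Sum>\<gamma>\<in>G n. exp (- t * jac p \<gamma>)) \<longlonglongrightarrow> 0"
  proof (rule sum_exp_tail)
    show "Limsup at_top (\<lambda>T. ereal (1 / T) * ln_card {\<gamma> \<in> \<Gamma>. jac p \<gamma> < T}) < ereal t"
      using crit by (simp add: critical_exponent_def)
    fix n \<gamma> assume "\<gamma> \<in> G n"
    then have \<gamma>: "\<gamma> \<in> \<Gamma>" "wl \<gamma> = n" by (auto simp: G_def)
    obtain e f \<sigma> where S: "svd (mat_of \<gamma>) e f \<sigma>" using svd_exists[OF mat_of_invertible[OF \<gamma>(1)]] .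
    have "exp (- jac p \<gamma>) \<le> c * exp (- \<mu> * real (wl \<gamma>))"
      using jacobian_svd(4,5)[OF S p] sv_ratio_le[OF \<gamma>(1) S] by linarith
    then have "exp (- jac p \<gamma>) \<le> c * exp (- \<mu> * real n)" by (simp only: \<gamma>(2))
    also have "\<dots> = exp (ln c - \<mu> * real n)" using c by (simp add: exp_diff exp_minus field_simps)
    finally show "\<mu> * real n - ln c \<le> jac p \<gamma>" by simp
  qed (use finG \<mu> in \<open>auto simp: G_def\<close>)
  have bound: "hausdorff_premeasure proj_space (proj_dist B) s \<delta> (limit_set B \<Gamma> S)
      \<le> ennreal (E * (\<Sum>\<gamma>\<in>G n. exp (- t * jac p \<gamma>)))"
    if n: "?d * (D * (c * exp (- \<mu> * real n)))\<^sup>2 \<le> 3 / 4" "3 * ?d * (c * exp (- \<mu> * real n)) \<le> \<delta>" for n \<delta>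
  proof -
    have "\<exists>e f \<sigma>. svd (mat_of \<gamma>) e f \<sigma>" if "\<gamma> \<in> G n" for \<gamma>
    proof -
      have "\<gamma> \<in> \<Gamma>" using that by (simp add: G_def)
      from svd_exists[OF mat_of_invertible[OF this]] show ?thesis by blast
    qed
    then obtain e f \<sigma> where S: "\<And>\<gamma>. \<gamma> \<in> G n \<Longrightarrow> svd (mat_of \<gamma>) (e \<gamma>) (f \<gamma>) (\<sigma> \<gamma>)" by metis
    define x where "x \<gamma> = \<sigma> \<gamma> (p + 1) / \<sigma> \<gamma> 1" for \<gamma>
    have rat: "\<sigma> \<gamma> 2 / \<sigma> \<gamma> 1 \<le> c * exp (- \<mu> * real n)" if "\<gamma> \<in> G n" for \<gamma>
      using sv_ratio_le[OF _ S[OF that]] that by (auto simp: G_def)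
    have rat0: "0 < \<sigma> \<gamma> 2 / \<sigma> \<gamma> 1" if "\<gamma> \<in> G n" for \<gamma>
      using jacobian_svd(2,5)[OF S[OF that] p] by linarith
    have "\<exists>Z. finite Z \<and> shadow (f \<gamma>) (\<sigma> \<gamma>) D \<subseteq> (\<Union>z\<in>Z. cell (f \<gamma>) (x \<gamma>) z) \<and>
      real (card Z) \<le> (2 * D + 3) ^ (CARD('n) - 1) * (\<Prod>k=2..p. \<sigma> \<gamma> k / \<sigma> \<gamma> (p + 1))" if \<gamma>: "\<gamma> \<in> G n" for \<gamma>
    proof -
      have "(D * (\<sigma> \<gamma> 2 / \<sigma> \<gamma> 1))\<^sup>2 \<le> (D * (c * exp (- \<mu> * real n)))\<^sup>2"
        using rat[OF \<gamma>] rat0[OF \<gamma>] D by (intro power_mono mult_left_mono mult_nonneg_nonneg) auto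
      then have "?d * (D * (\<sigma> \<gamma> 2 / \<sigma> \<gamma> 1))\<^sup>2 \<le> ?d * (D * (c * exp (- \<mu> * real n)))\<^sup>2"
        by (intro mult_left_mono) auto
      then have "?d * (D * (\<sigma> \<gamma> 2 / \<sigma> \<gamma> 1))\<^sup>2 \<le> 3 / 4" using n(1) by linarith
      from shadow_covered[OF S[OF \<gamma>] D p this] show ?thesis unfolding x_def by metis
    qed
    then obtain Z where Z: "\<And>\<gamma>. \<gamma> \<in> G n \<Longrightarrow> finite (Z \<gamma>)"
      "\<And>\<gamma>. \<gamma> \<in> G n \<Longrightarrow> shadow (f \<gamma>) (\<sigma> \<gamma>) D \<subseteq> (\<Union>z\<in>Z \<gamma>. cell (f \<gamma>) (x \<gamma>) z)"
      "\<And>\<gamma>. \<gamma> \<in> G n \<Longrightarrow> real (card (Z \<gamma>)) \<le> (2 * D + 3) ^ (CARD('n) - 1) * (\<Prod>k=2..p. \<sigma> \<gamma> k / \<sigma> \<gamma> (p + 1))"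
      by metis
    have x0: "0 < x \<gamma>" "x \<gamma> \<le> c * exp (- \<mu> * real n)" if "\<gamma> \<in> G n" for \<gamma>
      using jacobian_svd(2,5)[OF S[OF that] p] rat[OF that] by (auto simp: x_def)
    let ?J = "Sigma (G n) Z"
    have "hausdorff_premeasure proj_space (proj_dist B) s \<delta> (limit_set B \<Gamma> S)
      \<le> ennreal (\<Sum>j\<in>?J. (3 * ?d * x (fst j)) powr s)"
    proof (rule hausdorff_premeasure_finite_cover[where V = "\<lambda>(\<gamma>, z). cell (f \<gamma>) (x \<gamma>) z"])
      show "finite ?J" using finG Z(1) by blast
      show "s > 0" by (rule s)
      show "limit_set B \<Gamma> S \<subseteq> (\<Union>j\<in>?J. case j of (\<gamma>, z) \<Rightarrow> cell (f \<gamma>) (x \<gamma>) z)"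
      proof
        fix L assume "L \<in> limit_set B \<Gamma> S"
        from D_shadow[OF this, of n] obtain \<gamma> y where \<gamma>: "\<gamma> \<in> G n" and y: "norm y = 1" "L = span {R *v y}"
          "\<And>e f s. svd (mat_of \<gamma>) e f s \<Longrightarrow> (\<forall>k\<in>{1..CARD('n)}. \<bar>y \<bullet> f k\<bar> \<le> D * s k / s 1)"
          by (auto simp: G_def)
        have "L \<in> shadow (f \<gamma>) (\<sigma> \<gamma>) D" using y(1,2) y(3)[OF S[OF \<gamma>]] by (auto simp: shadow_def)
        then show "L \<in> (\<Union>j\<in>?J. case j of (\<gamma>, z) \<Rightarrow> cell (f \<gamma>) (x \<gamma>) z)" using Z(2)[OF \<gamma>] \<gamma> by force
      qed
      fix j assume "j \<in> ?J"
      then obtain \<gamma> z where j: "j = (\<gamma>, z)" "\<gamma> \<in> G n" by auto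
      show "(case j of (\<gamma>, z) \<Rightarrow> cell (f \<gamma>) (x \<gamma>) z) \<subseteq> proj_space" by (simp add: j cell_subset)
      show "proj_dist B L L' \<le> 3 * ?d * x (fst j)"
        if "L \<in> (case j of (\<gamma>, z) \<Rightarrow> cell (f \<gamma>) (x \<gamma>) z)" "L' \<in> (case j of (\<gamma>, z) \<Rightarrow> cell (f \<gamma>) (x \<gamma>) z)" for L L'
        using cell_diameter[OF svdD(2)[OF S[OF j(2)]] x0(1)[OF j(2)]] that by (simp add: j)
      have "3 * ?d * x \<gamma> \<le> 3 * ?d * (c * exp (- \<mu> * real n))"
        using x0(2)[OF j(2)] by (intro mult_left_mono) auto
      then have "3 * ?d * x \<gamma> \<le> \<delta>" using n(2) by (rule order_trans)
      then show "0 \<le> 3 * ?d * x (fst j) \<and> 3 * ?d * x (fst j) \<le> \<delta>"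
        using x0(1)[OF j(2)] by (simp add: j)
    qed
    also have "\<dots> \<le> ennreal (E * (\<Sum>\<gamma>\<in>G n. exp (- t * jac p \<gamma>)))"
    proof (rule ennreal_leI)
      have "(\<Sum>j\<in>?J. (3 * ?d * x (fst j)) powr s) = (\<Sum>\<gamma>\<in>G n. \<Sum>z\<in>Z \<gamma>. (3 * ?d * x \<gamma>) powr s)"
        using sum.Sigma[of "G n" Z "\<lambda>\<gamma> z. (3 * ?d * x \<gamma>) powr s"] finG Z(1)
        by (simp add: case_prod_unfold del: sum_constant)
      also have "\<dots> = (\<Sum>\<gamma>\<in>G n. real (card (Z \<gamma>)) * (3 * ?d * x \<gamma>) powr s)" by simp
      also have "\<dots> \<le> (\<Sum>\<gamma>\<in>G n. E * exp (- t * jac p \<gamma>))"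
      proof (intro sum_mono)
        fix \<gamma> assume \<gamma>: "\<gamma> \<in> G n"
        define Q where "Q = exp (- jac p \<gamma>)"
        have J: "Q / x \<gamma> ^ p = (\<Prod>k=2..p. \<sigma> \<gamma> k / \<sigma> \<gamma> (p + 1))" "x \<gamma> ^ p \<le> Q" "Q \<le> x \<gamma>"
          using jacobian_svd[OF S[OF \<gamma>] p] by (simp_all add: Q_def x_def)
        have Q0: "Q > 0" by (simp add: Q_def)
        have main: "Q / x \<gamma> ^ p * x \<gamma> powr s \<le> Q powr t"
          using st powr_exponent_high[OF Q0 x0(1)[OF \<gamma>] J(2)] powr_exponent_low[OF Q0 J(3)] by auto
        have "real (card (Z \<gamma>)) * (3 * ?d * x \<gamma>) powr s
            \<le> ((2 * D + 3) ^ (CARD('n) - 1) * (Q / x \<gamma> ^ p)) * ((3 * ?d) powr s * x \<gamma> powr s)"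
          using Z(3)[OF \<gamma>] x0(1)[OF \<gamma>] unfolding J(1)
          by (subst powr_mult) (auto intro!: mult_right_mono)
        also have "\<dots> = E * (Q / x \<gamma> ^ p * x \<gamma> powr s)" by (simp add: E_def)
        also have "\<dots> \<le> E * Q powr t" using main E0 by (intro mult_left_mono) auto
        also have "Q powr t = exp (- t * jac p \<gamma>)" by (simp add: Q_def powr_def)
        finally show "real (card (Z \<gamma>)) * (3 * ?d * x \<gamma>) powr s \<le> E * exp (- t * jac p \<gamma>)" .
      qed
      also have "\<dots> = E * (\<Sum>\<gamma>\<in>G n. exp (- t * jac p \<gamma>))" by (simp add: sum_distrib_left)
      finally show "(\<Sum>j\<in>?J. (3 * ?d * x (fst j)) powr s) \<le> E * (\<Sum>\<gamma>\<in>G n. exp (- t * jac p \<gamma>))" .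
    qed
    finally show ?thesis .
  qed
  have "hausdorff_premeasure proj_space (proj_dist B) s \<delta> (limit_set B \<Gamma> S) \<le> 0" if \<delta>: "\<delta> > 0" for \<delta>
  proof -
    have "(\<lambda>n. ?d * (D * (c * exp (- \<mu> * real n)))\<^sup>2) \<longlonglongrightarrow> ?d * (D * 0)\<^sup>2" by (intro tendsto_intros ratio)
    then have 1: "\<forall>\<^sub>F n in sequentially. ?d * (D * (c * exp (- \<mu> * real n)))\<^sup>2 < 3 / 4"
      by (rule order_tendstoD) simp
    have "(\<lambda>n. 3 * ?d * (c * exp (- \<mu> * real n))) \<longlonglongrightarrow> 3 * ?d * 0" by (intro tendsto_intros ratio)
    then have 2: "\<forall>\<^sub>F n in sequentially. 3 * ?d * (c * exp (- \<mu> * real n)) < \<delta>"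
      by (rule order_tendstoD) (simp add: \<delta>)
    have "(\<lambda>n. E * (\<Sum>\<gamma>\<in>G n. exp (- t * jac p \<gamma>))) \<longlonglongrightarrow> E * 0" by (intro tendsto_intros tail)
    then have "(\<lambda>n. ennreal (E * (\<Sum>\<gamma>\<in>G n. exp (- t * jac p \<gamma>)))) \<longlonglongrightarrow> ennreal (E * 0)"
      by (rule tendsto_ennrealI)
    then have lim: "(\<lambda>n. ennreal (E * (\<Sum>\<gamma>\<in>G n. exp (- t * jac p \<gamma>)))) \<longlonglongrightarrow> 0" by simp
    have ev: "\<forall>\<^sub>F n in sequentially. hausdorff_premeasure proj_space (proj_dist B) s \<delta> (limit_set B \<Gamma> S)
        \<le> ennreal (E * (\<Sum>\<gamma>\<in>G n. exp (- t * jac p \<gamma>)))"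
      using 1 2 by eventually_elim (intro bound less_imp_le)
    show ?thesis by (rule tendsto_lowerbound[OF lim ev]) simp
  qed
  then show ?thesis unfolding hausdorff_measure_def by (intro antisym SUP_least) auto
qed

end

text \<open>If the bound fails, there is an admissible pair \<open>s\<close>, \<open>t\<close> with \<open>t\<close> above the critical exponent and \<open>s\<close> below
the dimension.\<close>

theorem corollary1p1:
  fixes B :: "real^'n \<Rightarrow> real^'n \<Rightarrow> real"
    and \<Gamma> S :: "(real^'n^'n) set set"
    and p :: nat
  assumes "CARD('n) \<ge> 2"
    and "is_scalar_product B"
    and "projective_anosov B \<Gamma>"
    and "finite_gen_set PGL \<Gamma> S"
    and "p \<in> {1..CARD('n) - 1}"
    and "hausdorff_dim proj_space (proj_dist B) (limit_set B \<Gamma> S) \<ge> ereal (real p)"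
  shows "hausdorff_dim proj_space (proj_dist B) (limit_set B \<Gamma> S)
           \<le> ereal (real p) * critical_exponent B \<Gamma> (unstable_jacobian p)"
proof (rule ccontr)
  define h where "h = critical_exponent B \<Gamma> (unstable_jacobian p)"
  let ?dim = "hausdorff_dim proj_space (proj_dist B) (limit_set B \<Gamma> S)"
  assume "\<not> ?thesis"
  then have less: "ereal (real p) * h < ?dim" by (simp add: h_def)
  obtain P R where chart: "euclidean_chart B P R" using euclidean_chart_exists[OF assms(2)] .
  obtain c \<mu> where c: "c > 0" "\<mu> > 0"
    "\<And>\<gamma>. \<gamma> \<in> \<Gamma> \<Longrightarrow> sv B \<gamma> 2 / sv B \<gamma> 1 \<le> c * exp (- \<mu> * real (word_length PGL S \<gamma>))"
    using anosov_gap[OF assms(3,4)] by blast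
  have "subgroup \<Gamma> PGL" using assms(3) by (simp add: projective_anosov_def)
  then interpret anosov_chart B P R \<Gamma> S c \<mu>
    using chart c assms(1,4) by (simp add: anosov_chart_def anosov_chart_axioms_def)
  have p: "real p \<ge> 1" using assms(5) by simp
  have contra: False
    if "s > 0" "ereal s < ?dim" "h < ereal t" "(s = real p * t \<and> t \<ge> 1) \<or> (s = real p - 1 + t \<and> t \<le> 1)" for s t
  proof -
    have "hausdorff_measure proj_space (proj_dist B) s (limit_set B \<Gamma> S) = 0"
      using hausdorff_measure_zero[OF assms(5) that(1) _ that(4)] that(3) by (simp add: h_def)
    then have "?dim \<le> ereal s" unfolding hausdorff_dim_def using that(1) by (intro Inf_lower) auto
    then show False using that(2) by simp
  qed
  show False
  proof (cases "h < 1")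
    case True
    \<comment> \<open>The positivity of \<open>t\<close> makes \<open>s = p - 1 + t\<close> positive also for \<open>p = 1\<close>.\<close>
    then obtain t where t: "max h 0 < ereal t" "ereal t < 1"
      using ereal_dense2[of "max h 0" 1] by auto
    then have t': "h < ereal t" "0 < t" "t < 1" by auto
    have "ereal (real p - 1 + t) < ereal (real p)" using t' by simp
    then have "ereal (real p - 1 + t) < ?dim" using assms(6) by (rule less_le_trans)
    then show False using contra[of "real p - 1 + t" t] t' p by simp
  next
    case False
    then have h1: "1 \<le> h" by simp
    moreover have "h \<noteq> \<infinity>" using less p by auto
    ultimately obtain h0 where h0: "h = ereal h0" "h0 \<ge> 1" by (cases h) auto
    have "ereal (real p * h0) < ?dim" using less by (simp add: h0)
    then obtain s where s: "ereal (real p * h0) < ereal s" "ereal s < ?dim"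
      using ereal_dense2 by blast
    have ps: "real p * h0 < s" using s(1) by simp
    then have hs: "h0 < s / real p" using p by (simp add: pos_less_divide_eq mult.commute)
    have "real p * 1 \<le> real p * h0" using h0(2) by (intro mult_left_mono) auto
    then have "real p \<le> s" "s > 0" using ps p by linarith+
    then show False using contra[of s "s / real p"] s(2) p h0 hs by auto
  qed
qed

end
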